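(* Let $X$ be a compact metric space, $Y\subset[-1,1]$ compact, $Z:=X\times Y$, and let $H$ be the RKHS of a continuous kernel over $X$ with closed unit ball $B_H$ and with $\|f\|_\infty\le\|f\|_H$ for all $f\in H$. Assume there are constants $a\ge 1$ and $0<p<2$ such that for all $n\ge1$ and all $\delta>0$, $$\sup_{T\in Z^n}\log\mathcal N(B_H,\delta,L_2(T_X))\le a\,\delta^{-p}.$$ Let $L:Y\times\mathbb R\to[0,\infty)$ be continuous, convex in its second variable, and satisfy, for some constants $\alpha\in[1,2]$ and $c_L>0$ and all $t\ge 0$, $$\sup_{y\in Y}L(y,t)\le 1+|t|^\alpha\quad(\text{for all }t\in\mathbb R),\qquad \sup_{y\in Y}\big|L(y,\cdot)|_{[-t,t]}\big|_1\le c_L\,t^{\alpha-1},$$ where $|h|_1$ denotes the Lipschitz constant of $h$. Let $P$ be a Borel probability measure on $X\times Y$ such that a minimizer $f^*_{L,P}$ of the $L$-risk over all measurable functions exists. Suppose that for all $0<\lambda\le1$ and all $f\in\lambda^{-1/2}B_H$, $$\mathbb E_P\big(L\circ f-L\circ f^*_{L,P}\big)^2\le c\,(\|f\|_\infty+1)^v\Big(\mathbb E_P\big(L\circ f-L\circ f^*_{L,P}\big)\Big)^{\vartheta}$$ for some constants $c\ge1$, $\vartheta\in(0,1]$, $v\in[0,2]$. Then there exists a constant $K\ge1$ such that for all $n\ge 1$, $0<\lambda\le1$, $\varepsilon>0$, $x\ge1$ satisfying $$\varepsilon\ge\max\Big\{a(\lambda)+\lambda,\ \Big(\tfrac{Ka}{\lambda^{\frac{2\alpha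 p+v(2-p)}{4}}n}\Big)^{\frac{4}{8-2\alpha p-(v+2\vartheta)(2-p)}},\ \Big(\tfrac{Ka}{\lambda^{\frac{\alpha(2+p)}{4}}n}\Big)^{\frac{4}{(2+p)(2-\alpha)}},\ \Big(\tfrac{Kx}{\lambda^{\frac{v}{2}}n}\Big)^{\frac{2}{4-v-2\vartheta}},\ \Big(\tfrac{Kx}{\lambda^{\frac{\alpha}{2}}n}\Big)^{\frac{2}{2-\alpha}}\Big\}$$ we have $$\Pr{}^*\big(T\in Z^n:\ \mathcal R_{L,P}(f_{T,\lambda})-\mathcal R^*_{L,P}<a(\lambda)+\varepsilon\big)\ge1-e^{-x},$$ where $\Pr^*$ denotes outer probability with respect to $P^n$.
   Context: For a measurable $f:X\to\mathbb R$, $L\circ f$ denotes the function $(x,y)\mapsto L(y,f(x))$, $\mathcal R_{L,P}(f):=\mathbb E_{(x,y)\sim P}L(y,f(x))$, and $\mathcal R^*_{L,P}:=\inf\{\mathcal R_{L,P}(f): f:X\to\mathbb R\text{ measurable}\}$; $f^*_{L,P}$ is a measurable function attaining this infimum. For $\lambda>0$, $f_{P,\lambda}:=\arg\min_{f\in H}(\lambda\|f\|_H^2+\mathcal R_{L,P}(f))$, and for a sample $T=((x_1,y_1),\dots,(x_n,y_n))\in Z^n$, $f_{T,\lambda}$ denotes the same minimizer with $P$ replaced by the empirical measure of $T$. The approximation error function is $a(\lambda):=\lambda\|f_{P,\lambda}\|_H^2+\mathcal R_{L,P}(f_{P,\lambda})-\mathcal R^*_{L,P}$ (not to be confused with the constant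 $a$). For $T_X=(x_1,\dots,x_n)$, $L_2(T_X)$ is the space of (classes of) functions on $X$ with norm $\|f\|_{L_2(T_X)}=(\frac1n\sum_i f(x_i)^2)^{1/2}$. For a subset $A$ of a Banach space $E$ with closed unit ball $B_E$, $\mathcal N(A,\varepsilon,E):=\min\{m\ge1:\exists x_1,\dots,x_m\in E,\ A\subset\bigcup_i(x_i+\varepsilon B_E)\}$. Conventions: $0^0:=1$, and when an exponent equals $+\infty$ (e.g. $\frac{2}{2-\alpha}$ with $\alpha=2$), $s^\infty:=0$ for $0\le s<1$, $:=1$ for $s=1$, $:=\infty$ for $s>1$. *)

theory Defs
  imports "HOL-Analysis.Analysis" "HOL-Probability.Probability"
begin

text \<open>The RKHS H is represented by a Hilbert space type 'h together with the canonical
  feature map Phi :: 'x => 'h; the element h of 'h is the function (\<lambda>x. h \<bullet> Phi x),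
  with H-norm norm h. The kernel is k x x' = Phi x \<bullet> Phi x'.\<close>

definition rkhs_fun :: "('x \<Rightarrow> 'h::real_inner) \<Rightarrow> 'h \<Rightarrow> 'x \<Rightarrow> real" where
  "rkhs_fun Phi h = (\<lambda>x. h \<bullet> Phi x)"

definition is_rkhs_cont_kernel :: "('x::metric_space \<Rightarrow> 'h::{real_inner,complete_space}) \<Rightarrow> bool" where
  "is_rkhs_cont_kernel Phi \<longleftrightarrow>
     inj (rkhs_fun Phi) \<and> continuous_on UNIV (\<lambda>(x, x'). Phi x \<bullet> Phi x')"

definition sup_norm :: "('x \<Rightarrow> real) \<Rightarrow> real" where
  "sup_norm f = (SUP x. \<bar>f x\<bar>)"

definition L2_emp_norm :: "nat \<Rightarrow> (nat \<Rightarrow> 'x) \<Rightarrow> ('x \<Rightarrow> real) \<Rightarrow> real" where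
  "L2_emp_norm n xs f = sqrt ((1 / real n) * (\<Sum>i<n. (f (xs i))\<^sup>2))"

text \<open>Covering number N(B_H, delta, L_2(T_X)); centres are arbitrary functions on X
  (representatives of elements of L_2(T_X)).\<close>
definition cov_num_BH :: "('x \<Rightarrow> 'h::real_inner) \<Rightarrow> nat \<Rightarrow> (nat \<Rightarrow> 'x) \<Rightarrow> real \<Rightarrow> nat" where
  "cov_num_BH Phi n xs \<delta> = (LEAST m. m \<ge> 1 \<and> (\<exists>g :: nat \<Rightarrow> 'x \<Rightarrow> real.
      \<forall>h. norm h \<le> 1 \<longrightarrow> (\<exists>i<m. L2_emp_norm n xs (\<lambda>x. rkhs_fun Phi h x - g i x) \<le> \<delta>)))"

definition risk :: "('x \<times> real) measure \<Rightarrow> (real \<Rightarrow> real \<Rightarrow> real) \<Rightarrow> ('x \<Rightarrow> real) \<Rightarrow> real" where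
  "risk P L f = (\<integral>z. L (snd z) (f (fst z)) \<partial>P)"

text \<open>Bayes risk: infimum over all measurable f. Since L is nonnegative, functions with
  non-integrable loss have risk +infinity and do not affect the infimum.\<close>
definition bayes_risk :: "('x::topological_space \<times> real) measure \<Rightarrow> (real \<Rightarrow> real \<Rightarrow> real) \<Rightarrow> real" where
  "bayes_risk P L = Inf {risk P L f | f. f \<in> borel_measurable borel \<and>
      integrable P (\<lambda>z. L (snd z) (f (fst z)))}"

definition f_P_lam :: "('x \<Rightarrow> 'h::real_inner) \<Rightarrow> ('x \<times> real) measure \<Rightarrow> (real \<Rightarrow> real \<Rightarrow> real) \<Rightarrow> real \<Rightarrow> 'h" where
  "f_P_lam Phi P L lam = (SOME h. \<forall>g. lam * (norm h)\<^sup>2 + risk P L (rkhs_fun Phi h)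
                               \<le> lam * (norm g)\<^sup>2 + risk P L (rkhs_fun Phi g))"

definition emp_risk :: "nat \<Rightarrow> (nat \<Rightarrow> 'x \<times> real) \<Rightarrow> (real \<Rightarrow> real \<Rightarrow> real) \<Rightarrow> ('x \<Rightarrow> real) \<Rightarrow> real" where
  "emp_risk n T L f = (1 / real n) * (\<Sum>i<n. L (snd (T i)) (f (fst (T i))))"

definition f_T_lam :: "('x \<Rightarrow> 'h::real_inner) \<Rightarrow> nat \<Rightarrow> (nat \<Rightarrow> 'x \<times> real) \<Rightarrow> (real \<Rightarrow> real \<Rightarrow> real) \<Rightarrow> real \<Rightarrow> 'h" where
  "f_T_lam Phi n T L lam = (SOME h. \<forall>g. lam * (norm h)\<^sup>2 + emp_risk n T L (rkhs_fun Phi h)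
                               \<le> lam * (norm g)\<^sup>2 + emp_risk n T L (rkhs_fun Phi g))"

definition approx_err :: "('x::topological_space \<Rightarrow> 'h::real_inner) \<Rightarrow> ('x \<times> real) measure \<Rightarrow> (real \<Rightarrow> real \<Rightarrow> real) \<Rightarrow> real \<Rightarrow> real" where
  "approx_err Phi P L lam = lam * (norm (f_P_lam Phi P L lam))\<^sup>2
      + risk P L (rkhs_fun Phi (f_P_lam Phi P L lam)) - bayes_risk P L"

definition outer_prob :: "'a measure \<Rightarrow> 'a set \<Rightarrow> real" where
  "outer_prob M A = Inf {measure M B | B. B \<in> sets M \<and> A \<subseteq> B}"

text \<open>s ^ (num/den) with the convention s^infinity = 0 (s<1), 1 (s=1), infinity (s>1)
  when den = 0 (num > 0 in all uses).\<close>
definition epow :: "real \<Rightarrow> real \<Rightarrow> real \<Rightarrow> ereal" where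
  "epow s num den = (if den = 0 then (if s < 1 then 0 else if s = 1 then 1 else \<infinity>)
                     else ereal (s powr (num / den)))"

end

theory Submission
  imports Defs
begin

text \<open>
  Put \<open>G = \<epsilon> / lam\<close>, which is at least 1. If the empirical minimizer violates the claim, convexity and the
  intermediate value theorem produce a point \<open>h\<close> on the segment from \<open>f_P_lam\<close> to \<open>f_T_lam\<close> with
  regularized excess risk exactly \<open>approx_err + \<epsilon> \<le> 2\<epsilon>\<close> and with empirical regularized risk at most that of
  \<open>f_P_lam\<close>. Then \<open>norm h\<close> is of order \<open>sqrt G\<close>, the excess loss of \<open>h\<close> has second moment of order
  \<open>G powr (v/2) * \<epsilon> powr theta\<close>, and the empirical mean of \<open>L \<circ> h - L \<circ> f_P_lam\<close> falls short of its
  expectation by at least \<open>\<epsilon>\<close>. The functions to be controlled are bounded by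
  \<open>B \<approx> G powr (\<alpha>/2)\<close> and have \<open>L\<^sub>2\<close>-entropy \<open>a * (B / \<delta>) powr p\<close>.

  Such a deviation is excluded by symmetrization with a ghost sample and Rademacher chaining conditionally
  on the double sample; with \<open>\<sigma>\<^sup>2 \<approx> G powr (v/2) * \<epsilon> powr theta + B * \<epsilon>\<close> it suffices that
  \<open>a * B powr p * \<sigma> powr (2 - p)\<close> and \<open>x * \<sigma>\<^sup>2\<close> are small compared with \<open>n * \<epsilon>\<^sup>2\<close>, and the two summands of
  \<open>\<sigma>\<^sup>2\<close> turn these two conditions into the four lower bounds on \<open>\<epsilon>\<close> that involve \<open>K\<close>.
  Measurability causes no trouble because the class is first replaced by a finite net in the sup norm.
\<close>

section \<open>Rademacher sums\<close>

text \<open>Two obstacles shape the argument. Nothing bounds \<open>L \<circ> fstar\<close> in the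
  sup norm, so the reference function is \<open>f_P_lam\<close>: differences of losses of
  norm-bounded RKHS functions are bounded, and the second-moment hypothesis, which is about
  \<open>fstar\<close>, reaches these differences by comparing both losses with that of
  \<open>fstar\<close>. Moreover, chaining needs a small second moment on the sample itself, whereas
  the hypotheses bound it only under \<open>P\<close>. A second symmetrization argument, applied to
  squares, transfers the bound; its failure probability is of order
  \<open>exp (entropy - 2 * n * \<sigma>\<^sup>2 / B\<^sup>2)\<close>, and the summand
  \<open>B * \<epsilon>\<close> of \<open>\<sigma>\<^sup>2\<close> makes this exponent comparable
  with the exponent \<open>n * \<epsilon>\<^sup>2 / \<sigma>\<^sup>2\<close> of the chaining bound.

  No probability space of signs is introduced. A sign vector is the set \<open>I\<close> of its
  negative coordinates, probabilities are cardinalities inside \<open>Pow {..<n}\<close> divided by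
  \<open>2 ^ n\<close>, and symmetrization averages over the swaps that exchange observation
  \<open>i\<close> with its ghost for all \<open>i \<in> I\<close>.\<close>

definition signed_sum :: "nat \<Rightarrow> nat set \<Rightarrow> (nat \<Rightarrow> real) \<Rightarrow> real" where
  "signed_sum n I v = (\<Sum>i<n. if i \<in> I then - v i else v i)"

text \<open>The difference of the two sides vanishes at 0 and has derivative
  \<open>t * sinh t\<close>. It supplies the sign of the derivative in the next lemma.\<close>

lemma sinh_le_mult_cosh:
  fixes x :: real
  assumes "0 \<le> x"
  shows "sinh x \<le> x * cosh x"
proof -
  have "\<exists>y. ((\<lambda>x. x * cosh x - sinh x) has_real_derivative y) (at t) \<and> 0 \<le> y"
    if "0 \<le> t" for t :: real
    using that by (intro exI[of _ "t * sinh t"] conjI derivative_eq_intros | simp)+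
  from DERIV_nonneg_imp_nondecreasing[OF assms this]
  show ?thesis by simp
qed

text \<open>The right side is the moment generating function of a standard Gaussian, so this is the
  sub-Gaussian bound for one fair sign. It holds because
  \<open>- cosh x * exp (- x\<^sup>2 / 2)\<close> starts at -1 and increases on the half
  line.\<close>

lemma cosh_le_exp_half_square: "cosh x \<le> exp (x\<^sup>2 / 2)" for x :: real
proof -
  have *: "cosh x \<le> exp (x\<^sup>2 / 2)" if "0 \<le> x" for x :: real
  proof -
    have "\<exists>y. ((\<lambda>x. - cosh x * exp (- x\<^sup>2 / 2)) has_real_derivative y) (at t) \<and> 0 \<le> y"
      if "0 \<le> t" for t :: real
    proof (intro exI conjI)
      show "((\<lambda>x. - cosh x * exp (- x\<^sup>2 / 2)) has_real_derivative
          (t * cosh t - sinh t) * exp (- t\<^sup>2 / 2)) (at t)"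
        by (auto intro!: derivative_eq_intros simp: algebra_simps)
      show "0 \<le> (t * cosh t - sinh t) * exp (- t\<^sup>2 / 2)"
        using sinh_le_mult_cosh[OF that] by simp
    qed
    from DERIV_nonneg_imp_nondecreasing[OF that this]
    have "cosh x * exp (- x\<^sup>2 / 2) \<le> 1" by simp
    then show ?thesis by (simp add: exp_minus field_simps)
  qed
  show ?thesis using *[of "\<bar>x\<bar>"] by simp
qed

text \<open>Independence of the signs appears as an expansion of a product: the sum over all sign
  patterns is what \<open>\<Prod>i<n. exp (- v i) + exp (v i)\<close> multiplies out to, and each
  factor is twice a \<open>cosh\<close>.\<close>

lemma sum_Pow_exp_signed_sum_le:
  "(\<Sum>I\<in>Pow {..<n}. exp (signed_sum n I v)) \<le> 2 ^ n * exp ((\<Sum>i<n. (v i)\<^sup>2) / 2)"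
proof -
  have "exp (signed_sum n I v) = (\<Prod>i\<in>I. exp (- v i)) * (\<Prod>i\<in>{..<n} - I. exp (v i))"
    if "I \<in> Pow {..<n}" for I
  proof -
    have fin: "finite I" using that finite_subset by auto
    have "signed_sum n I v = (\<Sum>i\<in>I. - v i) + (\<Sum>i\<in>{..<n} - I. v i)"
    proof -
      have "signed_sum n I v = (\<Sum>i\<in>I. if i \<in> I then - v i else v i)
          + (\<Sum>i\<in>{..<n} - I. if i \<in> I then - v i else v i)"
        unfolding signed_sum_def using that
        by (subst sum.subset_diff[of I]) auto
      then show ?thesis by simp
    qed
    then show ?thesis by (simp add: exp_add exp_sum fin)
  qed
  then have "(\<Sum>I\<in>Pow {..<n}. exp (signed_sum n I v))
      = (\<Sum>I\<in>Pow {..<n}. (\<Prod>i\<in>I. exp (- v i)) * (\<Prod>i\<in>{..<n} - I. exp (v i)))"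
    by (rule sum.cong[OF refl])
  also have "\<dots> = (\<Prod>i<n. exp (- v i) + exp (v i))"
    by (rule prod_add[symmetric]) simp
  also have "\<dots> \<le> (\<Prod>i<n. 2 * exp ((v i)\<^sup>2 / 2))"
  proof (rule prod_mono, intro conjI)
    fix i
    show "exp (- v i) + exp (v i) \<le> 2 * exp ((v i)\<^sup>2 / 2)"
      using cosh_le_exp_half_square[of "v i"] by (simp add: cosh_def)
  qed (simp add: add_nonneg_nonneg)
  also have "\<dots> = 2 ^ n * exp ((\<Sum>i<n. (v i)\<^sup>2) / 2)"
    by (simp add: prod.distrib exp_sum sum_divide_distrib)
  finally show ?thesis .
qed

lemma card_signed_sum_ge_le:
  assumes Q: "(\<Sum>i<n. (v i)\<^sup>2) \<le> Q" "0 < Q" and t: "0 \<le> t"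
  shows "real (card {I \<in> Pow {..<n}. t \<le> signed_sum n I v}) \<le> 2 ^ n * exp (- t\<^sup>2 / (2 * Q))"
proof -
  let ?S = "{I \<in> Pow {..<n}. t \<le> signed_sum n I v}"
  \<comment> \<open>Chernoff parameter: \<open>t / Q\<close> minimizes the exponent
    \<open>s\<^sup>2 * Q / 2 - s * t\<close>.\<close>
  define s where "s = t / Q"
  have s: "0 \<le> s" using Q t by (simp add: s_def)
  have sc: "signed_sum n I (\<lambda>i. s * v i) = s * signed_sum n I v" for I
    unfolding signed_sum_def sum_distrib_left by (rule sum.cong) auto
  have "real (card ?S) * exp (s * t) = (\<Sum>I\<in>?S. exp (s * t))" by simp
  also have "\<dots> \<le> (\<Sum>I\<in>?S. exp (signed_sum n I (\<lambda>i. s * v i)))"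
    by (rule sum_mono) (auto simp: sc intro!: mult_left_mono s)
  also have "\<dots> \<le> (\<Sum>I\<in>Pow {..<n}. exp (signed_sum n I (\<lambda>i. s * v i)))"
    by (rule sum_mono2) auto
  also have "\<dots> \<le> 2 ^ n * exp ((\<Sum>i<n. (s * v i)\<^sup>2) / 2)"
    by (rule sum_Pow_exp_signed_sum_le)
  also have "\<dots> \<le> 2 ^ n * exp (s\<^sup>2 * Q / 2)"
    using Q by (simp add: power_mult_distrib sum_distrib_left[symmetric] mult_left_mono)
  finally have "real (card ?S) \<le> 2 ^ n * exp (s\<^sup>2 * Q / 2) / exp (s * t)"
    by (simp add: field_simps)
  also have "\<dots> = 2 ^ n * exp (s\<^sup>2 * Q / 2 - s * t)" by (simp add: exp_diff)
  also have "s\<^sup>2 * Q / 2 - s * t = - t\<^sup>2 / (2 * Q)"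
    using Q by (simp add: s_def field_simps power2_eq_square)
  finally show ?thesis .
qed

lemma signed_sum_diff: "signed_sum n I (\<lambda>i. u i - w i) = signed_sum n I u - signed_sum n I w"
  unfolding signed_sum_def sum_subtractf[symmetric] by (rule sum.cong) auto

text \<open>Cauchy-Schwarz against the vector of signs. Being valid for every sign pattern, it
  disposes of the tail of a chain without any cost in probability.\<close>

lemma signed_sum_le:
  assumes "(\<Sum>i<n. (v i)\<^sup>2) \<le> real n * d\<^sup>2" "0 \<le> d"
  shows "signed_sum n I v \<le> real n * d"
proof -
  have "(signed_sum n I v)\<^sup>2 \<le> (\<Sum>i<n. (if i \<in> I then -1 else 1)\<^sup>2) * (\<Sum>i<n. (v i)\<^sup>2)"
    using Cauchy_Schwarz_ineq_sum[of "\<lambda>i. if i \<in> I then -1 else 1" v "{..<n}"]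
    unfolding signed_sum_def by (simp add: if_distrib[of "\<lambda>c. c * _"] cong: if_cong)
  also have "(\<Sum>i<n. (if i \<in> I then -1 else 1::real)\<^sup>2) = (\<Sum>i<n. 1)"
    by (rule sum.cong) auto
  also have "(\<Sum>i<n. 1) * (\<Sum>i<n. (v i)\<^sup>2) \<le> real n * (real n * d\<^sup>2)"
    using assms by (simp add: mult_left_mono)
  also have "\<dots> = (real n * d)\<^sup>2" by (simp add: power2_eq_square)
  finally show ?thesis using assms by (meson abs_le_square_iff abs_le_D1 abs_of_nonneg mult_nonneg_nonneg of_nat_0_le_iff power2_le_imp_le)
qed

section \<open>Chaining for Rademacher sums under polynomial entropy growth\<close>

definition chain_ratio :: "real \<Rightarrow> real" where
  "chain_ratio p = 2 powr (p / 2 - 1)"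

definition chain_const :: "real \<Rightarrow> real" where
  "chain_const p = 144 / (1 - chain_ratio p)\<^sup>2 * (3 + 1 / (2 powr p - 1))"

lemma chain_ratio_bounds:
  assumes "p < 2" shows "0 < chain_ratio p" "chain_ratio p < 1"
  using assms by (auto simp: chain_ratio_def powr_less_one)

text \<open>The identity that dictates the ratio. Halving the radius multiplies an exponent (step /
  radius) squared by \<open>4 * (chain_ratio p)\<^sup>2\<close>, and it multiplies the entropy by
  \<open>2 powr p\<close>; the two are made equal. The steps are then summable exactly because
  \<open>p < 2\<close>.\<close>

lemma chain_ratio_square: "4 * (chain_ratio p)\<^sup>2 = 2 powr p"
proof -
  have "(chain_ratio p)\<^sup>2 = 2 powr (p - 2)"
    by (simp add: chain_ratio_def power2_eq_square powr_add[symmetric])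
  also have "\<dots> = 2 powr p / 2 powr 2" by (simp add: powr_diff)
  finally show ?thesis by simp
qed

lemma chain_const_ge:
  assumes "0 < p" "p < 2" shows "432 \<le> chain_const p"
proof -
  have "1 \<le> 1 / (1 - chain_ratio p)\<^sup>2"
    using chain_ratio_bounds[OF assms(2)] by (simp add: field_simps power_le_one)
  moreover have "0 < 1 / (2 powr p - 1)" using assms by simp
  ultimately have "1 * 3 \<le> (1 / (1 - chain_ratio p)\<^sup>2) * (3 + 1 / (2 powr p - 1))"
    by (intro mult_mono) auto
  then have "144 * 3 \<le> 144 * (1 / (1 - chain_ratio p)\<^sup>2 * (3 + 1 / (2 powr p - 1)))" by linarith
  also have "\<dots> = chain_const p" by (simp add: chain_const_def)
  finally show ?thesis by simp
qed

text \<open>The exponent budget of link \<open>k\<close>: with step sizes proportional to \<open>chain_ratio p ^ k\<close>,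
  the sub-Gaussian exponent and the entropy both grow like \<open>(2 powr p) ^ k\<close>.\<close>

lemma chain_link_budget:
  assumes p: "0 < p" "p < 2" and A: "0 \<le> A" and x: "1 \<le> x" and D: "0 < D"
    and h1: "chain_const p * A * D powr (2 - p) \<le> N"
    and h2: "chain_const p * x * D\<^sup>2 \<le> N"
  shows "2 * A * (D / 2 ^ k) powr - p + x + 2 + real k
    \<le> N * ((1 - chain_ratio p) * chain_ratio p ^ k / 2)\<^sup>2 / (18 * (D / 2 ^ k)\<^sup>2)"
proof -
  define r where "r = chain_ratio p"
  define \<Theta> where "\<Theta> = 2 powr p"
  have r: "0 < r" "r < 1" using chain_ratio_bounds[OF p(2)] by (auto simp: r_def)
  have \<Theta>: "1 < \<Theta>" using p by (simp add: \<Theta>_def)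
  have r2: "4 * r\<^sup>2 = \<Theta>" by (simp add: r_def \<Theta>_def chain_ratio_square)
  have pw: "(D / 2 ^ k) powr - p = D powr - p * \<Theta> ^ k"
  proof -
    have "(2 ^ k) powr - p = (1 / \<Theta>) ^ k"
      by (simp add: \<Theta>_def powr_minus powr_realpow[symmetric] powr_powr mult.commute power_divide inverse_eq_divide)
    then show ?thesis using D by (simp add: powr_divide power_divide)
  qed
  have kc: "chain_const p = 144 / (1 - r)\<^sup>2 * (3 + 1 / (\<Theta> - 1))"
    by (simp add: chain_const_def r_def \<Theta>_def)
  \<comment> \<open>\<open>w\<close> is half the coefficient of \<open>\<Theta> ^ k\<close> in the
    sub-Gaussian exponent. One half has to pay for the entropy of the two nets of the link, the
    other for \<open>x + 2 + real k\<close>; the number 144 in \<open>chain_const\<close> is this 2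
    times 72.\<close>
  define w where "w = (1 - r)\<^sup>2 / 144 * N / D\<^sup>2"
  have eq: "N * ((1 - r) * r ^ k / 2)\<^sup>2 / (18 * (D / 2 ^ k)\<^sup>2) = 2 * w * \<Theta> ^ k"
  proof -
    have "(r ^ k)\<^sup>2 * (2 ^ k)\<^sup>2 = \<Theta> ^ k"
    proof -
      have "(r ^ k)\<^sup>2 = (r\<^sup>2) ^ k" "(2 ^ k)\<^sup>2 = (2\<^sup>2 :: real) ^ k"
        by (simp_all only: power_mult[symmetric] mult.commute)
      then show ?thesis unfolding r2[symmetric] power_mult_distrib by simp
    qed
    moreover have "N * (q * R / 2)\<^sup>2 / (18 * (D / T)\<^sup>2) = N * q\<^sup>2 / (72 * D\<^sup>2) * (R\<^sup>2 * T\<^sup>2)"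
      for q R T :: real by (simp add: power_mult_distrib power_divide)
    ultimately have "N * ((1 - r) * r ^ k / 2)\<^sup>2 / (18 * (D / 2 ^ k)\<^sup>2)
        = N * (1 - r)\<^sup>2 / (72 * D\<^sup>2) * \<Theta> ^ k"
      by simp
    then show ?thesis by (simp add: w_def)
  qed
  have Q: "3 \<le> 3 + 1 / (\<Theta> - 1)" using \<Theta> by simp
  have cc: "(1 - r)\<^sup>2 / 144 * chain_const p = 3 + 1 / (\<Theta> - 1)"
    using r by (simp add: kc)
  have w1: "(3 + 1 / (\<Theta> - 1)) * (A * D powr - p) \<le> w"
  proof -
    have "D powr (2 - p) / D\<^sup>2 = D powr - p"
      using D by (simp add: powr_diff powr_minus field_simps)
    then have "(3 + 1 / (\<Theta> - 1)) * (A * D powr - p)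
       = (1 - r)\<^sup>2 / 144 * (chain_const p * A * D powr (2 - p)) / D\<^sup>2"
      unfolding cc[symmetric] by (metis (no_types, opaque_lifting) mult.assoc times_divide_eq_right)
    also have "\<dots> \<le> w" unfolding w_def
      by (intro divide_right_mono mult_left_mono h1) auto
    finally show ?thesis .
  qed
  have w2: "(3 + 1 / (\<Theta> - 1)) * x \<le> w"
  proof -
    have "(3 + 1 / (\<Theta> - 1)) * x = (1 - r)\<^sup>2 / 144 * (chain_const p * x * D\<^sup>2) / D\<^sup>2"
      unfolding cc[symmetric] using D by simp
    also have "\<dots> \<le> w" unfolding w_def
      by (intro divide_right_mono mult_left_mono h2) auto
    finally show ?thesis .
  qed
  have "2 * A * D powr - p \<le> (3 + 1 / (\<Theta> - 1)) * (A * D powr - p)"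
    using Q A mult_right_mono[of 2 "3 + 1 / (\<Theta> - 1)" "A * D powr - p"] by simp
  with w1 have "2 * A * D powr - p \<le> w" by linarith
  then have 1: "2 * A * D powr - p * \<Theta> ^ k \<le> w * \<Theta> ^ k"
    using \<Theta> by (intro mult_right_mono) auto
  have "x + 2 + real k \<le> x * (3 + real k)"
    using x mult_right_mono[of 1 x "2 + real k"] by (simp add: algebra_simps)
  \<comment> \<open>Bernoulli gives growth of slope \<open>\<Theta> - 1\<close> only, which is small
    for small \<open>p\<close>. The summand \<open>1 / (\<Theta> - 1)\<close> of
    \<open>chain_const\<close> raises the slope to at least 1, so that the summand
    \<open>real k\<close> is covered.\<close>
  also have "3 + real k \<le> (3 + 1 / (\<Theta> - 1)) * (1 + real k * (\<Theta> - 1))"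
  proof -
    have "(3 + 1 / u) * (1 + real k * u) = 3 + real k + (3 * real k * u + 1 / u)" if "0 < u" for u :: real
      using that by (simp add: field_simps)
    from this[of "\<Theta> - 1"] show ?thesis using \<Theta> by simp
  qed
  also have "1 + real k * (\<Theta> - 1) \<le> \<Theta> ^ k"
    using Bernoulli_inequality[of "\<Theta> - 1" k] \<Theta> by simp
  finally have "x + 2 + real k \<le> x * ((3 + 1 / (\<Theta> - 1)) * \<Theta> ^ k)"
    using x Q by (simp add: mult_left_mono)
  also have "\<dots> = (3 + 1 / (\<Theta> - 1)) * x * \<Theta> ^ k" by simp
  also have "\<dots> \<le> w * \<Theta> ^ k" using w2 \<Theta> by (intro mult_right_mono) auto
  finally have 2: "x + 2 + real k \<le> w * \<Theta> ^ k" .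
  show ?thesis unfolding pw r_def[symmetric] eq using 1 2 by simp
qed

lemma card_UN_le_sum_real:
  assumes "finite A" "\<And>a. a \<in> A \<Longrightarrow> real (card (S a)) \<le> b a"
  shows "real (card (\<Union>a\<in>A. S a)) \<le> (\<Sum>a\<in>A. b a)"
proof -
  have "real (card (\<Union>a\<in>A. S a)) \<le> (\<Sum>a\<in>A. real (card (S a)))"
    using card_UN_le[OF assms(1), of S] by (metis of_nat_le_iff of_nat_sum)
  also have "\<dots> \<le> (\<Sum>a\<in>A. b a)" using assms(2) by (rule sum_mono)
  finally show ?thesis .
qed

text \<open>Dudley chaining. Each \<open>w\<close> is approximated on nets of radii
  \<open>D / 2 ^ k\<close>, and its signed sum is a telescoping sum of links plus a remainder. If
  the sum is large, some link is large; a union bound over the pairs of net points of that link,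
  with the budget above, leaves a geometric series. The bound depends on \<open>W\<close> only
  through its covers.\<close>

lemma rademacher_chaining:
  fixes W :: "(nat \<Rightarrow> real) set"
  assumes fin: "finite W" and n: "1 \<le> n" and D: "0 < D" and \<eta>: "0 < \<eta>"
    and p: "0 < p" "p < 2" and A: "0 \<le> A" and x: "1 \<le> x"
    and cover: "\<And>\<delta>. 0 < \<delta> \<Longrightarrow> \<exists>C. finite C \<and> real (card C) \<le> exp (A * \<delta> powr - p) \<and>
        (\<forall>w\<in>W. \<exists>c\<in>C. (\<Sum>i<n. (w i - c i)\<^sup>2) \<le> real n * \<delta>\<^sup>2)"
    and h1: "chain_const p * A * D powr (2 - p) \<le> real n * \<eta>\<^sup>2"
    and h2: "chain_const p * x * D\<^sup>2 \<le> real n * \<eta>\<^sup>2"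
  shows "real (card {I \<in> Pow {..<n}. \<exists>w\<in>W. (\<Sum>i<n. (w i)\<^sup>2) \<le> real n * D\<^sup>2 \<and>
      real n * \<eta> \<le> signed_sum n I w}) \<le> 2 ^ n * exp (- x) / 4"
proof -
  define r where "r = chain_ratio p"
  have r: "0 < r" "r < 1" using chain_ratio_bounds[OF p(2)] by (auto simp: r_def)
  define W' where "W' = {w \<in> W. (\<Sum>i<n. (w i)\<^sup>2) \<le> real n * D\<^sup>2}"
  have finW': "finite W'" using fin by (simp add: W'_def)
  define \<delta> where "\<delta> k = D / 2 ^ k" for k :: nat
  have \<delta>: "0 < \<delta> k" for k using D by (simp add: \<delta>_def)
  have \<delta>_Suc: "\<delta> k = 2 * \<delta> (Suc k)" for k by (simp add: \<delta>_def)
  \<comment> \<open>Normalized so that the allowances \<open>t 1\<close>, \<open>t 2\<close>, ... of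
    all links sum to less than \<open>\<eta> / 2\<close>; the other half of \<open>\<eta>\<close> is
    reserved for the remainder.\<close>
  define t where "t k = \<eta> * ((1 - r) * r ^ k / 2)" for k :: nat
  have "\<forall>k. \<exists>C. finite C \<and> real (card C) \<le> exp (A * \<delta> k powr - p) \<and>
        (\<forall>w\<in>W. \<exists>c\<in>C. (\<Sum>i<n. (w i - c i)\<^sup>2) \<le> real n * (\<delta> k)\<^sup>2)"
    using cover \<delta> by blast
  from choice[OF this] obtain C where C0: "\<forall>k. finite (C k) \<and> real (card (C k)) \<le> exp (A * \<delta> k powr - p) \<and>
        (\<forall>w\<in>W. \<exists>c\<in>C k. (\<Sum>i<n. (w i - c i)\<^sup>2) \<le> real n * (\<delta> k)\<^sup>2)" ..
  then have C: "\<And>k. finite (C k)" "\<And>k. real (card (C k)) \<le> exp (A * \<delta> k powr - p)"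
    by blast+
  define q where "q k w = (SOME c. c \<in> C k \<and> (\<Sum>i<n. (w i - c i)\<^sup>2) \<le> real n * (\<delta> k)\<^sup>2)" for k w
  have "q k w \<in> C k \<and> (\<Sum>i<n. (w i - q k w i)\<^sup>2) \<le> real n * (\<delta> k)\<^sup>2" if "w \<in> W" for k w
  proof -
    have "\<exists>c. c \<in> C k \<and> (\<Sum>i<n. (w i - c i)\<^sup>2) \<le> real n * (\<delta> k)\<^sup>2" using C0 that by blast
    from someI_ex[OF this] show ?thesis unfolding q_def .
  qed
  then have q: "\<And>k w. w \<in> W \<Longrightarrow> q k w \<in> C k"
    "\<And>k w. w \<in> W \<Longrightarrow> (\<Sum>i<n. (w i - q k w i)\<^sup>2) \<le> real n * (\<delta> k)\<^sup>2"
    by blast+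
  \<comment> \<open>The chain starts at the zero vector, which lies within \<open>D\<close> of every
    element of \<open>W'\<close>. Hence the level-0 net is a single point whose signed sum
    vanishes.\<close>
  define \<pi> where "\<pi> k w = (if k = 0 then (\<lambda>_. 0) else q k w)" for k w
  have \<pi>_near: "(\<Sum>i<n. (w i - \<pi> k w i)\<^sup>2) \<le> real n * (\<delta> k)\<^sup>2" if "w \<in> W'" for k w
    using that q(2)[of w k] by (auto simp: \<pi>_def W'_def \<delta>_def)
  define N where "N k = \<pi> k ` W'" for k
  have finN: "finite (N k)" for k using finW' by (simp add: N_def)
  have cardN: "real (card (N k)) \<le> exp (A * \<delta> k powr - p)" for k
  proof (cases "k = 0")
    case True
    have "N k \<subseteq> {\<lambda>_. 0}" by (auto simp: N_def \<pi>_def True)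
    then have "card (N k) \<le> 1" using card_mono[of "{\<lambda>_::nat. 0::real}" "N k"] by simp
    then have "real (card (N k)) \<le> 1" by simp
    also have "1 \<le> exp (A * \<delta> k powr - p)" using A by simp
    finally show ?thesis .
  next
    case False
    have "N k \<subseteq> C k" using q(1) by (auto simp: N_def \<pi>_def False W'_def)
    then have "card (N k) \<le> card (C k)" using C(1) by (rule card_mono[rotated])
    then show ?thesis using C(2)[of k] by linarith
  qed
  \<comment> \<open>At this depth Cauchy-Schwarz bounds the remainder by \<open>\<eta> / 2\<close>
    for all sign patterns, so finitely many links suffice.\<close>
  obtain m :: nat where m: "\<delta> m \<le> \<eta> / 2"
  proof -
    obtain m :: nat where "2 * D / \<eta> < 2 ^ m" using real_arch_pow[of 2 "2 * D / \<eta>"] by auto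
    then have "\<delta> m \<le> \<eta> / 2" using \<eta> by (simp add: \<delta>_def field_simps)
    then show ?thesis using that by blast
  qed
  define pairs where "pairs k = {z \<in> N (Suc k) \<times> N k.
      (\<Sum>i<n. (fst z i - snd z i)\<^sup>2) \<le> real n * (9 * (\<delta> (Suc k))\<^sup>2)}" for k
  define E where "E k z = {I \<in> Pow {..<n}. real n * t (Suc k) \<le> signed_sum n I (\<lambda>i. fst z i - snd z i)}"
    for k :: nat and z :: "(nat \<Rightarrow> real) \<times> (nat \<Rightarrow> real)"
  have sub: "{I \<in> Pow {..<n}. \<exists>w\<in>W. (\<Sum>i<n. (w i)\<^sup>2) \<le> real n * D\<^sup>2 \<and>
      real n * \<eta> \<le> signed_sum n I w} \<subseteq> (\<Union>k<m. \<Union>z\<in>pairs k. E k z)" (is "?Bad \<subseteq> _")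
  proof
    fix I assume "I \<in> ?Bad"
    then obtain w where I: "I \<in> Pow {..<n}" and w: "w \<in> W'" and ge: "real n * \<eta> \<le> signed_sum n I w"
      by (auto simp: W'_def)
    have pr: "(\<pi> (Suc k) w, \<pi> k w) \<in> pairs k" for k
    proof -
      \<comment> \<open>The weights 3 and 3/2 are those for which squaring loses nothing against the
        triangle inequality with radii \<open>\<delta> (Suc k)\<close> and
        \<open>2 * \<delta> (Suc k)\<close>: the result is the factor 9 = (1 + 2) squared.\<close>
      have "(\<Sum>i<n. (\<pi> (Suc k) w i - \<pi> k w i)\<^sup>2)
          \<le> (\<Sum>i<n. 3 * (w i - \<pi> (Suc k) w i)\<^sup>2 + 3 / 2 * (w i - \<pi> k w i)\<^sup>2)"
      proof (rule sum_mono)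
        fix i
        have "(b - a)\<^sup>2 \<le> 3 * a\<^sup>2 + 3 / 2 * b\<^sup>2" for a b :: real
          using zero_le_power2[of "2 * a + b"] by (simp add: power2_eq_square algebra_simps)
        from this[of "w i - \<pi> k w i" "w i - \<pi> (Suc k) w i"]
        show "(\<pi> (Suc k) w i - \<pi> k w i)\<^sup>2
          \<le> 3 * (w i - \<pi> (Suc k) w i)\<^sup>2 + 3 / 2 * (w i - \<pi> k w i)\<^sup>2" by simp
      qed
      also have "\<dots> = 3 * (\<Sum>i<n. (w i - \<pi> (Suc k) w i)\<^sup>2) + 3 / 2 * (\<Sum>i<n. (w i - \<pi> k w i)\<^sup>2)"
        by (simp add: sum.distrib sum_distrib_left)
      also have "\<dots> \<le> 3 * (real n * (\<delta> (Suc k))\<^sup>2) + 3 / 2 * (real n * (\<delta> k)\<^sup>2)"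
        using \<pi>_near[OF w, of k] \<pi>_near[OF w, of "Suc k"] by (intro add_mono mult_left_mono) auto
      also have "\<dots> = real n * (9 * (\<delta> (Suc k))\<^sup>2)"
        unfolding \<delta>_Suc[of k] by (simp add: power_mult_distrib)
      finally show ?thesis using w by (auto simp: pairs_def N_def)
    qed
    have "\<exists>k<m. real n * t (Suc k) \<le> signed_sum n I (\<lambda>i. \<pi> (Suc k) w i - \<pi> k w i)"
    proof (rule ccontr)
      assume "\<not> ?thesis"
      then have lt: "signed_sum n I (\<lambda>i. \<pi> (Suc k) w i - \<pi> k w i) \<le> real n * t (Suc k)" if "k < m" for k
        using that by (meson less_imp_le not_le)
      have "signed_sum n I (\<pi> 0 w) = 0" by (auto simp: \<pi>_def signed_sum_def intro!: sum.neutral)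
      moreover have "(\<Sum>k<m. signed_sum n I (\<pi> (Suc k) w) - signed_sum n I (\<pi> k w))
          = signed_sum n I (\<pi> m w) - signed_sum n I (\<pi> 0 w)"
        by (rule sum_lessThan_telescope)
      ultimately have "signed_sum n I w = signed_sum n I (\<lambda>i. w i - \<pi> m w i)
          + (\<Sum>k<m. signed_sum n I (\<lambda>i. \<pi> (Suc k) w i - \<pi> k w i))"
        by (simp add: signed_sum_diff)
      also have "\<dots> \<le> real n * \<delta> m + (\<Sum>k<m. real n * t (Suc k))"
        using \<delta>[of m] by (intro add_mono signed_sum_le \<pi>_near w sum_mono lt) auto
      also have "\<dots> \<le> real n * (\<eta> / 2) + (\<Sum>k<m. real n * t (Suc k))"
        using m by (intro add_right_mono mult_left_mono) auto
      also have "(\<Sum>k<m. real n * t (Suc k)) = real n * (\<eta> / 2) * (r * (1 - r ^ m))"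
      proof -
        have "(\<Sum>k<m. real n * t (Suc k)) = real n * (\<eta> / 2) * (r * ((1 - r) * (\<Sum>k<m. r ^ k)))"
          unfolding sum_distrib_left by (rule sum.cong) (simp_all add: t_def)
        also have "(1 - r) * (\<Sum>k<m. r ^ k) = 1 - r ^ m" by (simp add: one_diff_power_eq)
        finally show ?thesis .
      qed
      also have "\<dots> < real n * (\<eta> / 2) * 1"
      proof (rule mult_strict_left_mono)
        have "r * (1 - r ^ m) \<le> r" using r by simp
        then show "r * (1 - r ^ m) < 1" using r by linarith
      qed (use n \<eta> in simp)
      finally show False using ge by (simp add: mult.commute)
    qed
    then show "I \<in> (\<Union>k<m. \<Union>z\<in>pairs k. E k z)"
      using pr I by (fastforce simp: E_def)
  qed
  have finp: "finite (pairs k)" for k using finN by (simp add: pairs_def)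
  have link: "real (card (\<Union>z\<in>pairs k. E k z)) \<le> 2 ^ n * exp (- x) / 4 * (1 / 2) ^ Suc k" for k
  proof -
    let ?e = "2 ^ n * exp (- (real n * t (Suc k))\<^sup>2 / (2 * (real n * (9 * (\<delta> (Suc k))\<^sup>2))))"
    have "real (card (\<Union>z\<in>pairs k. E k z)) \<le> (\<Sum>z\<in>pairs k. ?e)"
    proof (rule card_UN_le_sum_real[OF finp])
      fix z assume "z \<in> pairs k"
      then show "real (card (E k z)) \<le> ?e"
        unfolding E_def using n \<eta> r \<delta>[of "Suc k"]
        by (intro card_signed_sum_ge_le) (auto simp: pairs_def t_def)
    qed
    also have "\<dots> = real (card (pairs k)) * ?e" by simp
    also have "\<dots> \<le> (exp (A * \<delta> (Suc k) powr - p) * exp (A * \<delta> (Suc k) powr - p)) * ?e"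
    proof (rule mult_right_mono)
      have "card (pairs k) \<le> card (N (Suc k) \<times> N k)"
        using finN by (intro card_mono) (auto simp: pairs_def)
      then have "real (card (pairs k)) \<le> real (card (N (Suc k))) * real (card (N k))"
        by (simp add: card_cartesian_product flip: of_nat_mult)
      also have "\<dots> \<le> exp (A * \<delta> (Suc k) powr - p) * exp (A * \<delta> k powr - p)"
        by (intro mult_mono cardN) auto
      also have "\<dots> \<le> exp (A * \<delta> (Suc k) powr - p) * exp (A * \<delta> (Suc k) powr - p)"
        using A p \<delta>[of "Suc k"] \<delta>_Suc[of k] by (simp add: mult_left_mono powr_mono2')
      finally show "real (card (pairs k)) \<le> \<dots>" .
    qed simp
    also have "\<dots> = 2 ^ n * exp (2 * A * \<delta> (Suc k) powr - p - real n * (t (Suc k))\<^sup>2 / (18 * (\<delta> (Suc k))\<^sup>2))"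
      using n by (simp add: exp_add[symmetric] power2_eq_square algebra_simps)
    \<comment> \<open>In this exponent \<open>- 2\<close> yields the factor 1/4 of the claim and
      \<open>- real (Suc k)\<close> makes the bounds of the links summable to at most 1.\<close>
    also have "\<dots> \<le> 2 ^ n * exp (- x - 2 - real (Suc k))"
    proof -
      have "2 * A * (D / 2 ^ Suc k) powr - p + x + 2 + real (Suc k)
          \<le> real n * \<eta>\<^sup>2 * ((1 - r) * r ^ Suc k / 2)\<^sup>2 / (18 * (D / 2 ^ Suc k)\<^sup>2)"
        unfolding r_def by (rule chain_link_budget[OF p A x D h1 h2])
      also have "real n * \<eta>\<^sup>2 * ((1 - r) * r ^ Suc k / 2)\<^sup>2 = real n * (t (Suc k))\<^sup>2"
        by (simp only: t_def power_mult_distrib mult.assoc)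
      finally show ?thesis unfolding \<delta>_def[symmetric] by simp
    qed
    also have "\<dots> = 2 ^ n * exp (- x) * (exp (- 2) * exp (- real (Suc k)))"
      by (simp flip: exp_add)
    also have "\<dots> \<le> 2 ^ n * exp (- x) * (1 / 4 * (1 / 2) ^ Suc k)"
    proof -
      have e1: "exp (-1) \<le> (1 / 2 :: real)"
        using exp_ge_add_one_self[of 1] by (simp add: exp_minus field_simps)
      have e: "exp (- real j) \<le> (1 / 2) ^ j" for j :: nat
        using power_mono[OF e1, of j] by (simp flip: exp_of_nat_mult)
      show ?thesis using e[of 2] e[of "Suc k"]
        by (intro mult_left_mono mult_mono) (auto simp: power2_eq_square)
    qed
    finally show ?thesis by simp
  qed
  have "real (card ?Bad) \<le> real (card (\<Union>k<m. \<Union>z\<in>pairs k. E k z))"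
  proof -
    have "finite (\<Union>k<m. \<Union>z\<in>pairs k. E k z)" using finp by (auto simp: E_def)
    then show ?thesis using sub by (simp add: card_mono)
  qed
  also have "\<dots> \<le> (\<Sum>k<m. 2 ^ n * exp (- x) / 4 * (1 / 2) ^ Suc k)"
    by (rule card_UN_le_sum_real[OF _ link]) auto
  also have "\<dots> = 2 ^ n * exp (- x) / 4 * (\<Sum>k<m. (1 / 2) ^ Suc k)"
    by (simp only: sum_distrib_left)
  also have "(\<Sum>k<m. (1 / 2) ^ Suc k) = (1 - (1 / 2) ^ m :: real)"
    by (induction m) auto
  also have "2 ^ n * exp (- x) / 4 * (1 - (1 / 2) ^ m) \<le> 2 ^ n * exp (- x) / 4 * 1"
    by (intro mult_left_mono) auto
  finally show ?thesis by simp
qed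

section \<open>Swapping the halves of a double sample\<close>

definition swap_halves :: "nat \<Rightarrow> nat set \<Rightarrow> nat \<Rightarrow> nat" where
  "swap_halves n I i = (if i < n then (if i \<in> I then n + i else i)
     else if i - n \<in> I then i - n else i)"

lemma swap_halves_simps:
  assumes "i < n"
  shows "swap_halves n I i = (if i \<in> I then n + i else i)"
    and "swap_halves n I (n + i) = (if i \<in> I then i else n + i)"
  using assms by (auto simp: swap_halves_def)

lemma sum_lessThan_add_nat:
  fixes h :: "nat \<Rightarrow> 'a::comm_monoid_add"
  shows "(\<Sum>i<n + m. h i) = (\<Sum>i<n. h i) + (\<Sum>i<m. h (n + i))"
  by (induction m) (auto simp: ac_simps)

text \<open>This is where the signs come from: exchanging observation \<open>i\<close> with its
  ghost reverses the sign of the \<open>i\<close>-th difference and leaves all others alone.\<close>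

lemma signed_sum_swap_halves:
  "(\<Sum>i<n. u (swap_halves n I i)) - (\<Sum>i<n. u (swap_halves n I (n + i)))
    = signed_sum n I (\<lambda>i. u i - u (n + i))"
  unfolding signed_sum_def sum_subtractf[symmetric]
  by (rule sum.cong) (auto simp: swap_halves_simps)

lemma sum_swap_halves:
  fixes u :: "nat \<Rightarrow> real"
  shows "(\<Sum>i<n. u (swap_halves n I i)) + (\<Sum>i<n. u (swap_halves n I (n + i))) = (\<Sum>i<n + n. u i)"
  unfolding sum_lessThan_add_nat sum.distrib[symmetric]
  by (rule sum.cong) (auto simp: swap_halves_simps)

lemma square_add_le: "(a + b)\<^sup>2 \<le> 2 * a\<^sup>2 + 2 * b\<^sup>2" for a b :: real
  using zero_le_power2[of "a - b"] by (simp add: power2_eq_square algebra_simps)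

text \<open>If the ghost half has a small sum of squares, the other half rarely has a much larger
  one. On an empirical net the claim concerns finitely many functions; for each of them the
  difference of the two sums of squares is a signed sum whose own quadratic variation is at most
  \<open>B\<^sup>2\<close> times the total \<open>S c\<close>, and a difference of at least
  \<open>3 / 7 * S c\<close> is then exponentially unlikely.\<close>

lemma rademacher_second_moment:
  fixes u :: "'f \<Rightarrow> nat \<Rightarrow> real"
  assumes finC: "finite C" and B: "0 < B" and n: "1 \<le> n" and \<sigma>: "0 < s2"
    and bound: "\<And>c i. c \<in> C \<Longrightarrow> i < n + n \<Longrightarrow> \<bar>u c i\<bar> \<le> B"
    and near: "\<And>f. f \<in> F \<Longrightarrow> \<exists>c\<in>C. (\<Sum>i<n + n. (u f i - u c i)\<^sup>2) \<le> 2 * real n * s2"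
  shows "real (card {I \<in> Pow {..<n}. \<exists>f\<in>F.
      (\<Sum>i<n. (u f (swap_halves n I (n + i)))\<^sup>2) \<le> 4 * real n * s2 \<and>
      64 * real n * s2 < (\<Sum>i<n. (u f (swap_halves n I i))\<^sup>2)})
    \<le> 2 ^ n * (real (card C) * exp (- 2 * real n * s2 / B\<^sup>2))"
proof -
  define S where "S c = (\<Sum>i<n + n. (u c i)\<^sup>2)" for c
  define C' where "C' = {c \<in> C. 30 * real n * s2 \<le> S c}"
  define E where "E c = {I \<in> Pow {..<n}. 3 / 7 * S c \<le> signed_sum n I (\<lambda>i. (u c i)\<^sup>2 - (u c (n + i))\<^sup>2)}" for c
  have "{I \<in> Pow {..<n}. \<exists>f\<in>F.
      (\<Sum>i<n. (u f (swap_halves n I (n + i)))\<^sup>2) \<le> 4 * real n * s2 \<and>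
      64 * real n * s2 < (\<Sum>i<n. (u f (swap_halves n I i))\<^sup>2)} \<subseteq> (\<Union>c\<in>C'. E c)" (is "?Bad \<subseteq> _")
  proof
    fix I assume "I \<in> ?Bad"
    then obtain f where I: "I \<in> Pow {..<n}" and f: "f \<in> F"
      and small: "(\<Sum>i<n. (u f (swap_halves n I (n + i)))\<^sup>2) \<le> 4 * real n * s2"
      and large: "64 * real n * s2 < (\<Sum>i<n. (u f (swap_halves n I i))\<^sup>2)" by auto
    obtain c where c: "c \<in> C" and nr: "(\<Sum>i<n + n. (u f i - u c i)\<^sup>2) \<le> 2 * real n * s2"
      using near[OF f] by blast
    define \<tau> where "\<tau> = swap_halves n I"
    let ?d1 = "\<Sum>i<n. (u f (\<tau> i) - u c (\<tau> i))\<^sup>2" and ?d2 = "\<Sum>i<n. (u f (\<tau> (n + i)) - u c (\<tau> (n + i)))\<^sup>2"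
    let ?a = "\<Sum>i<n. (u c (\<tau> i))\<^sup>2" and ?b = "\<Sum>i<n. (u c (\<tau> (n + i)))\<^sup>2"
    have "?d1 + ?d2 \<le> 2 * real n * s2"
      using sum_swap_halves[of "\<lambda>i. (u f i - u c i)\<^sup>2" n I] nr by (simp add: \<tau>_def)
    moreover have "0 \<le> ?d1" "0 \<le> ?d2" by (auto intro: sum_nonneg)
    ultimately have d: "?d1 \<le> 2 * real n * s2" "?d2 \<le> 2 * real n * s2" by linarith+
    have "(\<Sum>i<n. (u f (\<tau> i))\<^sup>2) \<le> (\<Sum>i<n. 2 * (u c (\<tau> i))\<^sup>2 + 2 * (u f (\<tau> i) - u c (\<tau> i))\<^sup>2)"
    proof (rule sum_mono)
      fix i show "(u f (\<tau> i))\<^sup>2 \<le> 2 * (u c (\<tau> i))\<^sup>2 + 2 * (u f (\<tau> i) - u c (\<tau> i))\<^sup>2"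
        using square_add_le[of "u c (\<tau> i)" "u f (\<tau> i) - u c (\<tau> i)"] by simp
    qed
    also have "\<dots> = 2 * ?a + 2 * ?d1" by (simp add: sum.distrib sum_distrib_left)
    \<comment> \<open>With \<open>q = real n * s2\<close>: from 64 q < 2 a + 2 * 2 q follows a \<ge>
      30 q. Likewise b \<le> 2 * 4 q + 2 * 2 q = 12 q below.\<close>
    finally have a: "30 * real n * s2 \<le> ?a" using large d by (simp add: \<tau>_def)
    have "?b \<le> (\<Sum>i<n. 2 * (u f (\<tau> (n + i)))\<^sup>2 + 2 * (u f (\<tau> (n + i)) - u c (\<tau> (n + i)))\<^sup>2)"
    proof (rule sum_mono)
      fix i show "(u c (\<tau> (n + i)))\<^sup>2 \<le> 2 * (u f (\<tau> (n + i)))\<^sup>2 + 2 * (u f (\<tau> (n + i)) - u c (\<tau> (n + i)))\<^sup>2"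
        using square_add_le[of "u f (\<tau> (n + i))" "u c (\<tau> (n + i)) - u f (\<tau> (n + i))"]
        by (simp add: power2_commute)
    qed
    also have "\<dots> = 2 * (\<Sum>i<n. (u f (\<tau> (n + i)))\<^sup>2) + 2 * ?d2" by (simp add: sum.distrib sum_distrib_left)
    finally have b: "?b \<le> 12 * real n * s2" using small d by (simp add: \<tau>_def)
    have ab: "?a + ?b = S c" using sum_swap_halves[of "\<lambda>i. (u c i)\<^sup>2" n I] by (simp add: \<tau>_def S_def)
    have "?a - ?b = signed_sum n I (\<lambda>i. (u c i)\<^sup>2 - (u c (n + i))\<^sup>2)"
      using signed_sum_swap_halves[of "\<lambda>i. (u c i)\<^sup>2" n I] by (simp add: \<tau>_def)
    \<comment> \<open>The extreme case is a = 30 q, b = 12 q, where the ratio of difference and sum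
      is 18 / 42.\<close>
    moreover have "3 / 7 * (?a + ?b) \<le> ?a - ?b"
    proof -
      have "3 / 7 * (a + b) \<le> a - b" if "30 * q \<le> a" "b \<le> 12 * q" for a b q :: real
        using that by (simp add: field_simps)
      from this[of "real n * s2"] show ?thesis using a b by (simp add: mult.assoc)
    qed
    moreover have "0 \<le> ?b" by (auto intro: sum_nonneg)
    ultimately show "I \<in> (\<Union>c\<in>C'. E c)" using c I a ab by (auto simp: C'_def E_def)
  qed
  then have "real (card ?Bad) \<le> real (card (\<Union>c\<in>C'. E c))"
    using finC by (intro of_nat_mono card_mono) (auto simp: C'_def E_def)
  also have "\<dots> \<le> (\<Sum>c\<in>C'. 2 ^ n * exp (- 2 * real n * s2 / B\<^sup>2))"
  proof (rule card_UN_le_sum_real)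
    fix c assume "c \<in> C'"
    then have c: "c \<in> C" and Sc: "30 * real n * s2 \<le> S c" by (auto simp: C'_def)
    have "0 < 30 * real n * s2" using n \<sigma> by simp
    then have Sp: "0 < S c" using Sc by linarith
    have "(\<Sum>i<n. ((u c i)\<^sup>2 - (u c (n + i))\<^sup>2)\<^sup>2) \<le> (\<Sum>i<n. B\<^sup>2 * ((u c i)\<^sup>2 + (u c (n + i))\<^sup>2))"
    proof (rule sum_mono)
      fix i assume "i \<in> {..<n}"
      then have "(u c i)\<^sup>2 \<le> B\<^sup>2" "(u c (n + i))\<^sup>2 \<le> B\<^sup>2"
        using bound[OF c, of i] bound[OF c, of "n + i"] B by (auto simp: abs_le_square_iff[symmetric])
      moreover have "(p - q)\<^sup>2 \<le> b * (p + q)" if "0 \<le> p" "0 \<le> q" "p \<le> b" "q \<le> b" for p q b :: real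
      proof -
        have "(p - q)\<^sup>2 = \<bar>p - q\<bar> * \<bar>p - q\<bar>" by (simp add: power2_eq_square)
        also have "\<dots> \<le> b * (p + q)" using that by (intro mult_mono) auto
        finally show ?thesis .
      qed
      ultimately show "((u c i)\<^sup>2 - (u c (n + i))\<^sup>2)\<^sup>2 \<le> B\<^sup>2 * ((u c i)\<^sup>2 + (u c (n + i))\<^sup>2)" by simp
    qed
    also have "\<dots> = B\<^sup>2 * S c" by (simp add: S_def sum_lessThan_add_nat sum.distrib sum_distrib_left distrib_left)
    finally have var: "(\<Sum>i<n. ((u c i)\<^sup>2 - (u c (n + i))\<^sup>2)\<^sup>2) \<le> B\<^sup>2 * S c" .
    have "real (card (E c)) \<le> 2 ^ n * exp (- (3 / 7 * S c)\<^sup>2 / (2 * (B\<^sup>2 * S c)))"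
      unfolding E_def using Sp B by (intro card_signed_sum_ge_le[OF var]) auto
    also have "- (3 / 7 * S c)\<^sup>2 / (2 * (B\<^sup>2 * S c)) = - (9 / 98 * S c) / B\<^sup>2"
      using Sp by (simp add: power2_eq_square)
    also have "2 ^ n * exp \<dots> \<le> 2 ^ n * exp (- 2 * real n * s2 / B\<^sup>2)"
    proof -
      \<comment> \<open>Here 9 / 98 is half the square of 3 / 7, and 30 * 9 / 98 exceeds 2.\<close>
      have "2 * (real n * s2) \<le> 9 / 98 * S c" 
      proof -
        have "0 \<le> real n * s2" using \<sigma> by simp
        moreover have "30 * (real n * s2) \<le> S c" using Sc by (simp add: mult.assoc)
        ultimately show ?thesis by linarith
      qed
      from divide_right_mono[OF this, of "B\<^sup>2"] show ?thesis by simp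
    qed
    finally show "real (card (E c)) \<le> 2 ^ n * exp (- 2 * real n * s2 / B\<^sup>2)" .
  qed (use finC in \<open>simp add: C'_def\<close>)
  also have "\<dots> = real (card C') * (2 ^ n * exp (- 2 * real n * s2 / B\<^sup>2))" by simp
  also have "\<dots> \<le> real (card C) * (2 ^ n * exp (- 2 * real n * s2 / B\<^sup>2))"
    using finC by (intro mult_right_mono of_nat_mono card_mono) (auto simp: C'_def)
  finally show ?thesis by (simp add: mult_ac)
qed

section \<open>Symmetrization\<close>

lemma measurable_PiM_component_comp:
  assumes "h \<in> borel_measurable M" "j \<in> J"
  shows "(\<lambda>\<omega>. h (\<omega> j)) \<in> borel_measurable (PiM J (\<lambda>_. M))"
  using measurable_compose[OF measurable_component_singleton[OF assms(2), of "\<lambda>_. M"] assms(1)] by simp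

lemma integral_PiM_component:
  fixes h :: "'z \<Rightarrow> real"
  assumes "prob_space M" "h \<in> borel_measurable M" "j \<in> J"
  shows "(\<integral>\<omega>. h (\<omega> j) \<partial>PiM J (\<lambda>_. M)) = (\<integral>z. h z \<partial>M)"
proof -
  have "(\<integral>z. h z \<partial>M) = (\<integral>z. h z \<partial>distr (PiM J (\<lambda>_. M)) M (\<lambda>\<omega>. \<omega> j))"
    using distr_PiM_component[of J "\<lambda>_. M" j] assms by simp
  also have "\<dots> = (\<integral>\<omega>. h (\<omega> j) \<partial>PiM J (\<lambda>_. M))"
    using assms by (intro integral_distr) auto
  finally show ?thesis by simp
qed

text \<open>Independence, read off the product formula for integrals by taking the constant function
  1 at all coordinates other than \<open>j\<close> and \<open>k\<close>.\<close>

lemma integral_PiM_two_components: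
  fixes h :: "'z \<Rightarrow> real"
  assumes M: "prob_space M" and h: "integrable M h" and J: "finite J" "j \<in> J" "k \<in> J" "j \<noteq> k"
  shows "(\<integral>\<omega>. h (\<omega> j) * h (\<omega> k) \<partial>PiM J (\<lambda>_. M)) = (\<integral>z. h z \<partial>M)\<^sup>2"
proof -
  interpret prob_space M by fact
  interpret PS: product_sigma_finite "\<lambda>_. M" by standard
  define f where "f i = (if i = j \<or> i = k then h else (\<lambda>_. 1))" for i
  have split: "(\<Prod>i\<in>J. F i) = F j * F k" if "\<And>i. i \<noteq> j \<Longrightarrow> i \<noteq> k \<Longrightarrow> F i = 1" for F :: "_ \<Rightarrow> real"
  proof -
    have "(\<Prod>i\<in>J. F i) = F j * (F k * (\<Prod>i\<in>J - {j} - {k}. F i))"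
      using J by (simp add: prod.remove[of J j] prod.remove[of "J - {j}" k])
    also have "(\<Prod>i\<in>J - {j} - {k}. F i) = 1" by (rule prod.neutral) (use that in auto)
    finally show ?thesis by simp
  qed
  have "(\<integral>\<omega>. (\<Prod>i\<in>J. f i (\<omega> i)) \<partial>PiM J (\<lambda>_. M)) = (\<Prod>i\<in>J. integral\<^sup>L M (f i))"
    by (rule PS.product_integral_prod[OF J(1)]) (auto simp: f_def h)
  moreover have "(\<Prod>i\<in>J. integral\<^sup>L M (f i)) = (\<integral>z. h z \<partial>M) * (\<integral>z. h z \<partial>M)"
    by (subst split) (auto simp: f_def prob_space)
  moreover have "(\<Prod>i\<in>J. f i (\<omega> i)) = h (\<omega> j) * h (\<omega> k)" for \<omega>
    by (subst split) (auto simp: f_def)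
  ultimately show ?thesis by (simp add: power2_eq_square)
qed

text \<open>After expanding the square, the mixed terms vanish by independence and centering, and
  each diagonal term contributes the same second moment.\<close>

lemma integral_PiM_sum_square:
  fixes h :: "'z \<Rightarrow> real"
  assumes M: "prob_space M" and h: "h \<in> borel_measurable M" and b: "\<And>z. z \<in> space M \<Longrightarrow> \<bar>h z\<bar> \<le> b"
    and mean: "(\<integral>z. h z \<partial>M) = 0" and J: "finite J"
  shows "integrable (PiM J (\<lambda>_. M)) (\<lambda>\<omega>. (\<Sum>j\<in>J. h (\<omega> j))\<^sup>2)"
    and "(\<integral>\<omega>. (\<Sum>j\<in>J. h (\<omega> j))\<^sup>2 \<partial>PiM J (\<lambda>_. M)) = real (card J) * (\<integral>z. (h z)\<^sup>2 \<partial>M)"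
proof -
  interpret prob_space M by fact
  interpret J: prob_space "PiM J (\<lambda>_. M)" by (intro prob_space_PiM M)
  have int_h: "integrable M h"
    by (rule integrable_const_bound[where B = b]) (use b h in auto)
  have int2: "integrable (PiM J (\<lambda>_. M)) (\<lambda>\<omega>. h (\<omega> j) * h (\<omega> k))" if "j \<in> J" "k \<in> J" for j k
  proof (rule J.integrable_const_bound[where B = "b * b"])
    show "AE \<omega> in PiM J (\<lambda>_. M). norm (h (\<omega> j) * h (\<omega> k)) \<le> b * b"
    proof (rule AE_I2)
      fix \<omega> assume "\<omega> \<in> space (PiM J (\<lambda>_. M))"
      then have "\<omega> j \<in> space M" "\<omega> k \<in> space M" using that by (auto simp: space_PiM)
      then have "\<bar>h (\<omega> j)\<bar> \<le> b" "\<bar>h (\<omega> k)\<bar> \<le> b" using b by auto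
      then show "norm (h (\<omega> j) * h (\<omega> k)) \<le> b * b"
        by (simp add: abs_mult mult_mono)
    qed
  qed (intro borel_measurable_times measurable_PiM_component_comp h that)
  have ex: "(\<Sum>j\<in>J. h (\<omega> j))\<^sup>2 = (\<Sum>j\<in>J. \<Sum>k\<in>J. h (\<omega> j) * h (\<omega> k))" for \<omega>
    by (simp add: power2_eq_square sum_product)
  show "integrable (PiM J (\<lambda>_. M)) (\<lambda>\<omega>. (\<Sum>j\<in>J. h (\<omega> j))\<^sup>2)"
    unfolding ex by (intro Bochner_Integration.integrable_sum int2)
  have "(\<integral>\<omega>. (\<Sum>j\<in>J. h (\<omega> j))\<^sup>2 \<partial>PiM J (\<lambda>_. M))
      = (\<Sum>j\<in>J. \<Sum>k\<in>J. \<integral>\<omega>. h (\<omega> j) * h (\<omega> k) \<partial>PiM J (\<lambda>_. M))"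
    unfolding ex
    by (simp add: Bochner_Integration.integral_sum Bochner_Integration.integrable_sum int2 cong: sum.cong)
  also have "\<dots> = (\<Sum>j\<in>J. \<Sum>k\<in>J. if k = j then \<integral>z. (h z)\<^sup>2 \<partial>M else 0)"
  proof (intro sum.cong refl)
    fix j k assume jk: "j \<in> J" "k \<in> J"
    show "(\<integral>\<omega>. h (\<omega> j) * h (\<omega> k) \<partial>PiM J (\<lambda>_. M)) = (if k = j then \<integral>z. (h z)\<^sup>2 \<partial>M else 0)"
    proof (cases "k = j")
      case True
      have "(\<lambda>z. (h z)\<^sup>2) \<in> borel_measurable M" using h by simp
      from integral_PiM_component[OF M this jk(1)] show ?thesis using True by (simp add: power2_eq_square)
    next
      case False
      then show ?thesis using integral_PiM_two_components[OF M int_h J, of j k] jk mean by simp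
    qed
  qed
  also have "\<dots> = real (card J) * (\<integral>z. (h z)\<^sup>2 \<partial>M)" using J by simp
  finally show "(\<integral>\<omega>. (\<Sum>j\<in>J. h (\<omega> j))\<^sup>2 \<partial>PiM J (\<lambda>_. M)) = real (card J) * (\<integral>z. (h z)\<^sup>2 \<partial>M)" .
qed

text \<open>Two bad events of probability at most 1/4 each: Markov for the sum of squares at four
  times its expected bound, and Chebyshev for the mean at distance \<open>\<epsilon> / 2\<close>,
  where the factor 16 in \<open>large\<close> is what gives 1/4. The sum of squares is included
  because it is the premise under which the other half can be controlled after swapping.\<close>

lemma ghost_sample_half:
  fixes h :: "'z \<Rightarrow> real"
  assumes M: "prob_space M" and h: "h \<in> borel_measurable M" and b: "\<And>z. z \<in> space M \<Longrightarrow> \<bar>h z\<bar> \<le> b"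
    and s2: "(\<integral>z. (h z)\<^sup>2 \<partial>M) \<le> s2" "0 < s2" and J: "finite J" "J \<noteq> {}"
    and \<epsilon>: "0 < \<epsilon>" and large: "16 * s2 \<le> real (card J) * \<epsilon>\<^sup>2"
  shows "1 / 2 \<le> measure (PiM J (\<lambda>_. M)) {\<omega> \<in> space (PiM J (\<lambda>_. M)).
      (\<Sum>j\<in>J. (h (\<omega> j))\<^sup>2) \<le> 4 * real (card J) * s2 \<and>
      real (card J) * ((\<integral>z. h z \<partial>M) - \<epsilon> / 2) \<le> (\<Sum>j\<in>J. h (\<omega> j))}"
proof -
  interpret prob_space M by fact
  let ?J = "PiM J (\<lambda>_. M)"
  interpret J: prob_space ?J by (intro prob_space_PiM M)
  define N where "N = real (card J)"
  have N: "0 < N" using J by (simp add: N_def card_gt_0_iff)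
  define \<mu> where "\<mu> = (\<integral>z. h z \<partial>M)"
  have hJ[measurable]: "(\<lambda>\<omega>. h (\<omega> j)) \<in> borel_measurable ?J" if "j \<in> J" for j
    by (rule measurable_PiM_component_comp[OF h that])
  have int_h: "integrable M h"
    by (rule integrable_const_bound[where B = b]) (use b h in auto)
  have h2: "(\<lambda>z. (h z)\<^sup>2) \<in> borel_measurable M" using h by simp
  have int_h2: "integrable M (\<lambda>z. (h z)\<^sup>2)"
    by (rule integrable_const_bound[where B = "b\<^sup>2"])
       (use b h in \<open>auto intro!: AE_I2 simp: abs_le_square_iff[symmetric] intro: order_trans[OF _ abs_ge_self]\<close>)
  define E1 where "E1 = {\<omega> \<in> space ?J. 4 * N * s2 \<le> (\<Sum>j\<in>J. (h (\<omega> j))\<^sup>2)}"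
  define E2 where "E2 = {\<omega> \<in> space ?J. (N * \<epsilon> / 2)\<^sup>2 \<le> (\<Sum>j\<in>J. h (\<omega> j) - \<mu>)\<^sup>2}"
  have int_c: "integrable ?J (\<lambda>\<omega>. (h (\<omega> j))\<^sup>2)" if "j \<in> J" for j
  proof (rule J.integrable_const_bound[where B = "b\<^sup>2"])
    show "AE \<omega> in ?J. norm ((h (\<omega> j))\<^sup>2) \<le> b\<^sup>2"
    proof (rule AE_I2)
      fix \<omega> assume "\<omega> \<in> space ?J"
      then have "\<bar>h (\<omega> j)\<bar> \<le> b" using that b by (auto simp: space_PiM)
      then show "norm ((h (\<omega> j))\<^sup>2) \<le> b\<^sup>2" using power_mono[of "\<bar>h (\<omega> j)\<bar>" b 2] by simp
    qed
  qed (use that in measurable)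
  have "(\<integral>\<omega>. (\<Sum>j\<in>J. (h (\<omega> j))\<^sup>2) \<partial>?J) = N * (\<integral>z. (h z)\<^sup>2 \<partial>M)"
    by (subst Bochner_Integration.integral_sum)
       (simp_all add: int_c N_def integral_PiM_component[OF M h2, of _ J])
  also have "\<dots> \<le> N * s2" using s2 N by (intro mult_left_mono) auto
  finally have m1: "(\<integral>\<omega>. (\<Sum>j\<in>J. (h (\<omega> j))\<^sup>2) \<partial>?J) \<le> N * s2" .
  have "J.prob E1 \<le> (\<integral>\<omega>. (\<Sum>j\<in>J. (h (\<omega> j))\<^sup>2) \<partial>?J) / (4 * N * s2)"
    unfolding E1_def using N s2
    by (intro integral_Markov_inequality_measure[where A = "space ?J"] Bochner_Integration.integrable_sum int_c)
       (auto intro!: AE_I2 sum_nonneg)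
  also have "\<dots> \<le> N * s2 / (4 * N * s2)" using m1 N s2 by (intro divide_right_mono) auto
  also have "\<dots> = 1 / 4" using N s2 by simp
  finally have p1: "J.prob E1 \<le> 1 / 4" .
  define h' where "h' z = h z - \<mu>" for z
  have h': "h' \<in> borel_measurable M" using h by (simp add: h'_def[abs_def])
  have b': "\<bar>h' z\<bar> \<le> b + \<bar>\<mu>\<bar>" if "z \<in> space M" for z using b[OF that] by (simp add: h'_def)
  have mean': "(\<integral>z. h' z \<partial>M) = 0" using int_h by (simp add: h'_def \<mu>_def prob_space)
  have var': "(\<integral>z. (h' z)\<^sup>2 \<partial>M) \<le> s2"
  proof -
    have "(\<integral>z. (h' z)\<^sup>2 \<partial>M) = (\<integral>z. (h z)\<^sup>2 - 2 * \<mu> * h z + \<mu>\<^sup>2 \<partial>M)"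
      by (rule Bochner_Integration.integral_cong) (auto simp: h'_def power2_eq_square algebra_simps)
    also have "\<dots> = (\<integral>z. (h z)\<^sup>2 \<partial>M) - 2 * \<mu> * \<mu> + \<mu>\<^sup>2"
      using int_h int_h2 by (simp add: \<mu>_def prob_space)
    also have "\<dots> = (\<integral>z. (h z)\<^sup>2 \<partial>M) - \<mu>\<^sup>2" by (simp add: power2_eq_square)
    also have "\<dots> \<le> s2" using s2 zero_le_power2[of \<mu>] by linarith
    finally show ?thesis .
  qed
  note sq = integral_PiM_sum_square[OF M h' b' mean' J(1)]
  have "J.prob E2 \<le> (\<integral>\<omega>. (\<Sum>j\<in>J. h' (\<omega> j))\<^sup>2 \<partial>?J) / (N * \<epsilon> / 2)\<^sup>2"
    unfolding E2_def h'_def[symmetric] using N \<epsilon>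
    by (intro integral_Markov_inequality_measure[where A = "space ?J"] sq(1)) auto
  also have "\<dots> \<le> N * s2 / (N * \<epsilon> / 2)\<^sup>2"
    using sq(2) var' N by (intro divide_right_mono) (auto simp: N_def)
  also have "\<dots> = 4 * s2 / (N * \<epsilon>\<^sup>2)" using N by (simp add: power2_eq_square mult_ac)
  also have "\<dots> \<le> 1 / 4" using large N \<epsilon> by (simp add: N_def field_simps)
  finally have p2: "J.prob E2 \<le> 1 / 4" .
  have E[measurable]: "E1 \<in> sets ?J" "E2 \<in> sets ?J" unfolding E1_def E2_def by measurable
  have "J.prob (E1 \<union> E2) \<le> 1 / 2"
    using measure_Un_le[OF E] p1 p2 by linarith
  then have "1 / 2 \<le> J.prob (space ?J - (E1 \<union> E2))"
    using J.prob_compl[of "E1 \<union> E2"] E by auto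
  also have "\<dots> \<le> J.prob {\<omega> \<in> space ?J. (\<Sum>j\<in>J. (h (\<omega> j))\<^sup>2) \<le> 4 * real (card J) * s2 \<and>
      real (card J) * ((\<integral>z. h z \<partial>M) - \<epsilon> / 2) \<le> (\<Sum>j\<in>J. h (\<omega> j))}"
  proof (rule J.finite_measure_mono)
    show "space ?J - (E1 \<union> E2) \<subseteq> {\<omega> \<in> space ?J. (\<Sum>j\<in>J. (h (\<omega> j))\<^sup>2) \<le> 4 * real (card J) * s2 \<and>
      real (card J) * ((\<integral>z. h z \<partial>M) - \<epsilon> / 2) \<le> (\<Sum>j\<in>J. h (\<omega> j))}"
    proof
      fix \<omega> assume \<omega>: "\<omega> \<in> space ?J - (E1 \<union> E2)"
      then have "(\<Sum>j\<in>J. h (\<omega> j) - \<mu>)\<^sup>2 < (N * \<epsilon> / 2)\<^sup>2" by (auto simp: E2_def)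
      then have "\<bar>\<Sum>j\<in>J. h (\<omega> j) - \<mu>\<bar> < N * \<epsilon> / 2"
        using N \<epsilon> by (metis abs_of_pos abs_square_less_1 divide_pos_pos mult_pos_pos not_le abs_le_square_iff zero_less_numeral)
      then have "- (N * \<epsilon> / 2) < (\<Sum>j\<in>J. h (\<omega> j) - \<mu>)" by linarith
      then have "N * (\<mu> - \<epsilon> / 2) \<le> (\<Sum>j\<in>J. h (\<omega> j))"
        by (simp add: sum_subtractf N_def algebra_simps)
      then show "\<omega> \<in> {\<omega> \<in> space ?J. (\<Sum>j\<in>J. (h (\<omega> j))\<^sup>2) \<le> 4 * real (card J) * s2 \<and>
          real (card J) * ((\<integral>z. h z \<partial>M) - \<epsilon> / 2) \<le> (\<Sum>j\<in>J. h (\<omega> j))}"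
        using \<omega> by (auto simp: E1_def N_def \<mu>_def)
    qed
  qed measurable
  finally show ?thesis .
qed

text \<open>2304 = 4 * 4 * 144. Chaining is run with threshold \<open>\<epsilon> / 2\<close> (a
  factor 4), with entropy constant \<open>4 * A\<close>, and at radius \<open>12 * \<sigma>\<close>,
  where \<open>12 powr (2 - p) \<le> 144\<close>.\<close>

definition dev_const :: "real \<Rightarrow> real" where
  "dev_const p = 2304 * chain_const p"

text \<open>The double sample is fixed and only the swap varies. A bad swap either makes the sum of
  squares of the first half exceed \<open>64 * real n * s2\<close>, or the paired differences have
  quadratic mean at most \<open>12 * sqrt s2\<close> and chaining applies to them. Each alternative
  accounts for at most the fraction \<open>exp (- x) / 4\<close> of the swaps.\<close>

lemma swap_count_le:
  fixes u :: "'f \<Rightarrow> nat \<Rightarrow> real"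
  assumes finF: "finite F" and n: "1 \<le> n" and B: "0 < B" and s2: "0 < s2" and \<epsilon>: "0 < \<epsilon>"
    and p: "0 < p" "p < 2" and A: "0 \<le> A" and x: "1 \<le> x" and B\<epsilon>: "B * \<epsilon> \<le> s2"
    and bound: "\<And>f i. f \<in> F \<Longrightarrow> i < n + n \<Longrightarrow> \<bar>u f i\<bar> \<le> B"
    and cover: "\<And>\<delta>. 0 < \<delta> \<Longrightarrow> \<exists>C\<subseteq>F. real (card C) \<le> exp (A * \<delta> powr - p) \<and>
        (\<forall>f\<in>F. \<exists>c\<in>C. (\<Sum>i<n + n. (u f i - u c i)\<^sup>2) \<le> 2 * real n * \<delta>\<^sup>2)"
    and h1: "dev_const p * A * sqrt s2 powr (2 - p) \<le> real n * \<epsilon>\<^sup>2"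
    and h2: "dev_const p * x * s2 \<le> real n * \<epsilon>\<^sup>2"
  shows "real (card {I \<in> Pow {..<n}. \<exists>f\<in>F.
      (\<Sum>i<n. (u f (swap_halves n I (n + i)))\<^sup>2) \<le> 4 * real n * s2 \<and>
      real n * (\<epsilon> / 2) \<le> (\<Sum>i<n. u f (swap_halves n I (n + i))) - (\<Sum>i<n. u f (swap_halves n I i))})
    \<le> 2 ^ n * (exp (- x) / 2)"
proof -
  define \<sigma> where "\<sigma> = sqrt s2"
  have \<sigma>: "0 < \<sigma>" "\<sigma>\<^sup>2 = s2" using s2 by (auto simp: \<sigma>_def)
  define v where "v f i = u f (n + i) - u f i" for f i
  define W where "W = v ` F"
  let ?S1 = "{I \<in> Pow {..<n}. \<exists>w\<in>W. (\<Sum>i<n. (w i)\<^sup>2) \<le> real n * (12 * \<sigma>)\<^sup>2 \<and>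
      real n * (\<epsilon> / 2) \<le> signed_sum n I w}"
  let ?S2 = "{I \<in> Pow {..<n}. \<exists>f\<in>F.
      (\<Sum>i<n. (u f (swap_halves n I (n + i)))\<^sup>2) \<le> 4 * real n * s2 \<and>
      64 * real n * s2 < (\<Sum>i<n. (u f (swap_halves n I i))\<^sup>2)}"
  have half: "(\<Sum>i<n. (u f (n + i) - u f i - (c (n + i) - c i))\<^sup>2) \<le> 2 * (\<Sum>i<n + n. (u f i - c i)\<^sup>2)" for f c
  proof -
    have "(\<Sum>i<n. (u f (n + i) - u f i - (c (n + i) - c i))\<^sup>2)
        \<le> (\<Sum>i<n. 2 * (u f i - c i)\<^sup>2 + 2 * (u f (n + i) - c (n + i))\<^sup>2)"
    proof (rule sum_mono)
      fix i
      show "(u f (n + i) - u f i - (c (n + i) - c i))\<^sup>2 \<le> 2 * (u f i - c i)\<^sup>2 + 2 * (u f (n + i) - c (n + i))\<^sup>2"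
        using square_add_le[of "c i - u f i" "u f (n + i) - c (n + i)"]
        by (simp add: power2_commute[of "c i"] algebra_simps)
    qed
    also have "\<dots> = 2 * (\<Sum>i<n + n. (u f i - c i)\<^sup>2)"
      by (simp add: sum_lessThan_add_nat sum.distrib sum_distrib_left)
    finally show ?thesis .
  qed
  have S1: "real (card ?S1) \<le> 2 ^ n * exp (- x) / 4"
  proof (rule rademacher_chaining[where A = "4 * A" and p = p])
    show "\<exists>C. finite C \<and> real (card C) \<le> exp (4 * A * \<delta> powr - p) \<and>
        (\<forall>w\<in>W. \<exists>c\<in>C. (\<Sum>i<n. (w i - c i)\<^sup>2) \<le> real n * \<delta>\<^sup>2)" if \<delta>: "0 < \<delta>" for \<delta>
    proof -
      obtain C where C: "C \<subseteq> F" "real (card C) \<le> exp (A * (\<delta> / 2) powr - p)"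
        "\<And>f. f \<in> F \<Longrightarrow> \<exists>c\<in>C. (\<Sum>i<n + n. (u f i - u c i)\<^sup>2) \<le> 2 * real n * (\<delta> / 2)\<^sup>2"
        using cover[OF half_gt_zero[OF \<delta>]] by blast
      have finC: "finite C" using C(1) finF finite_subset by blast
      \<comment> \<open>Nets at radius \<open>\<delta> / 2\<close> on the \<open>n + n\<close>
        points become nets at radius \<open>\<delta>\<close> for the \<open>n\<close> paired
        differences; the price is the factor \<open>2 powr p\<close>, at most 4, in the
        entropy.\<close>
      have "(\<delta> / 2) powr - p \<le> 4 * \<delta> powr - p"
      proof -
        have "(\<delta> / 2) powr - p = \<delta> powr - p * 2 powr p"
          using \<delta> by (simp add: powr_divide powr_minus field_simps)
        also have "\<dots> \<le> \<delta> powr - p * 2 powr 2" using p by (intro mult_left_mono powr_mono) auto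
        finally show ?thesis by simp
      qed
      then have "A * (\<delta> / 2) powr - p \<le> 4 * A * \<delta> powr - p"
        using A mult_left_mono by fastforce
      then have "real (card C) \<le> exp (4 * A * \<delta> powr - p)" using C(2) by (meson exp_le_cancel_iff order_trans)
      moreover have "card (v ` C) \<le> card C" by (rule card_image_le[OF finC])
      ultimately have "real (card (v ` C)) \<le> exp (4 * A * \<delta> powr - p)" by linarith
      moreover have "\<exists>c\<in>v ` C. (\<Sum>i<n. (w i - c i)\<^sup>2) \<le> real n * \<delta>\<^sup>2" if "w \<in> W" for w
      proof -
        obtain f where f: "f \<in> F" "w = v f" using \<open>w \<in> W\<close> by (auto simp: W_def)
        obtain c where c: "c \<in> C" "(\<Sum>i<n + n. (u f i - u c i)\<^sup>2) \<le> 2 * real n * (\<delta> / 2)\<^sup>2"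
          using C(3)[OF f(1)] by blast
        then have "(\<Sum>i<n. (w i - v c i)\<^sup>2) \<le> real n * \<delta>\<^sup>2"
          using half[of f "u c"] by (simp add: f(2) v_def power_divide)
        then show ?thesis using c(1) by blast
      qed
      ultimately show ?thesis using finC by (intro exI[of _ "v ` C"]) auto
    qed
    have "chain_const p * (4 * A) * (12 * \<sigma>) powr (2 - p) \<le> chain_const p * (4 * A) * (144 * \<sigma> powr (2 - p))"
    proof (rule mult_left_mono)
      have "(12::real) powr (2 - p) \<le> 12 powr 2" using p by (intro powr_mono) auto
      then show "(12 * \<sigma>) powr (2 - p) \<le> 144 * \<sigma> powr (2 - p)"
        using \<sigma> by (simp add: powr_mult mult_right_mono)
    qed (use A chain_const_ge[OF p] in simp)
    also have "\<dots> = dev_const p * A * sqrt s2 powr (2 - p) / 4" by (simp add: dev_const_def \<sigma>_def)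
    also have "\<dots> \<le> real n * (\<epsilon> / 2)\<^sup>2" using h1 by (simp add: power_divide)
    finally show "chain_const p * (4 * A) * (12 * \<sigma>) powr (2 - p) \<le> real n * (\<epsilon> / 2)\<^sup>2" .
    have "0 \<le> s2 * (x * chain_const p)" using chain_const_ge[OF p] x s2 by simp
    then have "4 * (chain_const p * x * (12 * \<sigma>)\<^sup>2) \<le> dev_const p * x * s2"
      by (simp add: power_mult_distrib \<sigma>(2) dev_const_def)
    also have "\<dots> \<le> real n * \<epsilon>\<^sup>2" by (rule h2)
    finally show "chain_const p * x * (12 * \<sigma>)\<^sup>2 \<le> real n * (\<epsilon> / 2)\<^sup>2" by (simp add: power_divide)
  qed (use finF n \<sigma> \<epsilon> p A x in \<open>auto simp: W_def\<close>)
  have S2: "real (card ?S2) \<le> 2 ^ n * (exp (- x) / 4)"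
  proof -
    obtain C where C: "C \<subseteq> F" "real (card C) \<le> exp (A * \<sigma> powr - p)"
        "\<And>f. f \<in> F \<Longrightarrow> \<exists>c\<in>C. (\<Sum>i<n + n. (u f i - u c i)\<^sup>2) \<le> 2 * real n * s2"
      using cover[OF \<sigma>(1)] unfolding \<sigma>(2) by blast
    have "real (card ?S2) \<le> 2 ^ n * (real (card C) * exp (- 2 * real n * s2 / B\<^sup>2))"
    proof (rule rademacher_second_moment)
      show "finite C" using C(1) finF finite_subset by blast
      show "\<bar>u c i\<bar> \<le> B" if "c \<in> C" "i < n + n" for c i using that C(1) bound by blast
    qed (use B n s2 C(3) in auto)
    also have "\<dots> \<le> 2 ^ n * (exp (A * \<sigma> powr - p) * exp (- 2 * real n * s2 / B\<^sup>2))"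
      using C(2) by (intro mult_left_mono mult_right_mono) auto
    also have "exp (A * \<sigma> powr - p) * exp (- 2 * real n * s2 / B\<^sup>2) \<le> exp (- x - 2)"
    proof -
      \<comment> \<open>Because \<open>B * \<epsilon> \<le> s2\<close>, the available exponent
        \<open>2 * real n * s2 / B\<^sup>2\<close> is at least \<open>2 * q\<close>. One
        \<open>q\<close> absorbs the entropy at radius \<open>\<sigma>\<close>, the other exceeds
        \<open>3 * x\<close> and hence \<open>x + 2\<close>.\<close>
      define q where "q = real n * \<epsilon>\<^sup>2 / s2"
      have "q \<le> real n * s2 / B\<^sup>2"
      proof -
        have "(B * \<epsilon>)\<^sup>2 \<le> s2\<^sup>2" using B\<epsilon> B \<epsilon> by (intro power_mono) auto
        then have "real n * (B * \<epsilon>)\<^sup>2 \<le> real n * s2\<^sup>2" by (intro mult_left_mono) auto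
        then show ?thesis using s2 B by (simp add: q_def field_simps power2_eq_square)
      qed
      moreover have "A * \<sigma> powr - p \<le> q"
      proof -
        have "A * \<sigma> powr (2 - p) \<le> dev_const p * (A * \<sigma> powr (2 - p))"
          using mult_right_mono[of 1 "dev_const p" "A * \<sigma> powr (2 - p)"] chain_const_ge[OF p] A
          by (simp add: dev_const_def)
        then have "A * \<sigma> powr (2 - p) \<le> real n * \<epsilon>\<^sup>2" using h1 by (simp add: \<sigma>_def mult.assoc)
        then have "A * \<sigma> powr (2 - p) / s2 \<le> q" using s2 by (simp add: q_def divide_right_mono)
        moreover have "\<sigma> powr (2 - p) / s2 = \<sigma> powr - p"
          using \<sigma> by (simp add: \<sigma>(2)[symmetric] powr_diff powr_minus field_simps)
        ultimately show ?thesis by (metis times_divide_eq_right)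
      qed
      moreover have "3 * x \<le> q"
      proof -
        have "3 * x * s2 \<le> dev_const p * x * s2"
          using chain_const_ge[OF p] x s2 by (intro mult_right_mono) (auto simp: dev_const_def)
        then have "3 * x * s2 \<le> real n * \<epsilon>\<^sup>2" using h2 by linarith
        then show ?thesis using s2 by (simp add: q_def field_simps)
      qed
      ultimately show ?thesis using x by (simp flip: exp_add)
    qed
    also have "exp (- x - 2) \<le> exp (- x) / 4"
    proof -
      have "2 \<le> exp (1::real)" using exp_ge_add_one_self[of 1] by simp
      then have "2 * 2 \<le> exp (1::real) * exp 1" by (intro mult_mono) auto
      then have "4 \<le> exp (2::real)" by (simp flip: exp_add)
      then have "exp (- x) / exp 2 \<le> exp (- x) / 4" by (intro divide_left_mono) auto
      then show ?thesis by (simp only: exp_diff)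
    qed
    finally show ?thesis by simp
  qed
  have "{I \<in> Pow {..<n}. \<exists>f\<in>F.
      (\<Sum>i<n. (u f (swap_halves n I (n + i)))\<^sup>2) \<le> 4 * real n * s2 \<and>
      real n * (\<epsilon> / 2) \<le> (\<Sum>i<n. u f (swap_halves n I (n + i))) - (\<Sum>i<n. u f (swap_halves n I i))}
    \<subseteq> ?S1 \<union> ?S2" (is "?S \<subseteq> _")
  proof
    fix I assume "I \<in> ?S"
    then obtain f where I: "I \<in> Pow {..<n}" and f: "f \<in> F"
      and small: "(\<Sum>i<n. (u f (swap_halves n I (n + i)))\<^sup>2) \<le> 4 * real n * s2"
      and dev: "real n * (\<epsilon> / 2) \<le> (\<Sum>i<n. u f (swap_halves n I (n + i))) - (\<Sum>i<n. u f (swap_halves n I i))"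
      by auto
    show "I \<in> ?S1 \<union> ?S2"
    proof (cases "64 * real n * s2 < (\<Sum>i<n. (u f (swap_halves n I i))\<^sup>2)")
      case True
      then show ?thesis using I f small by auto
    next
      case False
      have "(\<Sum>i<n. (v f i)\<^sup>2) \<le> 2 * (\<Sum>i<n + n. (u f i)\<^sup>2)"
        using half[of f "\<lambda>_. 0"] by (simp add: v_def)
      also have "(\<Sum>i<n + n. (u f i)\<^sup>2) \<le> 68 * real n * s2"
        using sum_swap_halves[of "\<lambda>i. (u f i)\<^sup>2" n I] small False by simp
      \<comment> \<open>136 = 2 * (64 + 4), rounded up next to the square of 12.\<close>
      finally have "(\<Sum>i<n. (v f i)\<^sup>2) \<le> 136 * (real n * s2)" by simp
      also have "\<dots> \<le> 144 * (real n * s2)" using s2 by simp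
      also have "\<dots> = real n * (12 * \<sigma>)\<^sup>2" by (simp add: power_mult_distrib \<sigma>)
      finally have "(\<Sum>i<n. (v f i)\<^sup>2) \<le> real n * (12 * \<sigma>)\<^sup>2" .
      \<comment> \<open>The deviation is ghost half minus first half, so the swap identity is
        applied to \<open>- u f\<close>.\<close>
      moreover have "real n * (\<epsilon> / 2) \<le> signed_sum n I (v f)"
        using dev signed_sum_swap_halves[of "\<lambda>i. - u f i" n I] by (simp add: v_def[abs_def] sum_negf)
      ultimately show ?thesis using I f by (auto simp: W_def)
    qed
  qed
  then have "card ?S \<le> card (?S1 \<union> ?S2)" by (intro card_mono) auto
  also have "\<dots> \<le> card ?S1 + card ?S2" by (rule card_Un_le)
  finally have "real (card ?S) \<le> real (card ?S1) + real (card ?S2)" by linarith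
  then show ?thesis using S1 S2 by simp
qed

lemma swap_halves_less:
  assumes "I \<subseteq> {..<n}" "i < n + n"
  shows "swap_halves n I i < n + n"
  using assms by (auto simp: swap_halves_def)

lemma swap_halves_involution:
  assumes "I \<subseteq> {..<n}" "i < n + n"
  shows "swap_halves n I (swap_halves n I i) = i"
  using assms by (auto simp: swap_halves_def)

text \<open>Given a bad sample, the offending \<open>f\<close> is fixed and at least half of all
  ghost samples complete the pair to a point of \<open>E\<close>; hence \<open>Bad\<close> has at
  most twice the probability of \<open>E\<close>. The law of the double sample is invariant under
  swaps, so the probability of \<open>E\<close> is the mean, over all swaps, of probabilities of
  swapped events, and for each double sample the count of bad swaps bounds this mean. Finiteness of
  \<open>F\<close> makes \<open>Bad\<close> and \<open>E\<close> finite unions of measurable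
  sets.\<close>

lemma empirical_deviation_finite_class:
  fixes g :: "'f \<Rightarrow> 'z \<Rightarrow> real" and M :: "'z measure"
  assumes M: "prob_space M" and finF: "finite F" and n: "1 \<le> n" and B: "0 < B" and s2: "0 < s2"
    and \<epsilon>: "0 < \<epsilon>" and p: "0 < p" "p < 2" and A: "0 \<le> A" and x: "1 \<le> x" and B\<epsilon>: "B * \<epsilon> \<le> s2"
    and meas: "\<And>f. f \<in> F \<Longrightarrow> g f \<in> borel_measurable M"
    and bound: "\<And>f z. f \<in> F \<Longrightarrow> z \<in> space M \<Longrightarrow> \<bar>g f z\<bar> \<le> B"
    and var: "\<And>f. f \<in> F \<Longrightarrow> (\<integral>z. (g f z)\<^sup>2 \<partial>M) \<le> s2"
    and cover: "\<And>\<omega> \<delta>. 0 < \<delta> \<Longrightarrow> (\<And>i. i < n + n \<Longrightarrow> \<omega> i \<in> space M) \<Longrightarrow>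
        \<exists>C\<subseteq>F. real (card C) \<le> exp (A * \<delta> powr - p) \<and>
        (\<forall>f\<in>F. \<exists>c\<in>C. (\<Sum>i<n + n. (g f (\<omega> i) - g c (\<omega> i))\<^sup>2) \<le> 2 * real n * \<delta>\<^sup>2)"
    and h1: "dev_const p * A * sqrt s2 powr (2 - p) \<le> real n * \<epsilon>\<^sup>2"
    and h2: "dev_const p * x * s2 \<le> real n * \<epsilon>\<^sup>2"
  defines "Bad \<equiv> {T \<in> space (PiM {..<n} (\<lambda>_. M)). \<exists>f\<in>F.
      real n * \<epsilon> \<le> real n * (\<integral>z. g f z \<partial>M) - (\<Sum>i<n. g f (T i))}"
  shows "Bad \<in> sets (PiM {..<n} (\<lambda>_. M))" "measure (PiM {..<n} (\<lambda>_. M)) Bad \<le> exp (- x)"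
proof -
  interpret prob_space M by fact
  interpret PS: product_sigma_finite "\<lambda>_::nat. M" by standard
  define M1 where "M1 = PiM {..<n} (\<lambda>_. M)"
  define M2 where "M2 = PiM {n..<n + n} (\<lambda>_. M)"
  define MM where "MM = PiM {..<n + n} (\<lambda>_. M)"
  interpret M1: prob_space M1 unfolding M1_def by (intro prob_space_PiM M)
  interpret M2: prob_space M2 unfolding M2_def by (intro prob_space_PiM M)
  interpret MM: prob_space MM unfolding MM_def by (intro prob_space_PiM M)
  have un: "{..<n} \<union> {n..<n + n} = {..<n + n}" by auto
  define Ev where "Ev \<omega> \<longleftrightarrow> (\<exists>f\<in>F. (\<Sum>i<n. (g f (\<omega> (n + i)))\<^sup>2) \<le> 4 * real n * s2 \<and>
      real n * (\<epsilon> / 2) \<le> (\<Sum>i<n. g f (\<omega> (n + i))) - (\<Sum>i<n. g f (\<omega> i)))" for \<omega>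
  define E where "E = {\<omega> \<in> space MM. Ev \<omega>}"
  have mMM: "(\<lambda>\<omega>. g f (\<omega> j)) \<in> borel_measurable MM" if "f \<in> F" "j < n + n" for f j
    unfolding MM_def using that by (intro measurable_PiM_component_comp meas) auto
  have mM1: "(\<lambda>\<omega>. g f (\<omega> j)) \<in> borel_measurable M1" if "f \<in> F" "j < n" for f j
    unfolding M1_def using that by (intro measurable_PiM_component_comp meas) auto
  have E: "E \<in> sets MM"
    unfolding E_def Ev_def
  proof (intro sets.sets_Collect_finite_Ex[OF _ finF])
    fix f assume f: "f \<in> F"
    have [measurable]: "(\<lambda>\<omega>. \<Sum>i<n. (g f (\<omega> (n + i)))\<^sup>2) \<in> borel_measurable MM"
      "(\<lambda>\<omega>. (\<Sum>i<n. g f (\<omega> (n + i))) - (\<Sum>i<n. g f (\<omega> i))) \<in> borel_measurable MM"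
      using mMM[OF f] by (auto intro!: borel_measurable_sum borel_measurable_diff borel_measurable_power)
    show "{\<omega> \<in> space MM. (\<Sum>i<n. (g f (\<omega> (n + i)))\<^sup>2) \<le> 4 * real n * s2 \<and>
      real n * (\<epsilon> / 2) \<le> (\<Sum>i<n. g f (\<omega> (n + i))) - (\<Sum>i<n. g f (\<omega> i))} \<in> sets MM"
      by measurable
  qed
  have Bad: "Bad \<in> sets M1"
    unfolding Bad_def M1_def[symmetric]
  proof (intro sets.sets_Collect_finite_Ex[OF _ finF])
    fix f assume f: "f \<in> F"
    have [measurable]: "(\<lambda>\<omega>. \<Sum>i<n. g f (\<omega> i)) \<in> borel_measurable M1"
      using mM1[OF f] by (auto intro!: borel_measurable_sum)
    show "{T \<in> space M1. real n * \<epsilon> \<le> real n * (\<integral>z. g f z \<partial>M) - (\<Sum>i<n. g f (T i))} \<in> sets M1"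
      by measurable
  qed
  then show "Bad \<in> sets (PiM {..<n} (\<lambda>_. M))" by (simp add: M1_def)
  have PE: "measure MM E \<le> exp (- x) / 2"
  proof -
    \<comment> \<open>The restriction keeps the swapped point extensional, as elements of the
      product space must be. Reindexing an identically distributed product along a permutation
      preserves it.\<close>
    define sw where "sw I \<omega> = (\<lambda>i\<in>{..<n + n}. \<omega> (swap_halves n I i))" for I and \<omega> :: "nat \<Rightarrow> 'z"
    have sw_meas: "sw I \<in> measurable MM MM" if "I \<in> Pow {..<n}" for I
      unfolding sw_def[abs_def] MM_def
      by (rule measurable_restrict) (use that swap_halves_less[of I n] in auto)
    have sw_distr: "distr MM MM (sw I) = MM" if "I \<in> Pow {..<n}" for I
    proof -
      have "inj_on (swap_halves n I) {..<n + n}"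
        by (rule inj_on_inverseI[where g = "swap_halves n I"])
           (use that in \<open>auto intro: swap_halves_involution\<close>)
      moreover have "swap_halves n I \<in> {..<n + n} \<rightarrow> {..<n + n}"
        using that swap_halves_less[of I n] by auto
      ultimately show ?thesis
        using distr_PiM_reindex[of "{..<n + n}" "\<lambda>_. M" "swap_halves n I" "{..<n + n}"] M
        unfolding MM_def sw_def[abs_def] by simp
    qed
    have swE: "measure MM E = measure MM (sw I -` E \<inter> space MM)" "sw I -` E \<inter> space MM \<in> sets MM"
      if "I \<in> Pow {..<n}" for I
      using measure_distr[OF sw_meas[OF that] E] sw_distr[OF that] measurable_sets[OF sw_meas[OF that] E]
      by auto
    have "2 ^ n * measure MM E = (\<Sum>I\<in>Pow {..<n}. measure MM (sw I -` E \<inter> space MM))"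
    proof -
      have "(\<Sum>I\<in>Pow {..<n}. measure MM (sw I -` E \<inter> space MM)) = (\<Sum>I\<in>Pow {..<n}. measure MM E)"
        by (rule sum.cong[OF refl swE(1)[symmetric]])
      then show ?thesis by (simp add: card_Pow)
    qed
    also have "\<dots> = (\<Sum>I\<in>Pow {..<n}. \<integral>\<omega>. indicator (sw I -` E \<inter> space MM) \<omega> \<partial>MM)"
      using swE(2) by (intro sum.cong) auto
    also have "\<dots> = (\<integral>\<omega>. (\<Sum>I\<in>Pow {..<n}. indicator (sw I -` E \<inter> space MM) \<omega>) \<partial>MM)"
      using swE(2) by (subst Bochner_Integration.integral_sum)
        (auto intro!: integrable_real_indicator simp: MM.emeasure_finite less_top[symmetric])
    also have "\<dots> \<le> (\<integral>\<omega>. 2 ^ n * (exp (- x) / 2) \<partial>MM)"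
    proof (rule integral_mono)
      fix \<omega> assume \<omega>: "\<omega> \<in> space MM"
      then have \<omega>M: "\<omega> i \<in> space M" if "i < n + n" for i using that by (auto simp: MM_def space_PiM)
      have "(\<Sum>I\<in>Pow {..<n}. indicator (sw I -` E \<inter> space MM) \<omega> :: real)
          = real (card (Pow {..<n} \<inter> {I. \<omega> \<in> sw I -` E \<inter> space MM}))"
        unfolding indicator_def by (rule sum_of_bool_eq) simp_all
      also have "Pow {..<n} \<inter> {I. \<omega> \<in> sw I -` E \<inter> space MM} \<subseteq> {I \<in> Pow {..<n}. \<exists>f\<in>F.
          (\<Sum>i<n. (g f (\<omega> (swap_halves n I (n + i))))\<^sup>2) \<le> 4 * real n * s2 \<and>
          real n * (\<epsilon> / 2) \<le> (\<Sum>i<n. g f (\<omega> (swap_halves n I (n + i)))) - (\<Sum>i<n. g f (\<omega> (swap_halves n I i)))}"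
        (is "?L \<subseteq> ?R")
        by (auto simp: E_def Ev_def sw_def)
      then have "real (card ?L) \<le> real (card ?R)" by (intro of_nat_mono card_mono) auto
      also have "\<dots> \<le> 2 ^ n * (exp (- x) / 2)"
        by (rule swap_count_le[where u = "\<lambda>f i. g f (\<omega> i)", OF finF n B s2 \<epsilon> p A x B\<epsilon> _ _ h1 h2])
           (use bound \<omega>M cover[OF _ \<omega>M] in auto)
      finally show "(\<Sum>I\<in>Pow {..<n}. indicator (sw I -` E \<inter> space MM) \<omega>) \<le> 2 ^ n * (exp (- x) / 2)" .
    qed (use swE(2) in \<open>auto intro!: Bochner_Integration.integrable_sum integrable_real_indicator simp: MM.emeasure_finite less_top[symmetric]\<close>)
    also have "\<dots> = 2 ^ n * (exp (- x) / 2)" by (simp add: MM.prob_space)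
    finally show ?thesis by simp
  qed
  \<comment> \<open>Fubini over sample and ghost: for \<open>T \<in> Bad\<close> the fibre of
    \<open>E\<close> over \<open>T\<close> contains the ghost event of the single \<open>f\<close>
    that makes \<open>T\<close> bad. The deviation \<open>\<epsilon>\<close> of \<open>T\<close>
    minus the \<open>\<epsilon> / 2\<close> granted to the ghost mean leaves the
    \<open>\<epsilon> / 2\<close> in \<open>Ev\<close>.\<close>
  have half: "ennreal (1 / 2) * emeasure M1 Bad \<le> emeasure MM E"
  proof -
    let ?X = "merge {..<n} {n..<n + n} -` E \<inter> space (M1 \<Otimes>\<^sub>M M2)"
    have mm: "merge {..<n} {n..<n + n} \<in> measurable (M1 \<Otimes>\<^sub>M M2) MM"
      unfolding M1_def M2_def MM_def un[symmetric] by (rule measurable_merge)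
    have X: "?X \<in> sets (M1 \<Otimes>\<^sub>M M2)" by (rule measurable_sets[OF mm E])
    have "distr (M1 \<Otimes>\<^sub>M M2) MM (merge {..<n} {n..<n + n}) = MM"
    proof -
      have "{..<n} \<inter> {n..<n + n} = {}" by auto
      from PS.distr_merge[OF this] show ?thesis unfolding M1_def M2_def MM_def un by simp
    qed
    then have "emeasure MM E = emeasure (M1 \<Otimes>\<^sub>M M2) ?X"
      using emeasure_distr[OF mm E] by simp
    also have "\<dots> = (\<integral>\<^sup>+T. emeasure M2 (Pair T -` ?X) \<partial>M1)"
      by (rule M2.emeasure_pair_measure_alt[OF X])
    also have "\<dots> \<ge> (\<integral>\<^sup>+T. ennreal (1 / 2) * indicator Bad T \<partial>M1)"
    proof (rule nn_integral_mono)
      fix T assume T: "T \<in> space M1"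
      show "ennreal (1 / 2) * indicator Bad T \<le> emeasure M2 (Pair T -` ?X)"
      proof (cases "T \<in> Bad")
        case True
        then obtain f where f: "f \<in> F"
          and dev: "real n * \<epsilon> \<le> real n * (\<integral>z. g f z \<partial>M) - (\<Sum>i<n. g f (T i))"
          by (auto simp: Bad_def)
        let ?G = "{\<omega> \<in> space M2. (\<Sum>j\<in>{n..<n + n}. (g f (\<omega> j))\<^sup>2) \<le> 4 * real (card {n..<n + n}) * s2 \<and>
          real (card {n..<n + n}) * ((\<integral>z. g f z \<partial>M) - \<epsilon> / 2) \<le> (\<Sum>j\<in>{n..<n + n}. g f (\<omega> j))}"
        have "1 / 2 \<le> measure M2 ?G"
          unfolding M2_def
        proof (rule ghost_sample_half[OF M meas[OF f] bound[OF f] var[OF f] s2 _ _ \<epsilon>])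
          have "16 * s2 \<le> dev_const p * x * s2"
            using chain_const_ge[OF p] x s2 mult_mono[of 16 "dev_const p" 1 x]
            by (intro mult_right_mono) (auto simp: dev_const_def)
          then show "16 * s2 \<le> real (card {n..<n + n}) * \<epsilon>\<^sup>2" using h2 by simp
        qed (use n in auto)
        also have "\<dots> \<le> measure M2 (Pair T -` ?X)"
        proof (rule M2.finite_measure_mono)
          show "Pair T -` ?X \<in> sets M2" by (rule sets_Pair1[OF X])
          show "?G \<subseteq> Pair T -` ?X"
          proof
            fix \<omega> assume \<omega>: "\<omega> \<in> ?G"
            define m where "m = merge {..<n} {n..<n + n} (T, \<omega>)"
            have sp: "(T, \<omega>) \<in> space (M1 \<Otimes>\<^sub>M M2)" using T \<omega> by (simp add: space_pair_measure)
            then have "m \<in> space MM" unfolding m_def by (rule measurable_space[OF mm])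
            have m: "m i = T i" "m (n + i) = \<omega> (n + i)" if "i < n" for i
              using that by (auto simp: m_def merge_def)
            have sh: "(\<Sum>j\<in>{n..<n + n}. \<phi> j) = (\<Sum>i<n. \<phi> (n + i))" for \<phi> :: "nat \<Rightarrow> real"
              by (rule sum.reindex_bij_witness[of _ "\<lambda>i. n + i" "\<lambda>j. j - n"]) auto
            have "Ev m"
              unfolding Ev_def
            proof (intro bexI[OF _ f] conjI)
              show "(\<Sum>i<n. (g f (m (n + i)))\<^sup>2) \<le> 4 * real n * s2"
                using \<omega> by (simp add: m sh)
              have "real n * ((\<integral>z. g f z \<partial>M) - \<epsilon> / 2) \<le> (\<Sum>i<n. g f (m (n + i)))"
                using \<omega> by (simp add: m sh)
              moreover have "(\<Sum>i<n. g f (m i)) = (\<Sum>i<n. g f (T i))" by (simp add: m)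
              ultimately show "real n * (\<epsilon> / 2) \<le> (\<Sum>i<n. g f (m (n + i))) - (\<Sum>i<n. g f (m i))"
                using dev by (simp add: algebra_simps)
            qed
            then show "\<omega> \<in> Pair T -` ?X" using sp \<open>m \<in> space MM\<close> by (simp add: E_def m_def)
          qed
        qed
        finally show ?thesis
          using True by (simp add: M2.emeasure_eq_measure ennreal_leI del: ennreal_half)
      qed simp
    qed
    finally have "(\<integral>\<^sup>+T. ennreal (1 / 2) * indicator Bad T \<partial>M1) \<le> emeasure MM E" .
    then show ?thesis using nn_integral_cmult_indicator[OF Bad, of "ennreal (1 / 2)"] by simp
  qed
  have "measure M1 Bad \<le> 2 * measure MM E"
  proof -
    have "ennreal (1 / 2 * measure M1 Bad) = ennreal (1 / 2) * ennreal (measure M1 Bad)"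
      by (rule ennreal_mult) auto
    also have "\<dots> \<le> ennreal (measure MM E)"
      using half by (simp only: M1.emeasure_eq_measure MM.emeasure_eq_measure)
    finally show ?thesis by (simp add: ennreal_le_iff)
  qed
  then show "measure (PiM {..<n} (\<lambda>_. M)) Bad \<le> exp (- x)" using PE by (simp add: M1_def)
qed

section \<open>Covering and minimization in the RKHS\<close>

text \<open>The squared norm of \<open>Phi y - Phi x\<close> is a combination of kernel values, and
  the kernel is continuous.\<close>

lemma continuous_feature_map:
  assumes "is_rkhs_cont_kernel Phi"
  shows "continuous_on UNIV Phi"
proof -
  have c: "continuous_on UNIV (\<lambda>z. case z of (x, x') \<Rightarrow> Phi x \<bullet> Phi x')"
    using assms by (simp add: is_rkhs_cont_kernel_def)
  have c1: "continuous_on UNIV (\<lambda>y. Phi y \<bullet> Phi y)"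
  proof -
    have "continuous_on UNIV (\<lambda>y :: 'a. (y, y))" by (intro continuous_intros)
    from continuous_on_compose2[OF c this] show ?thesis by simp
  qed
  have "isCont Phi x" for x
  proof -
    have c2: "continuous_on UNIV (\<lambda>y. Phi y \<bullet> Phi x)"
    proof -
      have "continuous_on UNIV (\<lambda>y. (y, x))" by (intro continuous_intros)
      from continuous_on_compose2[OF c this] show ?thesis by simp
    qed
    have eq: "norm (Phi y - Phi x) = sqrt (Phi y \<bullet> Phi y - 2 * (Phi y \<bullet> Phi x) + Phi x \<bullet> Phi x)" for y
      by (simp add: norm_eq_sqrt_inner inner_diff_left inner_diff_right inner_commute algebra_simps)
    have "continuous_on UNIV (\<lambda>y. norm (Phi y - Phi x))"
      unfolding eq by (intro continuous_intros c1 c2)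
    then have "isCont (\<lambda>y. norm (Phi y - Phi x)) x"
      by (simp add: continuous_on_eq_continuous_at)
    then have "((\<lambda>y. norm (Phi y - Phi x)) \<longlongrightarrow> 0) (at x)"
      by (simp add: isCont_def)
    then show ?thesis
      unfolding isCont_def by (simp add: tendsto_norm_zero_iff LIM_zero_iff)
  qed
  then show ?thesis by (simp add: continuous_on_eq_continuous_at)
qed

text \<open>Norm balls of the Hilbert space need not be compact, but \<open>range Phi\<close> is, so
  up to a small error an element of \<open>V\<close> acts through its inner products with finitely
  many vectors. Rounding these leaves finitely many cells. The net consists of members of
  \<open>V\<close>, hence inherits every constraint that defines \<open>V\<close>.\<close>

lemma finite_sup_net:
  fixes Phi :: "'x::metric_space \<Rightarrow> 'h::real_inner"
  assumes X: "compact (UNIV :: 'x set)" and Phi: "continuous_on UNIV Phi"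
    and V: "\<And>h. h \<in> V \<Longrightarrow> norm h \<le> R" and \<eta>: "0 < \<eta>"
  shows "\<exists>S\<subseteq>V. finite S \<and> (\<forall>h\<in>V. \<exists>s\<in>S. \<forall>x. \<bar>h \<bullet> Phi x - s \<bullet> Phi x\<bar> \<le> \<eta>)"
proof -
  \<comment> \<open>A positive norm bound, so that the division in \<open>r\<close> is meaningful
    whatever the sign of \<open>R\<close>.\<close>
  define R' where "R' = \<bar>R\<bar> + 1"
  have VR: "norm h \<le> R'" if "h \<in> V" for h using V[OF that] by (auto simp: R'_def)
  have R'0: "0 < R'" by (simp add: R'_def)
  define r where "r = \<eta> / (4 * R')"
  have r: "0 < r" using \<eta> R'0 by (simp add: r_def)
  have "compact (range Phi)" using compact_continuous_image[OF Phi X] .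
  then obtain D where D: "finite D" "range Phi \<subseteq> (\<Union>d\<in>D. ball d r)"
    using r compact_eq_totally_bounded[of "range Phi"] by blast
  \<comment> \<open>The code of \<open>h\<close>: its inner products with the centres, rounded to
    the grid of width \<open>\<eta> / 4\<close>. Equal codes cost \<open>\<eta> / 4\<close>, and
    replacing \<open>Phi x\<close> by a centre costs \<open>\<eta> / 4\<close> for each of the two
    elements.\<close>
  define q where "q h = (\<lambda>d\<in>D. \<lfloor>h \<bullet> d * 4 / \<eta>\<rfloor>)" for h
  define b where "b d = R' * norm d * 4 / \<eta>" for d :: 'h
  have "q ` V \<subseteq> PiE D (\<lambda>d. {\<lfloor>- b d\<rfloor>..\<lfloor>b d\<rfloor>})"
  proof -
    have "q h \<in> PiE D (\<lambda>d. {\<lfloor>- b d\<rfloor>..\<lfloor>b d\<rfloor>})" if "h \<in> V" for h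
    proof (rule PiE_I)
      fix d assume "d \<in> D"
      have "\<bar>h \<bullet> d\<bar> \<le> norm h * norm d" by (rule Cauchy_Schwarz_ineq2)
      also have "\<dots> \<le> R' * norm d" using VR[OF that] by (intro mult_right_mono) auto
      finally have "\<bar>h \<bullet> d\<bar> * 4 / \<eta> \<le> b d" using \<eta> by (simp add: b_def divide_right_mono)
      then have "\<bar>h \<bullet> d * 4 / \<eta>\<bar> \<le> b d" using \<eta> by (simp add: abs_mult)
      then have "- b d \<le> h \<bullet> d * 4 / \<eta>" "h \<bullet> d * 4 / \<eta> \<le> b d" by linarith+
      then have "\<lfloor>- b d\<rfloor> \<le> \<lfloor>h \<bullet> d * 4 / \<eta>\<rfloor>" "\<lfloor>h \<bullet> d * 4 / \<eta>\<rfloor> \<le> \<lfloor>b d\<rfloor>"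
        by (auto intro: floor_mono)
      then show "q h d \<in> {\<lfloor>- b d\<rfloor>..\<lfloor>b d\<rfloor>}" using \<open>d \<in> D\<close> by (simp add: q_def)
    qed (simp add: q_def)
    then show ?thesis by blast
  qed
  then have fin: "finite (q ` V)" by (rule finite_subset) (intro finite_PiE D(1) finite_atLeastAtMost_int)
  define S where "S = inv_into V q ` q ` V"
  have "S \<subseteq> V" unfolding S_def by (auto intro: inv_into_into)
  moreover have "finite S" using fin by (simp add: S_def)
  moreover have "\<exists>s\<in>S. \<forall>x. \<bar>h \<bullet> Phi x - s \<bullet> Phi x\<bar> \<le> \<eta>" if h: "h \<in> V" for h
  proof (intro bexI allI)
    let ?s = "inv_into V q (q h)"
    show "?s \<in> S" using h by (simp add: S_def)
    have s: "?s \<in> V" "q ?s = q h" using h by (auto intro: inv_into_into f_inv_into_f)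
    fix x
    obtain d where d: "d \<in> D" "Phi x \<in> ball d r" using D(2) by blast
    have near: "\<bar>g \<bullet> Phi x - g \<bullet> d\<bar> \<le> \<eta> / 4" if "g \<in> V" for g
    proof -
      have "\<bar>g \<bullet> Phi x - g \<bullet> d\<bar> = \<bar>g \<bullet> (Phi x - d)\<bar>" by (simp add: inner_diff_right)
      also have "\<dots> \<le> norm g * norm (Phi x - d)" by (rule Cauchy_Schwarz_ineq2)
      also have "\<dots> \<le> R' * r"
        using VR[OF that] d(2) R'0 by (intro mult_mono) (auto simp: dist_norm norm_minus_commute)
      also have "\<dots> = \<eta> / 4" using R'0 by (simp add: r_def)
      finally show ?thesis .
    qed
    have "q ?s d = q h d" using s by simp
    then have "\<lfloor>?s \<bullet> d * 4 / \<eta>\<rfloor> = \<lfloor>h \<bullet> d * 4 / \<eta>\<rfloor>" using d(1) by (simp add: q_def)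
    then have "\<bar>h \<bullet> d * 4 / \<eta> - ?s \<bullet> d * 4 / \<eta>\<bar> < 1" by linarith
    also have "h \<bullet> d * 4 / \<eta> - ?s \<bullet> d * 4 / \<eta> = (h \<bullet> d - ?s \<bullet> d) * (4 / \<eta>)"
      by (simp add: diff_divide_distrib left_diff_distrib)
    finally have "\<bar>h \<bullet> d - ?s \<bullet> d\<bar> * (4 / \<eta>) < 1"
      using \<eta> unfolding abs_mult by simp
    then have "\<bar>h \<bullet> d - ?s \<bullet> d\<bar> \<le> \<eta> / 4"
    proof -
      have "y \<le> \<eta> / 4" if "y * (4 / \<eta>) < 1" for y using that \<eta> by (simp add: field_simps)
      then show ?thesis using \<open>\<bar>h \<bullet> d - ?s \<bullet> d\<bar> * (4 / \<eta>) < 1\<close> by blast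
    qed
    then show "\<bar>h \<bullet> Phi x - ?s \<bullet> Phi x\<bar> \<le> \<eta>" using near[OF h] near[OF s(1)] by linarith
  qed
  ultimately show ?thesis by blast
qed

section \<open>Empirical covering numbers\<close>

lemma L2_emp_norm_le_iff:
  assumes "1 \<le> n" "0 \<le> d"
  shows "L2_emp_norm n xs f \<le> d \<longleftrightarrow> (\<Sum>i<n. (f (xs i))\<^sup>2) \<le> real n * d\<^sup>2"
proof -
  have "L2_emp_norm n xs f \<le> d \<longleftrightarrow> sqrt ((1 / real n) * (\<Sum>i<n. (f (xs i))\<^sup>2)) \<le> sqrt (d\<^sup>2)"
    using assms by (simp add: L2_emp_norm_def)
  also have "\<dots> \<longleftrightarrow> (\<Sum>i<n. (f (xs i))\<^sup>2) \<le> real n * d\<^sup>2"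
    unfolding real_sqrt_le_iff using assms by (simp add: field_simps)
  finally show ?thesis .
qed

text \<open>A \<open>LEAST\<close> carries information only if some number qualifies. A finite
  sup-norm net of the unit ball provides one, so the covering number is attained by an actual
  cover.\<close>

lemma cov_num_BH_cover:
  fixes Phi :: "'x::metric_space \<Rightarrow> 'h::real_inner"
  assumes X: "compact (UNIV :: 'x set)" and Phi: "continuous_on UNIV Phi" and n: "1 \<le> n" and \<delta>: "0 < \<delta>"
  shows "1 \<le> cov_num_BH Phi n xs \<delta> \<and> (\<exists>g :: nat \<Rightarrow> 'x \<Rightarrow> real.
      \<forall>h. norm h \<le> 1 \<longrightarrow> (\<exists>i<cov_num_BH Phi n xs \<delta>. L2_emp_norm n xs (\<lambda>x. rkhs_fun Phi h x - g i x) \<le> \<delta>))"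
  unfolding cov_num_BH_def
proof (rule LeastI_ex)
  obtain S where S: "S \<subseteq> {h. norm h \<le> 1}" "finite S"
    "\<And>h. norm h \<le> 1 \<Longrightarrow> \<exists>s\<in>S. \<forall>x. \<bar>h \<bullet> Phi x - s \<bullet> Phi x\<bar> \<le> \<delta>"
    using finite_sup_net[OF X Phi, of "{h. norm h \<le> 1}" 1 \<delta>] \<delta> by auto
  obtain e where e: "bij_betw e {0..<card S} S" using ex_bij_betw_nat_finite[OF S(2)] by blast
  show "\<exists>m. m \<ge> 1 \<and> (\<exists>g :: nat \<Rightarrow> 'x \<Rightarrow> real.
      \<forall>h. norm h \<le> 1 \<longrightarrow> (\<exists>i<m. L2_emp_norm n xs (\<lambda>x. rkhs_fun Phi h x - g i x) \<le> \<delta>))"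
  proof (rule exI[of _ "card S"], rule conjI, goal_cases)
    case 1
    have "S \<noteq> {}" using S(3)[of 0] by auto
    then show ?case using S(2) by (simp add: Suc_le_eq card_gt_0_iff)
  next
    case 2
    show ?case
    proof (rule exI[of _ "\<lambda>i. rkhs_fun Phi (e i)"], intro allI impI)
      fix h :: 'h assume "norm h \<le> 1"
      then obtain s where s: "s \<in> S" "\<And>x. \<bar>h \<bullet> Phi x - s \<bullet> Phi x\<bar> \<le> \<delta>" using S(3) by blast
      then obtain i where i: "i < card S" "e i = s"
        using e unfolding bij_betw_def by (metis atLeastLessThan_iff imageE)
      have "(\<Sum>j<n. (h \<bullet> Phi (xs j) - s \<bullet> Phi (xs j))\<^sup>2) \<le> (\<Sum>j<n. \<delta>\<^sup>2)"
      proof (rule sum_mono)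
        fix j show "(h \<bullet> Phi (xs j) - s \<bullet> Phi (xs j))\<^sup>2 \<le> \<delta>\<^sup>2"
          using s(2)[of "xs j"] \<delta> by (simp add: abs_le_square_iff[symmetric])
      qed
      then have "L2_emp_norm n xs (\<lambda>x. rkhs_fun Phi h x - rkhs_fun Phi (e i) x) \<le> \<delta>"
        using n \<delta> i(2) by (subst L2_emp_norm_le_iff) (auto simp: rkhs_fun_def)
      then show "\<exists>i<card S. L2_emp_norm n xs (\<lambda>x. rkhs_fun Phi h x - rkhs_fun Phi (e i) x) \<le> \<delta>"
        using i(1) by blast
    qed
  qed
qed

text \<open>The centres of the cover are arbitrary functions, to which the loss estimates for
  \<open>S\<close> do not apply. Each used centre is replaced by one element of \<open>S\<close>
  near it, which doubles the radius; the factor \<open>R\<close> comes from scaling \<open>S\<close>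
  into the unit ball.\<close>

lemma rkhs_internal_cover:
  fixes Phi :: "'x::metric_space \<Rightarrow> 'h::real_inner"
  assumes X: "compact (UNIV :: 'x set)" and Phi: "continuous_on UNIV Phi" and n: "1 \<le> n" and \<delta>: "0 < \<delta>"
    and S: "\<And>s. s \<in> S \<Longrightarrow> norm s \<le> R" and R: "0 < R"
    and ent: "ln (real (cov_num_BH Phi n xs \<delta>)) \<le> E"
  shows "\<exists>C\<subseteq>S. real (card C) \<le> exp E \<and>
    (\<forall>s\<in>S. \<exists>c\<in>C. (\<Sum>i<n. (s \<bullet> Phi (xs i) - c \<bullet> Phi (xs i))\<^sup>2) \<le> real n * (2 * R * \<delta>)\<^sup>2)"
proof -
  define m where "m = cov_num_BH Phi n xs \<delta>"
  obtain g where m: "1 \<le> m" and g: "\<And>h. norm h \<le> 1 \<Longrightarrow>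
      \<exists>i<m. L2_emp_norm n xs (\<lambda>x. rkhs_fun Phi h x - g i x) \<le> \<delta>"
    using cov_num_BH_cover[OF X Phi n \<delta>, of xs] unfolding m_def by blast
  have mE: "real m \<le> exp E"
  proof -
    have "real m = exp (ln (real m))" using m by simp
    also have "\<dots> \<le> exp E" using ent by (simp add: m_def)
    finally show ?thesis .
  qed
  have "\<exists>i<m. (\<Sum>j<n. (s \<bullet> Phi (xs j) / R - g i (xs j))\<^sup>2) \<le> real n * \<delta>\<^sup>2" if "s \<in> S" for s
  proof -
    have "norm (s /\<^sub>R R) \<le> 1" using S[OF that] R by (simp add: field_simps)
    from g[OF this] show ?thesis using n \<delta> R
      by (auto simp: L2_emp_norm_le_iff rkhs_fun_def divide_inverse mult.commute)
  qed
  then obtain \<iota> where \<iota>: "\<And>s. s \<in> S \<Longrightarrow> \<iota> s < m"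
    "\<And>s. s \<in> S \<Longrightarrow> (\<Sum>j<n. (s \<bullet> Phi (xs j) / R - g (\<iota> s) (xs j))\<^sup>2) \<le> real n * \<delta>\<^sup>2"
    by metis
  define C where "C = inv_into S \<iota> ` \<iota> ` S"
  have sub: "\<iota> ` S \<subseteq> {..<m}" using \<iota>(1) by auto
  have "C \<subseteq> S" by (auto simp: C_def intro: inv_into_into)
  moreover have "real (card C) \<le> exp E"
  proof -
    have "card C \<le> card (\<iota> ` S)" unfolding C_def using finite_subset[OF sub] by (intro card_image_le) simp
    also have "\<dots> \<le> m" using card_mono[OF _ sub] by simp
    finally show ?thesis using mE by linarith
  qed
  moreover have "\<exists>c\<in>C. (\<Sum>i<n. (s \<bullet> Phi (xs i) - c \<bullet> Phi (xs i))\<^sup>2) \<le> real n * (2 * R * \<delta>)\<^sup>2" if s: "s \<in> S" for s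
  proof (rule bexI)
    let ?c = "inv_into S \<iota> (\<iota> s)"
    show "?c \<in> C" using s by (simp add: C_def)
    have c: "?c \<in> S" "\<iota> ?c = \<iota> s" using s by (auto intro: inv_into_into f_inv_into_f)
    let ?u = "\<lambda>h j. h \<bullet> Phi (xs j) / R - g (\<iota> s) (xs j)"
    have "(\<Sum>i<n. (s \<bullet> Phi (xs i) - ?c \<bullet> Phi (xs i))\<^sup>2) \<le> (\<Sum>i<n. R\<^sup>2 * (2 * (?u s i)\<^sup>2 + 2 * (?u ?c i)\<^sup>2))"
    proof (rule sum_mono)
      fix i
      have "s \<bullet> Phi (xs i) - ?c \<bullet> Phi (xs i) = R * (?u s i - ?u ?c i)"
        using R by (simp add: right_diff_distrib)
      then have "(s \<bullet> Phi (xs i) - ?c \<bullet> Phi (xs i))\<^sup>2 = R\<^sup>2 * (?u s i - ?u ?c i)\<^sup>2"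
        by (simp add: power_mult_distrib)
      also have "(?u s i - ?u ?c i)\<^sup>2 \<le> 2 * (?u s i)\<^sup>2 + 2 * (?u ?c i)\<^sup>2"
        using sum_squares_ge_zero[of "?u s i + ?u ?c i" 0] by (simp add: power2_eq_square algebra_simps)
      finally show "(s \<bullet> Phi (xs i) - ?c \<bullet> Phi (xs i))\<^sup>2 \<le> R\<^sup>2 * (2 * (?u s i)\<^sup>2 + 2 * (?u ?c i)\<^sup>2)"
        by (simp add: mult_left_mono)
    qed
    also have "\<dots> = R\<^sup>2 * (2 * (\<Sum>i<n. (?u s i)\<^sup>2) + 2 * (\<Sum>i<n. (?u ?c i)\<^sup>2))"
      by (simp add: sum_distrib_left[symmetric] sum.distrib)
    also have "\<dots> \<le> R\<^sup>2 * (2 * (real n * \<delta>\<^sup>2) + 2 * (real n * \<delta>\<^sup>2))"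
      using \<iota>(2)[OF s] \<iota>(2)[OF c(1)] c(2) by (intro mult_left_mono add_mono) auto
    also have "\<dots> = real n * (2 * R * \<delta>)\<^sup>2" by (simp add: power_mult_distrib)
    finally show "(\<Sum>i<n. (s \<bullet> Phi (xs i) - ?c \<bullet> Phi (xs i))\<^sup>2) \<le> real n * (2 * R * \<delta>)\<^sup>2" .
  qed
  ultimately show ?thesis by blast
qed

text \<open>The parallelogram identity makes the squared norm uniformly convex, so a minimizing
  sequence is Cauchy and its limit is a minimizer. This gives meaning to the \<open>SOME\<close> in
  \<open>f_T_lam\<close>.\<close>

lemma regularized_minimizer_exists:
  fixes r :: "'h::{real_inner,complete_space} \<Rightarrow> real"
  assumes lam: "0 < lam" and cont: "continuous_on UNIV r" and conv: "convex_on UNIV r"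
    and nonneg: "\<And>h. 0 \<le> r h"
  shows "\<exists>h. \<forall>g. lam * (norm h)\<^sup>2 + r h \<le> lam * (norm g)\<^sup>2 + r g"
proof -
  define J where "J h = lam * (norm h)\<^sup>2 + r h" for h
  define m where "m = Inf (range J)"
  have bdd: "bdd_below (range J)" using lam nonneg by (intro bdd_belowI[of _ 0]) (auto simp: J_def)
  have mle: "m \<le> J h" for h unfolding m_def using bdd by (intro cInf_lower) auto
  have "\<exists>h. J h < m + 1 / real (Suc k)" for k
  proof -
    have "Inf (range J) < m + 1 / real (Suc k)" by (simp add: m_def)
    from cInf_lessD[OF _ this] show ?thesis by auto
  qed
  then obtain s where s: "\<And>k. J (s k) < m + 1 / real (Suc k)" by metis
  \<comment> \<open>The objective is evaluated at the midpoint \<open>w\<close>, where it is still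
    at least the infimum \<open>m\<close>.\<close>
  have par: "lam / 4 * (norm (h - g))\<^sup>2 \<le> (J h - m) / 2 + (J g - m) / 2" for h g
  proof -
    define w where "w = (1 - 1 / 2) *\<^sub>R h + (1 / 2) *\<^sub>R g"
    have "r w \<le> (1 - 1 / 2) * r h + (1 / 2) * r g"
      unfolding w_def by (rule convex_onD[OF conv]) auto
    moreover have "(norm w)\<^sup>2 = (norm h)\<^sup>2 / 2 + (norm g)\<^sup>2 / 2 - (norm (h - g))\<^sup>2 / 4"
      by (simp add: w_def power2_norm_eq_inner inner_add_left inner_add_right inner_diff_left inner_diff_right
          inner_commute[of g h] field_simps)
    then have "lam * (norm w)\<^sup>2 = lam * ((norm h)\<^sup>2 / 2 + (norm g)\<^sup>2 / 2 - (norm (h - g))\<^sup>2 / 4)"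
      by simp
    then have "lam * (norm w)\<^sup>2 = lam * (norm h)\<^sup>2 / 2 + lam * (norm g)\<^sup>2 / 2 - lam / 4 * (norm (h - g))\<^sup>2"
      by (simp add: ring_distribs)
    ultimately have "J w \<le> J h / 2 + J g / 2 - lam / 4 * (norm (h - g))\<^sup>2"
      unfolding J_def add_divide_distrib by simp
    then show ?thesis using mle[of w] by (simp add: field_simps)
  qed
  have "Cauchy s"
  proof (rule metric_CauchyI)
    fix e :: real assume e: "0 < e"
    obtain N where N: "1 / real (Suc N) < lam / 4 * e\<^sup>2"
      using reals_Archimedean[of "lam / 4 * e\<^sup>2"] lam e by (auto simp: inverse_eq_divide)
    show "\<exists>N. \<forall>k\<ge>N. \<forall>l\<ge>N. dist (s k) (s l) < e"
    proof (intro exI allI impI)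
      fix k l assume "N \<le> k" "N \<le> l"
      then have "1 / real (Suc k) \<le> 1 / real (Suc N)" "1 / real (Suc l) \<le> 1 / real (Suc N)"
        by (auto intro!: divide_left_mono)
      then have "J (s k) < m + 1 / real (Suc N)" "J (s l) < m + 1 / real (Suc N)"
        using s[of k] s[of l] by (meson add_left_mono order.strict_trans2)+
      moreover have "(a - m) / 2 + (b - m) / 2 < q" if "a < m + q" "b < m + q" for a b q
        using that by (simp add: field_simps)
      ultimately have "(J (s k) - m) / 2 + (J (s l) - m) / 2 < 1 / real (Suc N)" by blast
      then have "lam / 4 * (norm (s k - s l))\<^sup>2 < lam / 4 * e\<^sup>2"
        using par[of "s k" "s l"] N by (meson order.strict_trans order.strict_trans1)
      then have "(norm (s k - s l))\<^sup>2 < e\<^sup>2" using lam by simp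
      then show "dist (s k) (s l) < e" using e by (simp add: dist_norm power_less_imp_less_base)
    qed
  qed
  then obtain h where h: "s \<longlonglongrightarrow> h" using Cauchy_convergent_iff convergent_def by blast
  have "(\<lambda>k. r (s k)) \<longlonglongrightarrow> r h"
    using cont h by (auto intro: continuous_on_tendsto_compose[of UNIV r])
  then have "(\<lambda>k. J (s k)) \<longlonglongrightarrow> J h" unfolding J_def by (intro tendsto_intros h)
  moreover have "(\<lambda>k. m + 1 / real (Suc k)) \<longlonglongrightarrow> m + 0"
    by (intro tendsto_intros LIMSEQ_Suc[OF lim_1_over_n])
  ultimately have "J h \<le> m + 0" using s by (intro LIMSEQ_le[of "\<lambda>k. J (s k)"]) (auto intro: less_imp_le)
  then have "J h \<le> J g" for g using mle[of g] by linarith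
  then show ?thesis unfolding J_def by blast
qed

section \<open>Exponents\<close>

text \<open>Inverts the exponent. For \<open>den = 0\<close> the convention makes the premise say
  \<open>s \<le> 1\<close>, which is the conclusion with exponent 0, so degenerate exponents need no
  further case distinction.\<close>

lemma le_powr_of_epow_le:
  assumes le: "epow s num den \<le> ereal \<epsilon>" and s: "0 < s" and num: "0 < num" and den: "0 \<le> den" and \<epsilon>: "0 < \<epsilon>"
  shows "s \<le> \<epsilon> powr (den / num)"
proof (cases "den = 0")
  case True
  then show ?thesis using le \<epsilon> by (auto simp: epow_def split: if_splits)
next
  case False
  then have "s powr (num / den) \<le> \<epsilon>" using le by (simp add: epow_def)
  then have "(s powr (num / den)) powr (den / num) \<le> \<epsilon> powr (den / num)"
    using num den by (intro powr_mono2) auto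
  then show ?thesis using s num False by (simp add: powr_powr)
qed

text \<open>Multiplying by \<open>\<epsilon> powr e\<close> turns the power of \<open>lam\<close>
  into a power of \<open>\<epsilon> / lam\<close>. In this form the conditions can be compared with
  the scales of the localized class.\<close>

lemma rescale_condition:
  fixes s :: real
  assumes le: "s / (lam powr e * n) \<le> \<epsilon> powr d" and pos: "0 < lam" "0 < n" "0 < \<epsilon>"
    and f: "e + d = f"
  shows "s * (\<epsilon> / lam) powr e \<le> n * \<epsilon> powr f"
proof -
  have "s \<le> \<epsilon> powr d * (lam powr e * n)" using le pos by (simp add: pos_divide_le_eq)
  then have "s * (\<epsilon> / lam) powr e \<le> \<epsilon> powr d * (lam powr e * n) * (\<epsilon> / lam) powr e"
    by (intro mult_right_mono) auto
  also have "\<dots> = n * \<epsilon> powr f" using pos by (simp add: powr_divide powr_add flip: f)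
  finally show ?thesis .
qed

lemma powr_add_le:
  fixes u w q :: real
  assumes "0 < u" "0 < w" "0 \<le> q" "q \<le> 1"
  shows "(u + w) powr q \<le> 2 * (u powr q + w powr q)"
proof -
  have *: "(2 * m) powr q \<le> 2 * m powr q" if "0 < m" for m
    using powr_mono[of q 1 2] assms that by (simp add: powr_mult mult_right_mono)
  show ?thesis
  proof (cases "u \<le> w")
    case True
    have "(u + w) powr q \<le> (2 * w) powr q" using assms True by (intro powr_mono2) auto
    also have "\<dots> \<le> 2 * w powr q" by (rule *[OF assms(2)])
    also have "\<dots> \<le> 2 * (u powr q + w powr q)" by simp
    finally show ?thesis .
  next
    case False
    have "(u + w) powr q \<le> (2 * u) powr q" using assms False by (intro powr_mono2) auto
    also have "\<dots> \<le> 2 * u powr q" by (rule *[OF assms(1)])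
    also have "\<dots> \<le> 2 * (u powr q + w powr q)" by simp
    finally show ?thesis .
  qed
qed

text \<open>The two summands of \<open>s2\<close> come from the variance hypothesis and from the sup
  bound \<open>B\<close>. Entropy against these summands uses \<open>k1\<close> and
  \<open>k2\<close>, the confidence term \<open>x\<close> uses \<open>k3\<close> and
  \<open>k4\<close>. In \<open>C0\<close>, 72 is 4 * 9 * 2 from the variance bound and
  \<open>4 * cL\<close> comes from \<open>B\<close>. In the condition on \<open>K\<close>, 4 is due
  to the square of \<open>\<epsilon> / 2\<close>, a factor 2 to the two summands, and in the entropy
  part another 2 to \<open>powr_add_le\<close>.\<close>

lemma localized_scales:
  fixes G n \<epsilon> x a p \<alpha> cL c theta v dc :: real
  assumes G: "1 \<le> G" and n: "0 < n" and \<epsilon>: "0 < \<epsilon>" and a: "1 \<le> a" and x: "1 \<le> x"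
    and p: "0 < p" "p < 2" and \<alpha>: "1 \<le> \<alpha>" "\<alpha> \<le> 2" and cL: "0 < cL" and c: "1 \<le> c"
    and theta: "0 < theta" "theta \<le> 1" and v: "0 \<le> v" "v \<le> 2" and dc: "1 \<le> dc"
  defines "C0 \<equiv> 72 * c + 4 * cL" and "Cb \<equiv> (4 * cL) powr p"
  defines "s2 \<equiv> C0 * (G powr (v / 2) * \<epsilon> powr theta + G powr (\<alpha> / 2) * \<epsilon>)"
    and "R \<equiv> sqrt (2 * G)"
  defines "B \<equiv> 2 * cL * R powr \<alpha>"
  assumes K: "16 * dc * Cb * C0 powr ((2 - p) / 2) + 8 * dc * C0 \<le> K"
    and k1: "K * a * G powr ((2 * \<alpha> * p + v * (2 - p)) / 4) \<le> n * \<epsilon> powr (2 - theta * (2 - p) / 2)"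
    and k2: "K * a * G powr (\<alpha> * (2 + p) / 4) \<le> n * \<epsilon> powr ((2 + p) / 2)"
    and k3: "K * x * G powr (v / 2) \<le> n * \<epsilon> powr (2 - theta)"
    and k4: "K * x * G powr (\<alpha> / 2) \<le> n * \<epsilon> powr 1"
  shows "0 < s2" "B * (\<epsilon> / 2) \<le> s2" "4 * c * (R + 1) powr v * (2 * \<epsilon>) powr theta \<le> s2"
    and "dc * (a * B powr p) * sqrt s2 powr (2 - p) \<le> n * (\<epsilon> / 2)\<^sup>2"
    and "dc * x * s2 \<le> n * (\<epsilon> / 2)\<^sup>2"
proof -
  define q where "q = (2 - p) / 2"
  have q: "0 \<le> q" "q \<le> 1" using p by (auto simp: q_def)
  define u where "u = G powr (v / 2) * \<epsilon> powr theta"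
  define w where "w = G powr (\<alpha> / 2) * \<epsilon>"
  have u: "0 < u" and w: "0 < w" using G \<epsilon> by (auto simp: u_def w_def)
  have C0: "0 < C0" using c cL by (simp add: C0_def add_pos_pos)
  have s2: "s2 = C0 * (u + w)" by (simp add: s2_def u_def w_def)
  show s2_pos: "0 < s2" using C0 u w by (simp add: s2)
  have K_pos: "0 < K"
  proof -
    have "0 < 8 * dc * C0" using dc C0 by simp
    moreover have "0 \<le> 16 * dc * Cb * C0 powr ((2 - p) / 2)" using dc by (simp add: Cb_def)
    ultimately show ?thesis using K by linarith
  qed
  have R_powr: "R powr \<alpha> = 2 powr (\<alpha> / 2) * G powr (\<alpha> / 2)"
    using G by (simp add: R_def powr_half_sqrt[symmetric] powr_powr powr_mult)
  have B_le: "B \<le> 4 * cL * G powr (\<alpha> / 2)" and B_nn: "0 < B"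
  proof -
    have "2 powr (\<alpha> / 2) \<le> (2::real) powr 1" using \<alpha> by (intro powr_mono) auto
    then have "2 * cL * (2 powr (\<alpha> / 2) * G powr (\<alpha> / 2)) \<le> 2 * cL * (2 * G powr (\<alpha> / 2))"
      using cL by (intro mult_left_mono mult_right_mono) auto
    then show "B \<le> 4 * cL * G powr (\<alpha> / 2)" by (simp add: B_def R_powr)
    show "0 < B" using cL G by (simp add: B_def R_powr)
  qed
  have "B * \<epsilon> \<le> 4 * cL * w"
    using mult_right_mono[OF B_le, of \<epsilon>] \<epsilon> by (simp add: w_def mult.assoc)
  also have "\<dots> \<le> C0 * w" using w c by (intro mult_right_mono) (auto simp: C0_def)
  also have "\<dots> \<le> s2" using u C0 by (simp add: s2)
  finally show "B * (\<epsilon> / 2) \<le> s2" using B_nn \<epsilon> s2_pos by (simp add: field_simps)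
  show "4 * c * (R + 1) powr v * (2 * \<epsilon>) powr theta \<le> s2"
  proof -
    \<comment> \<open>The additive 1 is absorbed because \<open>G \<ge> 1\<close>; this is what the
      lower bound \<open>lam\<close> on \<open>\<epsilon>\<close> is for.\<close>
    have "R + 1 \<le> 3 * sqrt G"
    proof -
      have "sqrt 2 \<le> (2::real)" using real_sqrt_le_mono[of 2 4] by simp
      then have "R \<le> 2 * sqrt G" using G by (simp add: R_def real_sqrt_mult mult_right_mono)
      moreover have "1 \<le> sqrt G" using G by simp
      ultimately show ?thesis by linarith
    qed
    then have "(R + 1) powr v \<le> (3 * sqrt G) powr v" using v G by (intro powr_mono2) (auto simp: R_def)
    also have "\<dots> = 3 powr v * G powr (v / 2)" using G by (simp add: powr_mult powr_half_sqrt[symmetric] powr_powr)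
    also have "\<dots> \<le> 9 * G powr (v / 2)" using powr_mono[of v 2 3] v by (intro mult_right_mono) auto
    finally have 1: "(R + 1) powr v \<le> 9 * G powr (v / 2)" .
    have "(2 * \<epsilon>) powr theta = 2 powr theta * \<epsilon> powr theta" using \<epsilon> by (simp add: powr_mult)
    also have "\<dots> \<le> 2 * \<epsilon> powr theta" using powr_mono[of theta 1 2] theta by (intro mult_right_mono) auto
    finally have 2: "(2 * \<epsilon>) powr theta \<le> 2 * \<epsilon> powr theta" .
    have "4 * c * (R + 1) powr v * (2 * \<epsilon>) powr theta \<le> 4 * c * (9 * G powr (v / 2)) * (2 * \<epsilon> powr theta)"
      using 1 2 c by (intro mult_mono) auto
    also have "\<dots> = 72 * c * u" by (simp add: u_def)
    also have "\<dots> \<le> C0 * u" using u cL by (intro mult_right_mono) (auto simp: C0_def)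
    also have "\<dots> \<le> s2" using w C0 by (simp add: s2)
    finally show ?thesis .
  qed
  show "dc * (a * B powr p) * sqrt s2 powr (2 - p) \<le> n * (\<epsilon> / 2)\<^sup>2"
  proof -
    have "B powr p \<le> (4 * cL * G powr (\<alpha> / 2)) powr p" using B_le B_nn p by (intro powr_mono2) auto
    also have "\<dots> = Cb * G powr (\<alpha> * p / 2)" using cL by (simp add: Cb_def powr_mult powr_powr)
    finally have 1: "B powr p \<le> Cb * G powr (\<alpha> * p / 2)" .
    have "sqrt s2 powr (2 - p) = s2 powr q"
      using s2_pos by (simp add: powr_half_sqrt[symmetric] powr_powr q_def)
    also have "\<dots> = C0 powr q * (u + w) powr q" using C0 u w by (simp add: s2 powr_mult)
    also have "\<dots> \<le> C0 powr q * (2 * (u powr q + w powr q))"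
      using u w q by (intro mult_left_mono powr_add_le) auto
    finally have 2: "sqrt s2 powr (2 - p) \<le> C0 powr q * (2 * (u powr q + w powr q))" .
    have "dc * (a * B powr p) * sqrt s2 powr (2 - p)
        \<le> dc * (a * (Cb * G powr (\<alpha> * p / 2))) * (C0 powr q * (2 * (u powr q + w powr q)))"
      using 1 2 dc a by (intro mult_mono) (auto simp: Cb_def)
    also have "\<dots> = 2 * dc * Cb * C0 powr q *
        (a * G powr (\<alpha> * p / 2) * u powr q + a * G powr (\<alpha> * p / 2) * w powr q)"
      by (simp add: algebra_simps)
    \<comment> \<open>In each summand the powers of \<open>G\<close> add up to the exponent in
      \<open>k1\<close> or \<open>k2\<close>, and the missing powers of \<open>\<epsilon>\<close>
      complete its right side to \<open>n * \<epsilon>\<^sup>2\<close>.\<close>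
    also have "\<dots> \<le> 2 * dc * Cb * C0 powr q * (n * \<epsilon>\<^sup>2 / K + n * \<epsilon>\<^sup>2 / K)"
    proof (intro mult_left_mono add_mono)
      have "a * G powr (\<alpha> * p / 2) * u powr q
          = a * G powr ((2 * \<alpha> * p + v * (2 - p)) / 4) * \<epsilon> powr (theta * (2 - p) / 2)"
      proof -
        have "u powr q = G powr (v / 2 * q) * \<epsilon> powr (theta * q)" by (simp add: u_def powr_mult powr_powr)
        moreover have "G powr (\<alpha> * p / 2) * G powr (v / 2 * q) = G powr ((2 * \<alpha> * p + v * (2 - p)) / 4)"
          unfolding powr_add[symmetric] by (rule arg_cong[of _ _ "(powr) G"]) (simp add: q_def field_simps)
        moreover have "theta * q = theta * (2 - p) / 2" by (simp add: q_def)
        ultimately show ?thesis by (metis mult.assoc)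
      qed
      also have "\<dots> \<le> n * \<epsilon> powr (2 - theta * (2 - p) / 2) / K * \<epsilon> powr (theta * (2 - p) / 2)"
        using k1 K_pos by (intro mult_right_mono) (auto simp: pos_le_divide_eq mult_ac)
      also have "\<dots> = n * (\<epsilon> powr (2 - theta * (2 - p) / 2) * \<epsilon> powr (theta * (2 - p) / 2)) / K" by simp
      also have "\<epsilon> powr (2 - theta * (2 - p) / 2) * \<epsilon> powr (theta * (2 - p) / 2) = \<epsilon>\<^sup>2"
        using \<epsilon> by (simp flip: powr_add)
      finally show "a * G powr (\<alpha> * p / 2) * u powr q \<le> n * \<epsilon>\<^sup>2 / K" .
      have "a * G powr (\<alpha> * p / 2) * w powr q
          = a * G powr (\<alpha> * (2 + p) / 4) * \<epsilon> powr ((2 - p) / 2)"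
      proof -
        have "w powr q = G powr (\<alpha> / 2 * q) * \<epsilon> powr q" using \<epsilon> by (simp add: w_def powr_mult powr_powr)
        moreover have "G powr (\<alpha> * p / 2) * G powr (\<alpha> / 2 * q) = G powr (\<alpha> * (2 + p) / 4)"
          unfolding powr_add[symmetric] by (rule arg_cong[of _ _ "(powr) G"]) (simp add: q_def field_simps)
        ultimately show ?thesis unfolding q_def by (metis mult.assoc)
      qed
      also have "\<dots> \<le> n * \<epsilon> powr ((2 + p) / 2) / K * \<epsilon> powr ((2 - p) / 2)"
        using k2 K_pos by (intro mult_right_mono) (auto simp: pos_le_divide_eq mult_ac)
      also have "\<dots> = n * (\<epsilon> powr ((2 + p) / 2) * \<epsilon> powr ((2 - p) / 2)) / K" by simp
      also have "\<epsilon> powr ((2 + p) / 2) * \<epsilon> powr ((2 - p) / 2) = \<epsilon>\<^sup>2"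
      proof -
        have "(2 + p) / 2 + (2 - p) / 2 = 2" by (simp add: field_simps)
        then show ?thesis using \<epsilon> by (simp only: powr_add[symmetric]) simp
      qed
      finally show "a * G powr (\<alpha> * p / 2) * w powr q \<le> n * \<epsilon>\<^sup>2 / K" .
    qed (use dc in \<open>simp add: Cb_def\<close>)
    also have "\<dots> = (16 * dc * Cb * C0 powr ((2 - p) / 2)) / K * (n * (\<epsilon> / 2)\<^sup>2)"
      by (simp add: q_def power_divide)
    also have "\<dots> \<le> 1 * (n * (\<epsilon> / 2)\<^sup>2)"
    proof (rule mult_right_mono)
      have "16 * dc * Cb * C0 powr ((2 - p) / 2) \<le> K"
      proof -
        have "0 < 8 * dc * C0" using dc C0 by simp
        then show ?thesis using K by linarith
      qed
      then show "(16 * dc * Cb * C0 powr ((2 - p) / 2)) / K \<le> 1" using K_pos by simp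
    qed (use n in simp)
    finally show ?thesis by simp
  qed
  show "dc * x * s2 \<le> n * (\<epsilon> / 2)\<^sup>2"
  proof -
    have "dc * x * s2 = dc * C0 * (x * u + x * w)" by (simp add: s2 algebra_simps)
    also have "\<dots> \<le> dc * C0 * (n * \<epsilon>\<^sup>2 / K + n * \<epsilon>\<^sup>2 / K)"
    proof (intro mult_left_mono add_mono)
      have "x * u \<le> n * \<epsilon> powr (2 - theta) / K * \<epsilon> powr theta"
        unfolding u_def mult.assoc[symmetric] using k3 K_pos
        by (intro mult_right_mono) (auto simp: pos_le_divide_eq mult_ac)
      also have "\<dots> = n * (\<epsilon> powr (2 - theta) * \<epsilon> powr theta) / K" by simp
      also have "\<epsilon> powr (2 - theta) * \<epsilon> powr theta = \<epsilon>\<^sup>2" using \<epsilon> by (simp flip: powr_add)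
      finally show "x * u \<le> n * \<epsilon>\<^sup>2 / K" .
      have "x * w \<le> n * \<epsilon> / K * \<epsilon>"
        unfolding w_def mult.assoc[symmetric] using k4 K_pos \<epsilon>
        by (intro mult_right_mono) (auto simp: pos_le_divide_eq mult_ac)
      then show "x * w \<le> n * \<epsilon>\<^sup>2 / K" by (simp add: power2_eq_square)
    qed (use dc C0 in simp)
    also have "\<dots> = (8 * dc * C0) / K * (n * (\<epsilon> / 2)\<^sup>2)" by (simp add: power_divide)
    also have "\<dots> \<le> 1 * (n * (\<epsilon> / 2)\<^sup>2)"
    proof (rule mult_right_mono)
      have "0 \<le> 16 * dc * Cb * C0 powr ((2 - p) / 2)" using dc by (simp add: Cb_def)
      then have "8 * dc * C0 \<le> K" using K by linarith
      then show "(8 * dc * C0) / K \<le> 1" using K_pos by simp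
    qed (use n in simp)
    finally show ?thesis by simp
  qed
qed

section \<open>The oracle inequality\<close>

locale kernel_machine =
  fixes Phi :: "'x::metric_space \<Rightarrow> 'h::{real_inner,complete_space}"
    and Y :: "real set"
    and P :: "('x \<times> real) measure"
    and L :: "real \<Rightarrow> real \<Rightarrow> real"
    and fstar :: "'x \<Rightarrow> real"
    and a p \<alpha> cL c theta v :: real
  assumes X_compact: "compact (UNIV :: 'x set)"
    and H_rkhs: "is_rkhs_cont_kernel Phi"
    and H_sup: "\<forall>h x. \<bar>rkhs_fun Phi h x\<bar> \<le> norm h"
    and a_ge: "a \<ge> 1" and p_pos: "0 < p" and p_lt: "p < 2"
    and entropy: "\<forall>n::nat. n \<ge> 1 \<longrightarrow> (\<forall>\<delta>>0. \<forall>T :: nat \<Rightarrow> 'x \<times> real.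
        (\<forall>i<n. snd (T i) \<in> Y) \<longrightarrow>
        ln (real (cov_num_BH Phi n (fst \<circ> T) \<delta>)) \<le> a * \<delta> powr (- p))"
    and L_nonneg: "\<forall>y\<in>Y. \<forall>t. 0 \<le> L y t"
    and L_cont: "continuous_on (Y \<times> UNIV) (\<lambda>(y, t). L y t)"
    and L_convex: "\<forall>y\<in>Y. convex_on UNIV (L y)"
    and \<alpha>_ge: "1 \<le> \<alpha>" and \<alpha>_le: "\<alpha> \<le> 2" and cL_pos: "0 < cL"
    and L_growth: "\<forall>y\<in>Y. \<forall>t. L y t \<le> 1 + \<bar>t\<bar> powr \<alpha>"
    and L_lip: "\<forall>t\<ge>0. \<forall>y\<in>Y. lipschitz_on (cL * t powr (\<alpha> - 1)) {-t..t} (L y)"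
    and P_prob: "prob_space P"
    and P_sets: "sets P = sets (restrict_space borel (UNIV \<times> Y))"
    and fstar_int: "integrable P (\<lambda>z. L (snd z) (fstar (fst z)))"
    and fstar_min: "risk P L fstar = bayes_risk P L"
    and c_ge: "c \<ge> 1" and theta_pos: "0 < theta" and theta_le: "theta \<le> 1"
    and v_nonneg: "0 \<le> v" and v_le: "v \<le> 2"
    and variance: "\<forall>lam. 0 < lam \<and> lam \<le> 1 \<longrightarrow> (\<forall>h. norm h \<le> lam powr (- 1 / 2) \<longrightarrow>
        (\<integral>\<^sup>+ z. ennreal ((L (snd z) (rkhs_fun Phi h (fst z)) - L (snd z) (fstar (fst z)))\<^sup>2) \<partial>P)
        \<le> ennreal (c * (sup_norm (rkhs_fun Phi h) + 1) powr v *
             (\<integral> z. L (snd z) (rkhs_fun Phi h (fst z)) - L (snd z) (fstar (fst z)) \<partial>P) powr theta))"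
begin

section \<open>Losses, risks and second moments of RKHS functions\<close>

sublocale prob_space P by (rule P_prob)

definition loss :: "'h \<Rightarrow> 'x \<times> real \<Rightarrow> real" where
  "loss h z = L (snd z) (h \<bullet> Phi (fst z))"

definition excess :: "'h \<Rightarrow> real" where
  "excess h = risk P L (rkhs_fun Phi h) - bayes_risk P L"

lemma space_P: "space P = UNIV \<times> Y"
  using sets_eq_imp_space_eq[OF P_sets] by (simp add: space_restrict_space)

lemma risk_eq: "risk P L (rkhs_fun Phi h) = (\<integral>z. loss h z \<partial>P)"
  by (simp add: risk_def rkhs_fun_def loss_def)

lemma continuous_Phi: "continuous_on UNIV Phi"
  by (rule continuous_feature_map[OF H_rkhs])

lemma inner_Phi_le: "\<bar>h \<bullet> Phi x\<bar> \<le> norm h"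
  using H_sup by (simp add: rkhs_fun_def)

lemma measurable_loss: "loss h \<in> borel_measurable P"
proof -
  have c2: "continuous_on (UNIV \<times> Y) (\<lambda>z. (snd z, h \<bullet> Phi (fst z)))"
    by (intro continuous_intros continuous_on_compose2[OF continuous_Phi]) auto
  have "continuous_on (UNIV \<times> Y) (loss h)"
  proof -
    have "(\<lambda>z. (snd z, h \<bullet> Phi (fst z))) ` (UNIV \<times> Y) \<subseteq> Y \<times> UNIV" by auto
    from continuous_on_compose2[OF L_cont c2 this] show ?thesis by (simp add: loss_def[abs_def])
  qed
  then have "loss h \<in> borel_measurable (restrict_space borel (UNIV \<times> Y))"
    by (rule borel_measurable_continuous_on_restrict)
  then show ?thesis using measurable_cong_sets[OF P_sets refl] by blast
qed

lemma loss_nonneg: "z \<in> space P \<Longrightarrow> 0 \<le> loss h z"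
  using L_nonneg by (auto simp: space_P loss_def)

lemma loss_le:
  assumes "z \<in> space P" shows "loss h z \<le> 1 + norm h powr \<alpha>"
proof -
  have "loss h z \<le> 1 + \<bar>h \<bullet> Phi (fst z)\<bar> powr \<alpha>"
    using assms L_growth by (auto simp: loss_def space_P)
  also have "\<bar>h \<bullet> Phi (fst z)\<bar> powr \<alpha> \<le> norm h powr \<alpha>"
    using \<alpha>_ge inner_Phi_le by (intro powr_mono2) auto
  finally show ?thesis by simp
qed

lemma integrable_loss: "integrable P (loss h)"
  by (rule integrable_const_bound[where B = "1 + norm h powr \<alpha>"])
     (auto intro!: AE_I2 measurable_loss simp: loss_nonneg loss_le)

lemma loss_lipschitz:
  assumes z: "z \<in> space P" and r: "norm h \<le> r" "norm g \<le> r"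
  shows "\<bar>loss h z - loss g z\<bar> \<le> cL * r powr (\<alpha> - 1) * \<bar>h \<bullet> Phi (fst z) - g \<bullet> Phi (fst z)\<bar>"
proof -
  have "0 \<le> r" using r(1) norm_ge_zero order_trans by blast
  then have "lipschitz_on (cL * r powr (\<alpha> - 1)) {-r..r} (L (snd z))"
    using L_lip z by (auto simp: space_P)
  moreover have "h \<bullet> Phi (fst z) \<in> {-r..r}" "g \<bullet> Phi (fst z) \<in> {-r..r}"
    using inner_Phi_le[of h "fst z"] inner_Phi_le[of g "fst z"] r by auto
  ultimately show ?thesis
    unfolding loss_def by (metis lipschitz_onD dist_real_def)
qed

text \<open>Provides the continuity of the risk along segments that the intermediate value argument
  requires.\<close>

lemma risk_lipschitz:
  assumes r: "norm h \<le> r" "norm g \<le> r"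
  shows "\<bar>risk P L (rkhs_fun Phi h) - risk P L (rkhs_fun Phi g)\<bar> \<le> cL * r powr (\<alpha> - 1) * norm (h - g)"
proof -
  have "\<bar>(\<integral>z. loss h z - loss g z \<partial>P)\<bar> \<le> cL * r powr (\<alpha> - 1) * norm (h - g)"
  proof -
    have "\<bar>loss h z - loss g z\<bar> \<le> cL * r powr (\<alpha> - 1) * norm (h - g)" if "z \<in> space P" for z
    proof -
      have "\<bar>h \<bullet> Phi (fst z) - g \<bullet> Phi (fst z)\<bar> \<le> norm (h - g)"
        using inner_Phi_le[of "h - g" "fst z"] by (simp add: inner_diff_left)
      then have "cL * r powr (\<alpha> - 1) * \<bar>h \<bullet> Phi (fst z) - g \<bullet> Phi (fst z)\<bar> \<le> cL * r powr (\<alpha> - 1) * norm (h - g)"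
        using cL_pos by (intro mult_left_mono) auto
      then show ?thesis using loss_lipschitz[OF that r] by linarith
    qed
    then have "(\<integral>z. \<bar>loss h z - loss g z\<bar> \<partial>P) \<le> cL * r powr (\<alpha> - 1) * norm (h - g)"
      using integrable_loss by (intro integral_le_const AE_I2) auto
    then show ?thesis using integral_abs_bound[of P "\<lambda>z. loss h z - loss g z"] by linarith
  qed
  then show ?thesis using integrable_loss by (simp add: risk_eq)
qed

lemma excess_nonneg: "0 \<le> excess h"
proof -
  have "bayes_risk P L \<le> risk P L (rkhs_fun Phi h)"
    unfolding bayes_risk_def
  proof (rule cInf_lower)
    have "continuous_on UNIV (rkhs_fun Phi h)"
      unfolding rkhs_fun_def by (intro continuous_intros continuous_Phi)
    then have "rkhs_fun Phi h \<in> borel_measurable borel" by (rule borel_measurable_continuous_onI)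
    moreover have "integrable P (\<lambda>z. L (snd z) (rkhs_fun Phi h (fst z)))"
      using integrable_loss[of h] by (simp add: loss_def[abs_def] rkhs_fun_def)
    ultimately show "risk P L (rkhs_fun Phi h) \<in> {risk P L f |f. f \<in> borel_measurable borel \<and>
      integrable P (\<lambda>z. L (snd z) (f (fst z)))}" by blast
    show "bdd_below {risk P L f |f. f \<in> borel_measurable borel \<and> integrable P (\<lambda>z. L (snd z) (f (fst z)))}"
    proof (rule bdd_belowI)
      fix r assume "r \<in> {risk P L f |f. f \<in> borel_measurable borel \<and> integrable P (\<lambda>z. L (snd z) (f (fst z)))}"
      then obtain f where "r = risk P L f" by blast
      then show "0 \<le> r"
        unfolding risk_def using L_nonneg by (auto intro!: Bochner_Integration.integral_nonneg simp: space_P)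
    qed
  qed
  then show ?thesis by (simp add: excess_def)
qed

text \<open>The variance hypothesis ranges over all \<open>lam\<close> in (0, 1], so every
  \<open>h\<close> is covered by a suitable choice of \<open>lam\<close>. Its left side is a
  nonnegative integral, so finiteness also yields integrability.\<close>

lemma second_moment_excess_loss:
  defines "D \<equiv> \<lambda>h z. loss h z - L (snd z) (fstar (fst z))"
  shows "integrable P (\<lambda>z. (D h z)\<^sup>2)"
    and "(\<integral>z. (D h z)\<^sup>2 \<partial>P) \<le> c * (norm h + 1) powr v * excess h powr theta"
proof -
  have D_meas: "D h \<in> borel_measurable P"
    unfolding D_def using measurable_loss[of h] borel_measurable_integrable[OF fstar_int] by auto
  \<comment> \<open>Then \<open>lam powr (- 1 / 2)\<close> equals \<open>1 + norm h\<close>, and the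
    added 1 keeps \<open>lam \<le> 1\<close>. This \<open>lam\<close> is unrelated to the
    regularization parameter.\<close>
  define lam where "lam = (1 + norm h) powr (- 2)"
  have lam: "0 < lam" "lam \<le> 1"
  proof -
    have pos: "0 < 1 + norm h" by (simp add: add_pos_nonneg)
    then show "0 < lam" by (simp add: lam_def)
    have "(1 + norm h) powr (- 2) \<le> (1 + norm h) powr 0" by (intro powr_mono) auto
    then show "lam \<le> 1" using pos by (simp add: lam_def)
  qed
  have "norm h \<le> lam powr (- 1 / 2)" by (simp add: lam_def powr_powr)
  then have "(\<integral>\<^sup>+ z. ennreal ((D h z)\<^sup>2) \<partial>P)
     \<le> ennreal (c * (sup_norm (rkhs_fun Phi h) + 1) powr v * (\<integral>z. D h z \<partial>P) powr theta)"
    using variance lam unfolding D_def loss_def rkhs_fun_def by blast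
  also have "(\<integral>z. D h z \<partial>P) = excess h"
    using integrable_loss fstar_int by (simp add: D_def excess_def risk_eq fstar_min[symmetric] risk_def[of P L fstar])
  also have "ennreal (c * (sup_norm (rkhs_fun Phi h) + 1) powr v * excess h powr theta)
      \<le> ennreal (c * (norm h + 1) powr v * excess h powr theta)"
  proof (rule ennreal_leI)
    have "sup_norm (rkhs_fun Phi h) \<le> norm h"
      unfolding sup_norm_def using H_sup by (intro cSUP_least) auto
    moreover have "\<bar>rkhs_fun Phi h undefined\<bar> \<le> sup_norm (rkhs_fun Phi h)"
      unfolding sup_norm_def
      by (rule cSUP_upper) (auto intro!: bdd_aboveI2[where M = "norm h"] simp: H_sup)
    then have "0 \<le> sup_norm (rkhs_fun Phi h)" by linarith
    ultimately show "c * (sup_norm (rkhs_fun Phi h) + 1) powr v * excess h powr theta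
        \<le> c * (norm h + 1) powr v * excess h powr theta"
      using v_nonneg c_ge by (intro mult_right_mono mult_left_mono powr_mono2) auto
  qed
  finally have le: "(\<integral>\<^sup>+ z. ennreal ((D h z)\<^sup>2) \<partial>P) \<le> ennreal (c * (norm h + 1) powr v * excess h powr theta)" .
  then show int: "integrable P (\<lambda>z. (D h z)\<^sup>2)"
    using D_meas by (intro integrableI_nonneg) (auto simp: less_top[symmetric] top_unique intro: le_less_trans)
  show "(\<integral>z. (D h z)\<^sup>2 \<partial>P) \<le> c * (norm h + 1) powr v * excess h powr theta"
    using le c_ge nn_integral_eq_integral[OF int] by (simp add: ennreal_le_iff)
qed

text \<open>Moves the reference point from \<open>fstar\<close> to a second RKHS function by
  comparing both losses with that of \<open>fstar\<close>; the factor 4 comes from (s - t) squared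
  \<le> 2 s squared + 2 t squared.\<close>

lemma second_moment_loss_diff:
  assumes h: "norm h \<le> R" "excess h \<le> e" and g: "norm g \<le> R" "excess g \<le> e"
  shows "(\<integral>z. (loss h z - loss g z)\<^sup>2 \<partial>P) \<le> 4 * c * (R + 1) powr v * e powr theta"
proof -
  define D where "D = (\<lambda>h z. loss h z - L (snd z) (fstar (fst z)))"
  have bd: "(\<integral>z. (D h z)\<^sup>2 \<partial>P) \<le> c * (R + 1) powr v * e powr theta" if "norm h \<le> R" "excess h \<le> e" for h
  proof -
    have "(\<integral>z. (D h z)\<^sup>2 \<partial>P) \<le> c * (norm h + 1) powr v * excess h powr theta"
      unfolding D_def by (rule second_moment_excess_loss(2))
    also have "\<dots> \<le> c * (R + 1) powr v * e powr theta"
      using that excess_nonneg[of h] theta_pos v_nonneg c_ge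
      by (intro mult_mono powr_mono2) auto
    finally show ?thesis .
  qed
  have int: "integrable P (\<lambda>z. (D h z)\<^sup>2)" for h
    unfolding D_def by (rule second_moment_excess_loss(1))
  have le: "(loss h z - loss g z)\<^sup>2 \<le> 2 * (D h z)\<^sup>2 + 2 * (D g z)\<^sup>2" for z
  proof -
    have "(s - t)\<^sup>2 \<le> 2 * s\<^sup>2 + 2 * t\<^sup>2" for s t :: real
      using zero_le_power2[of "s + t"] by (simp add: power2_eq_square algebra_simps)
    from this[of "D h z" "D g z"] show ?thesis by (simp add: D_def)
  qed
  have "(\<integral>z. (loss h z - loss g z)\<^sup>2 \<partial>P) \<le> (\<integral>z. 2 * (D h z)\<^sup>2 + 2 * (D g z)\<^sup>2 \<partial>P)"
  proof (rule integral_mono)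
    show "integrable P (\<lambda>z. 2 * (D h z)\<^sup>2 + 2 * (D g z)\<^sup>2)" using int by auto
    then show "integrable P (\<lambda>z. (loss h z - loss g z)\<^sup>2)"
      by (rule Bochner_Integration.integrable_bound)
         (use measurable_loss le in \<open>auto intro!: AE_I2 intro: order_trans[OF _ abs_ge_self]\<close>)
  qed (rule le)
  also have "\<dots> = 2 * (\<integral>z. (D h z)\<^sup>2 \<partial>P) + 2 * (\<integral>z. (D g z)\<^sup>2 \<partial>P)" using int by simp
  also have "\<dots> \<le> 4 * c * (R + 1) powr v * e powr theta" using bd[OF h] bd[OF g] by simp
  finally show ?thesis .
qed

section \<open>Empirical minimizers and localization along a segment\<close>

lemma continuous_L: "y \<in> Y \<Longrightarrow> continuous_on UNIV (L y)"
proof -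
  assume y: "y \<in> Y"
  have "continuous_on UNIV (\<lambda>t. (y, t))" by (intro continuous_intros)
  moreover have "range (\<lambda>t. (y, t)) \<subseteq> Y \<times> UNIV" using y by auto
  ultimately show ?thesis using continuous_on_compose2[OF L_cont] by fastforce
qed

lemma emp_risk_properties:
  assumes T: "\<And>i. i < n \<Longrightarrow> snd (T i) \<in> Y"
  shows "continuous_on UNIV (\<lambda>h. emp_risk n T L (rkhs_fun Phi h))"
    and "convex_on UNIV (\<lambda>h. emp_risk n T L (rkhs_fun Phi h))"
    and "0 \<le> emp_risk n T L (rkhs_fun Phi h)"
proof -
  show "continuous_on UNIV (\<lambda>h. emp_risk n T L (rkhs_fun Phi h))"
    unfolding emp_risk_def rkhs_fun_def
    by (intro continuous_intros continuous_on_compose2[OF continuous_L[OF T]]) auto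
  show "0 \<le> emp_risk n T L (rkhs_fun Phi h)"
    unfolding emp_risk_def using L_nonneg T by (intro mult_nonneg_nonneg sum_nonneg) auto
  show "convex_on UNIV (\<lambda>h. emp_risk n T L (rkhs_fun Phi h))"
  proof (rule convex_onI)
    fix t :: real and h g :: 'h assume t: "0 < t" "t < 1"
    have "(\<Sum>i<n. L (snd (T i)) (((1 - t) *\<^sub>R h + t *\<^sub>R g) \<bullet> Phi (fst (T i))))
      \<le> (\<Sum>i<n. (1 - t) * L (snd (T i)) (h \<bullet> Phi (fst (T i))) + t * L (snd (T i)) (g \<bullet> Phi (fst (T i))))"
    proof (rule sum_mono)
      fix i assume "i \<in> {..<n}"
      then have "convex_on UNIV (L (snd (T i)))" using T L_convex by auto
      from convex_onD[OF this, of t "h \<bullet> Phi (fst (T i))" "g \<bullet> Phi (fst (T i))"] t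
      show "L (snd (T i)) (((1 - t) *\<^sub>R h + t *\<^sub>R g) \<bullet> Phi (fst (T i)))
        \<le> (1 - t) * L (snd (T i)) (h \<bullet> Phi (fst (T i))) + t * L (snd (T i)) (g \<bullet> Phi (fst (T i)))"
        by (simp add: inner_add_left)
    qed
    also have "\<dots> = (1 - t) * (\<Sum>i<n. L (snd (T i)) (h \<bullet> Phi (fst (T i))))
        + t * (\<Sum>i<n. L (snd (T i)) (g \<bullet> Phi (fst (T i))))" (is "_ = (1 - t) * ?A + t * ?B")
      by (simp only: sum.distrib sum_distrib_left)
    finally have "emp_risk n T L (rkhs_fun Phi ((1 - t) *\<^sub>R h + t *\<^sub>R g)) \<le> 1 / real n * ((1 - t) * ?A + t * ?B)"
      unfolding emp_risk_def rkhs_fun_def by (intro mult_left_mono) auto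
    also have "\<dots> = (1 - t) * (1 / real n * ?A) + t * (1 / real n * ?B)"
      by (simp only: distrib_left mult.left_commute)
    finally show "emp_risk n T L (rkhs_fun Phi ((1 - t) *\<^sub>R h + t *\<^sub>R g))
        \<le> (1 - t) * emp_risk n T L (rkhs_fun Phi h) + t * emp_risk n T L (rkhs_fun Phi g)"
      unfolding emp_risk_def rkhs_fun_def .
  qed simp
qed

lemma f_T_lam_minimal:
  assumes T: "\<And>i. i < n \<Longrightarrow> snd (T i) \<in> Y" and lam: "0 < lam"
  shows "lam * (norm (f_T_lam Phi n T L lam))\<^sup>2 + emp_risk n T L (rkhs_fun Phi (f_T_lam Phi n T L lam))
    \<le> lam * (norm g)\<^sup>2 + emp_risk n T L (rkhs_fun Phi g)"
proof -
  have "\<exists>h. \<forall>g. lam * (norm h)\<^sup>2 + emp_risk n T L (rkhs_fun Phi h)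
      \<le> lam * (norm g)\<^sup>2 + emp_risk n T L (rkhs_fun Phi g)"
    by (rule regularized_minimizer_exists[OF lam]) (use emp_risk_properties[of n T] T in auto)
  from someI_ex[OF this] show ?thesis unfolding f_T_lam_def[symmetric] ..
qed

lemma norm_square_convex:
  fixes h g :: 'h
  assumes "0 \<le> t" "t \<le> 1"
  shows "(norm ((1 - t) *\<^sub>R h + t *\<^sub>R g))\<^sup>2 \<le> (1 - t) * (norm h)\<^sup>2 + t * (norm g)\<^sup>2"
proof -
  have "(1 - t) * (norm h)\<^sup>2 + t * (norm g)\<^sup>2 - (norm ((1 - t) *\<^sub>R h + t *\<^sub>R g))\<^sup>2
      = t * (1 - t) * (norm (h - g))\<^sup>2"
    by (simp add: power2_norm_eq_inner inner_add_left inner_add_right inner_diff_left inner_diff_right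
        inner_commute[of g h] algebra_simps)
  moreover have "0 \<le> t * (1 - t) * (norm (h - g))\<^sup>2" using assms by simp
  ultimately show ?thesis by linarith
qed

text \<open>By convexity of the regularized risks, a bad empirical solution can be moved along the segment
  towards \<open>f_P_lam\<close> until its regularized excess risk equals \<open>approx_err + \<epsilon>\<close>; there
  the norm and the excess risk are under control, so no peeling is needed.\<close>

lemma localization:
  assumes T: "\<And>i. i < n \<Longrightarrow> snd (T i) \<in> Y" and lam: "0 < lam" and \<epsilon>: "0 < \<epsilon>"
    and bad: "approx_err Phi P L lam + \<epsilon> \<le> excess (f_T_lam Phi n T L lam)"
  defines "h0 \<equiv> f_P_lam Phi P L lam"
  obtains h where "lam * (norm h)\<^sup>2 + excess h = approx_err Phi P L lam + \<epsilon>"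
    and "\<epsilon> \<le> (risk P L (rkhs_fun Phi h) - emp_risk n T L (rkhs_fun Phi h))
        - (risk P L (rkhs_fun Phi h0) - emp_risk n T L (rkhs_fun Phi h0))"
proof -
  define hT where "hT = f_T_lam Phi n T L lam"
  define J where "J h = lam * (norm h)\<^sup>2 + excess h" for h
  define JT where "JT h = lam * (norm h)\<^sup>2 + emp_risk n T L (rkhs_fun Phi h)" for h
  define \<gamma> where "\<gamma> t = (1 - t) *\<^sub>R h0 + t *\<^sub>R hT" for t
  define r where "r = norm h0 + norm hT"
  have J0: "J h0 = approx_err Phi P L lam" by (simp add: J_def h0_def approx_err_def excess_def)
  have \<gamma>r: "\<gamma> t \<in> cball 0 r" if "t \<in> {0..1}" for t
  proof -
    have "norm (\<gamma> t) \<le> norm ((1 - t) *\<^sub>R h0) + norm (t *\<^sub>R hT)"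
      unfolding \<gamma>_def by (rule norm_triangle_ineq)
    also have "\<dots> \<le> 1 * norm h0 + 1 * norm hT"
      using that by (auto intro!: add_mono mult_left_le_one_le)
    finally show ?thesis by (simp add: r_def)
  qed
  \<comment> \<open>The Lipschitz constant of the loss grows with the norm, so continuity is
    obtained on a ball that contains the whole segment.\<close>
  have "lipschitz_on (cL * r powr (\<alpha> - 1)) (cball 0 r) (\<lambda>h. risk P L (rkhs_fun Phi h))"
    using risk_lipschitz[of _ r] cL_pos by (intro lipschitz_onI) (auto simp: dist_norm)
  then have "continuous_on (cball 0 r) (\<lambda>h. risk P L (rkhs_fun Phi h))"
    by (rule lipschitz_on_continuous_on)
  then have cJ: "continuous_on (cball 0 r) J"
    unfolding J_def excess_def by (intro continuous_intros)
  have c\<gamma>: "continuous_on {0..1} \<gamma>" unfolding \<gamma>_def by (intro continuous_intros)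
  have "\<gamma> ` {0..1} \<subseteq> cball 0 r" using \<gamma>r by blast
  with cJ c\<gamma> have "continuous_on {0..1} (\<lambda>t. J (\<gamma> t))" by (rule continuous_on_compose2)
  moreover have "J (\<gamma> 0) \<le> approx_err Phi P L lam + \<epsilon>" using J0 \<epsilon> by (simp add: \<gamma>_def)
  moreover have "approx_err Phi P L lam + \<epsilon> \<le> J (\<gamma> 1)"
  proof -
    have "excess hT \<le> J hT" using lam by (simp add: J_def)
    then show ?thesis using bad by (simp add: \<gamma>_def hT_def[symmetric])
  qed
  ultimately obtain t where t: "0 \<le> t" "t \<le> 1" "J (\<gamma> t) = approx_err Phi P L lam + \<epsilon>"
    using IVT'[of "\<lambda>t. J (\<gamma> t)" 0 "approx_err Phi P L lam + \<epsilon>" 1] by auto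
  have "JT (\<gamma> t) \<le> (1 - t) * JT h0 + t * JT hT"
  proof -
    have "lam * (norm (\<gamma> t))\<^sup>2 \<le> lam * ((1 - t) * (norm h0)\<^sup>2 + t * (norm hT)\<^sup>2)"
      unfolding \<gamma>_def using norm_square_convex[OF t(1,2)] lam by (intro mult_left_mono) auto
    moreover have "emp_risk n T L (rkhs_fun Phi (\<gamma> t))
        \<le> (1 - t) * emp_risk n T L (rkhs_fun Phi h0) + t * emp_risk n T L (rkhs_fun Phi hT)"
    proof -
      have "convex_on UNIV (\<lambda>h. emp_risk n T L (rkhs_fun Phi h))" using T by (rule emp_risk_properties(2))
      from convex_onD[OF this, of t h0 hT] show ?thesis using t by (simp add: \<gamma>_def)
    qed
    ultimately show ?thesis by (simp add: JT_def algebra_simps)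
  qed
  also have "\<dots> \<le> (1 - t) * JT h0 + t * JT h0"
    using f_T_lam_minimal[OF T lam, where g = h0] t by (simp add: JT_def hT_def mult_left_mono)
  also have "\<dots> = JT h0" by (simp add: algebra_simps)
  finally have "JT (\<gamma> t) \<le> JT h0" .
  \<comment> \<open>Subtracting \<open>JT (\<gamma> t) \<le> JT h0\<close> from the equation
    J(\<open>\<gamma> t\<close>) - J(\<open>h0\<close>) = \<open>\<epsilon>\<close> cancels the
    regularization terms and the Bayes risk.\<close>
  then show thesis
    using t(3) J0 by (intro that[of "\<gamma> t"]) (auto simp: J_def JT_def excess_def)
qed

text \<open>Localization puts \<open>h\<close> and \<open>h0\<close> into the class
  \<open>V\<close>, and \<open>h\<close> is replaced by a member of a finite net of
  \<open>V\<close>. This costs \<open>\<epsilon> / 4\<close> in the risk and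
  \<open>\<epsilon> / 4\<close> in the empirical risk, so a deviation \<open>\<epsilon> / 2\<close>
  remains for the finite class. The good event need not be measurable, but it contains the
  complement of the measurable set \<open>Bad\<close>, and so does each of its measurable
  supersets.\<close>

lemma outer_prob_oracle_inequality:
  fixes n :: nat and lam \<epsilon> x s2 R B :: real
  assumes n: "1 \<le> n" and lam: "0 < lam" and \<epsilon>: "0 < \<epsilon>" and x: "1 \<le> x"
    and appr: "approx_err Phi P L lam \<le> \<epsilon>"
    and R_eq: "R = sqrt (2 * (\<epsilon> / lam))" and B_eq: "B = 2 * cL * R powr \<alpha>"
    and s2: "0 < s2" and Bs2: "B * (\<epsilon> / 2) \<le> s2"
    and vs2: "4 * c * (R + 1) powr v * (2 * \<epsilon>) powr theta \<le> s2"
    and h1: "dev_const p * (a * B powr p) * sqrt s2 powr (2 - p) \<le> real n * (\<epsilon> / 2)\<^sup>2"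
    and h2: "dev_const p * x * s2 \<le> real n * (\<epsilon> / 2)\<^sup>2"
  shows "1 - exp (- x) \<le> outer_prob (PiM {..<n} (\<lambda>_. P))
      {T \<in> space (PiM {..<n} (\<lambda>_. P)).
        risk P L (rkhs_fun Phi (f_T_lam Phi n T L lam)) - bayes_risk P L < approx_err Phi P L lam + \<epsilon>}"
proof -
  let ?Pn = "PiM {..<n} (\<lambda>_. P)"
  interpret Pn: prob_space ?Pn by (intro prob_space_PiM P_prob)
  define h0 where "h0 = f_P_lam Phi P L lam"
  define V where "V = {h. norm h \<le> R \<and> excess h \<le> 2 * \<epsilon>}"
  define l where "l = cL * R powr (\<alpha> - 1)"
  have R: "0 < R" using \<epsilon> lam by (simp add: R_eq)
  have l: "0 < l" using cL_pos R by (simp add: l_def)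
  have B: "0 < B" using cL_pos R by (simp add: B_eq)
  \<comment> \<open>On \<open>V\<close> the loss has Lipschitz constant \<open>l\<close>, and two
    functions of norm at most \<open>R\<close> differ by at most \<open>2 * R\<close>; so
    \<open>B\<close> bounds every difference of losses.\<close>
  have Bl: "B = 2 * l * R" using R by (simp add: B_eq l_def powr_diff)
  have inV: "h \<in> V" if "lam * (norm h)\<^sup>2 + excess h \<le> 2 * \<epsilon>" for h
  proof -
    have "lam * (norm h)\<^sup>2 \<le> 2 * \<epsilon>" using that excess_nonneg[of h] by linarith
    then have "(norm h)\<^sup>2 \<le> 2 * (\<epsilon> / lam)" using lam by (simp add: field_simps)
    then have "norm h \<le> R" unfolding R_eq by (rule real_le_rsqrt)
    moreover have "0 \<le> lam * (norm h)\<^sup>2" using lam by simp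
    ultimately show ?thesis using that by (simp add: V_def)
  qed
  have h0V: "h0 \<in> V"
    using appr \<epsilon> by (intro inV) (simp add: h0_def approx_err_def excess_def)
  have norm_V: "norm h \<le> R" and exc_V: "excess h \<le> 2 * \<epsilon>" if "h \<in> V" for h using that by (auto simp: V_def)
  have "\<exists>S\<subseteq>V. finite S \<and> (\<forall>h\<in>V. \<exists>s\<in>S. \<forall>x. \<bar>h \<bullet> Phi x - s \<bullet> Phi x\<bar> \<le> \<epsilon> / (4 * l))"
    by (rule finite_sup_net[OF X_compact continuous_Phi norm_V]) (use \<epsilon> l in auto)
  then obtain S where S: "S \<subseteq> V" "finite S"
    and net: "\<And>h. h \<in> V \<Longrightarrow> \<exists>s\<in>S. \<forall>x. \<bar>h \<bullet> Phi x - s \<bullet> Phi x\<bar> \<le> \<epsilon> / (4 * l)"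
    by auto
  define g where "g s z = loss s z - loss h0 z" for s z
  define Bad where "Bad = {T \<in> space ?Pn. \<exists>s\<in>S.
      real n * (\<epsilon> / 2) \<le> real n * (\<integral>z. g s z \<partial>P) - (\<Sum>i<n. g s (T i))}"
  have lip: "\<bar>loss h z - loss h' z\<bar> \<le> l * \<bar>h \<bullet> Phi (fst z) - h' \<bullet> Phi (fst z)\<bar>"
    if "h \<in> V" "h' \<in> V" "z \<in> space P" for h h' z
    unfolding l_def by (rule loss_lipschitz) (use that norm_V in auto)
  have dev: "Bad \<in> sets ?Pn" "measure ?Pn Bad \<le> exp (- x)"
  proof -
    have meas: "g s \<in> borel_measurable P" for s
      unfolding g_def[abs_def] by (intro borel_measurable_diff measurable_loss)
    have bound: "\<bar>g s z\<bar> \<le> B" if "s \<in> S" "z \<in> space P" for s z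
    proof -
      have sV: "s \<in> V" using that S by blast
      have "\<bar>g s z\<bar> \<le> l * \<bar>s \<bullet> Phi (fst z) - h0 \<bullet> Phi (fst z)\<bar>"
        unfolding g_def by (rule lip[OF sV h0V that(2)])
      also have "\<dots> \<le> l * (2 * R)"
        using l inner_Phi_le[of s "fst z"] inner_Phi_le[of h0 "fst z"] norm_V[OF sV] norm_V[OF h0V]
        by (intro mult_left_mono) auto
      finally show ?thesis by (simp add: Bl)
    qed
    have var: "(\<integral>z. (g s z)\<^sup>2 \<partial>P) \<le> s2" if "s \<in> S" for s
    proof -
      have "s \<in> V" using that S by blast
      then show ?thesis
        unfolding g_def using second_moment_loss_diff[of s R "2 * \<epsilon>" h0] norm_V exc_V h0V vs2
        by fastforce
    qed
    have cover: "\<exists>C\<subseteq>S. real (card C) \<le> exp (a * B powr p * \<delta> powr - p) \<and>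
        (\<forall>s\<in>S. \<exists>c\<in>C. (\<Sum>i<n + n. (g s (\<omega> i) - g c (\<omega> i))\<^sup>2) \<le> 2 * real n * \<delta>\<^sup>2)"
      if \<delta>: "0 < \<delta>" and \<omega>: "\<And>i. i < n + n \<Longrightarrow> \<omega> i \<in> space P" for \<omega> \<delta>
    proof -
      have \<delta>B: "0 < \<delta> / B" using \<delta> B by simp
      have n2: "1 \<le> n + n" using n by simp
      have Y: "\<forall>i<n + n. snd (\<omega> i) \<in> Y" using \<omega> by (auto simp: space_P mem_Times_iff)
      \<comment> \<open>The entropy hypothesis is used for the double sample of size
        \<open>n + n\<close> and at scale \<open>\<delta> / B\<close>: the internal cover has radius
        \<open>2 * R * (\<delta> / B)\<close>, which \<open>l\<close> turns into exactly
        \<open>\<delta>\<close> for the losses.\<close>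
      have ent: "ln (real (cov_num_BH Phi (n + n) (fst \<circ> \<omega>) (\<delta> / B))) \<le> a * (\<delta> / B) powr - p"
        using entropy n2 \<delta>B Y by blast
      have SR: "norm s \<le> R" if "s \<in> S" for s using norm_V S that by blast
      have "\<exists>C\<subseteq>S. real (card C) \<le> exp (a * (\<delta> / B) powr - p) \<and>
          (\<forall>s\<in>S. \<exists>c\<in>C. (\<Sum>i<n + n. (s \<bullet> Phi ((fst \<circ> \<omega>) i) - c \<bullet> Phi ((fst \<circ> \<omega>) i))\<^sup>2)
            \<le> real (n + n) * (2 * R * (\<delta> / B))\<^sup>2)"
        by (rule rkhs_internal_cover[OF X_compact continuous_Phi n2 \<delta>B SR R ent])
      then obtain C where C: "C \<subseteq> S" "real (card C) \<le> exp (a * (\<delta> / B) powr - p)"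
        and Cc: "\<forall>s\<in>S. \<exists>c\<in>C. (\<Sum>i<n + n. (s \<bullet> Phi ((fst \<circ> \<omega>) i) - c \<bullet> Phi ((fst \<circ> \<omega>) i))\<^sup>2)
            \<le> real (n + n) * (2 * R * (\<delta> / B))\<^sup>2"
        by (elim exE conjE)
      have E_eq: "a * (\<delta> / B) powr - p = a * B powr p * \<delta> powr - p"
        using \<delta> B by (simp add: powr_divide powr_minus field_simps)
      have "\<exists>c\<in>C. (\<Sum>i<n + n. (g s (\<omega> i) - g c (\<omega> i))\<^sup>2) \<le> 2 * real n * \<delta>\<^sup>2" if s: "s \<in> S" for s
      proof -
        obtain c' where c: "c' \<in> C" and le: "(\<Sum>i<n + n. (s \<bullet> Phi (fst (\<omega> i)) - c' \<bullet> Phi (fst (\<omega> i)))\<^sup>2)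
            \<le> real (n + n) * (2 * R * (\<delta> / B))\<^sup>2"
          using bspec[OF Cc s] unfolding comp_apply by (elim bexE)
        have V: "s \<in> V" "c' \<in> V" using s c C(1) S by auto
        have "(\<Sum>i<n + n. (g s (\<omega> i) - g c' (\<omega> i))\<^sup>2)
            \<le> (\<Sum>i<n + n. l\<^sup>2 * (s \<bullet> Phi (fst (\<omega> i)) - c' \<bullet> Phi (fst (\<omega> i)))\<^sup>2)"
        proof (rule sum_mono)
          fix i assume "i \<in> {..<n + n}"
          then have "\<bar>g s (\<omega> i) - g c' (\<omega> i)\<bar> \<le> l * \<bar>s \<bullet> Phi (fst (\<omega> i)) - c' \<bullet> Phi (fst (\<omega> i))\<bar>"
            using lip[OF V \<omega>[of i]] by (simp add: g_def)
          then have "\<bar>g s (\<omega> i) - g c' (\<omega> i)\<bar>\<^sup>2 \<le> (l * \<bar>s \<bullet> Phi (fst (\<omega> i)) - c' \<bullet> Phi (fst (\<omega> i))\<bar>)\<^sup>2"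
            by (intro power_mono) auto
          then show "(g s (\<omega> i) - g c' (\<omega> i))\<^sup>2 \<le> l\<^sup>2 * (s \<bullet> Phi (fst (\<omega> i)) - c' \<bullet> Phi (fst (\<omega> i)))\<^sup>2"
            by (simp add: power_mult_distrib)
        qed
        also have "\<dots> \<le> l\<^sup>2 * (real (n + n) * (2 * R * (\<delta> / B))\<^sup>2)"
          unfolding sum_distrib_left[symmetric] using le by (intro mult_left_mono) auto
        also have "\<dots> = 2 * real n * (B * (\<delta> / B))\<^sup>2"
          unfolding Bl by (simp add: power_mult_distrib power_divide)
        also have "\<dots> = 2 * real n * \<delta>\<^sup>2" using B by simp
        finally show ?thesis using c by blast
      qed
      then show ?thesis using C(1) C(2)[unfolded E_eq] by blast
    qed
    have A: "0 \<le> a * B powr p" using a_ge by simp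
    have \<epsilon>2: "0 < \<epsilon> / 2" using \<epsilon> by simp
    show "Bad \<in> sets ?Pn" "measure ?Pn Bad \<le> exp (- x)"
      unfolding Bad_def
      using empirical_deviation_finite_class[OF P_prob S(2) n B s2 \<epsilon>2 p_pos p_lt A x Bs2 meas bound var cover h1 h2]
      by blast+
  qed
  have sub: "space ?Pn - Bad \<subseteq> {T \<in> space ?Pn.
        risk P L (rkhs_fun Phi (f_T_lam Phi n T L lam)) - bayes_risk P L < approx_err Phi P L lam + \<epsilon>}"
    (is "_ \<subseteq> ?Good")
  proof (rule subsetI, rule ccontr)
    fix T assume T: "T \<in> space ?Pn - Bad" and "T \<notin> ?Good"
    then have bad: "approx_err Phi P L lam + \<epsilon> \<le> excess (f_T_lam Phi n T L lam)"
      by (auto simp: excess_def)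
    have TP: "T i \<in> space P" if "i < n" for i using T that by (auto simp: space_PiM)
    then have TY: "snd (T i) \<in> Y" if "i < n" for i using that by (auto simp: space_P mem_Times_iff)
    obtain h where h: "lam * (norm h)\<^sup>2 + excess h = approx_err Phi P L lam + \<epsilon>"
      and hdev: "\<epsilon> \<le> (risk P L (rkhs_fun Phi h) - emp_risk n T L (rkhs_fun Phi h))
        - (risk P L (rkhs_fun Phi h0) - emp_risk n T L (rkhs_fun Phi h0))"
      using localization[OF TY lam \<epsilon> bad] unfolding h0_def by blast
    have hV: "h \<in> V" using h appr by (intro inV) simp
    obtain s where s: "s \<in> S" "\<And>x. \<bar>h \<bullet> Phi x - s \<bullet> Phi x\<bar> \<le> \<epsilon> / (4 * l)" using net[OF hV] by blast
    have sV: "s \<in> V" using s S by blast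
    have near: "\<bar>loss h z - loss s z\<bar> \<le> \<epsilon> / 4" if "z \<in> space P" for z
    proof -
      have "\<bar>loss h z - loss s z\<bar> \<le> l * \<bar>h \<bullet> Phi (fst z) - s \<bullet> Phi (fst z)\<bar>" by (rule lip[OF hV sV that])
      also have "\<dots> \<le> l * (\<epsilon> / (4 * l))" using l s(2) by (intro mult_left_mono) auto
      finally show ?thesis using l by simp
    qed
    have rn: "risk P L (rkhs_fun Phi h) \<le> risk P L (rkhs_fun Phi s) + \<epsilon> / 4"
    proof -
      have "(\<integral>z. loss h z \<partial>P) \<le> (\<integral>z. loss s z + \<epsilon> / 4 \<partial>P)"
      proof (rule integral_mono)
        fix z assume "z \<in> space P"
        from near[OF this] show "loss h z \<le> loss s z + \<epsilon> / 4" by linarith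
      qed (auto intro!: integrable_loss)
      then show ?thesis using integrable_loss by (simp add: risk_eq prob_space)
    qed
    have emp: "real n * emp_risk n T L (rkhs_fun Phi f) = (\<Sum>i<n. loss f (T i))" for f
      using n by (simp add: emp_risk_def loss_def rkhs_fun_def)
    have en: "(\<Sum>i<n. loss s (T i)) \<le> (\<Sum>i<n. loss h (T i)) + real n * (\<epsilon> / 4)"
    proof -
      have "(\<Sum>i<n. loss s (T i)) \<le> (\<Sum>i<n. loss h (T i) + \<epsilon> / 4)"
      proof (rule sum_mono)
        fix i assume "i \<in> {..<n}"
        then have "\<bar>loss h (T i) - loss s (T i)\<bar> \<le> \<epsilon> / 4" by (intro near TP) simp
        then show "loss s (T i) \<le> loss h (T i) + \<epsilon> / 4" by linarith
      qed
      then show ?thesis by (simp add: sum.distrib)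
    qed
    have "real n * \<epsilon> \<le> real n * ((risk P L (rkhs_fun Phi h) - emp_risk n T L (rkhs_fun Phi h))
        - (risk P L (rkhs_fun Phi h0) - emp_risk n T L (rkhs_fun Phi h0)))"
      using hdev by (intro mult_left_mono) auto
    also have "\<dots> = real n * risk P L (rkhs_fun Phi h) - (\<Sum>i<n. loss h (T i))
        - real n * risk P L (rkhs_fun Phi h0) + (\<Sum>i<n. loss h0 (T i))"
      unfolding emp[symmetric] by (simp add: right_diff_distrib)
    finally have 1: "real n * \<epsilon> \<le> \<dots>" .
    have 2: "real n * risk P L (rkhs_fun Phi h) \<le> real n * risk P L (rkhs_fun Phi s) + real n * (\<epsilon> / 4)"
      using mult_left_mono[OF rn, of "real n"] by (simp only: distrib_left)
    have "real n * (\<integral>z. g s z \<partial>P) = real n * risk P L (rkhs_fun Phi s) - real n * risk P L (rkhs_fun Phi h0)"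
      using integrable_loss by (simp add: g_def risk_eq right_diff_distrib)
    moreover have "(\<Sum>i<n. g s (T i)) = (\<Sum>i<n. loss s (T i)) - (\<Sum>i<n. loss h0 (T i))"
      by (simp add: g_def sum_subtractf)
    moreover have "real n * (\<epsilon> / 4) = real n * \<epsilon> / 4" "real n * (\<epsilon> / 2) = real n * \<epsilon> / 2" by simp_all
    ultimately have "real n * (\<epsilon> / 2) \<le> real n * (\<integral>z. g s z \<partial>P) - (\<Sum>i<n. g s (T i))"
      using 1 2 en by linarith
    then have "T \<in> Bad" using T s(1) by (auto simp: Bad_def)
    then show False using T by blast
  qed
  show ?thesis
    unfolding outer_prob_def
  proof (rule cInf_greatest)
    show "{measure ?Pn A |A. A \<in> sets ?Pn \<and> ?Good \<subseteq> A} \<noteq> {}"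
      by (auto intro!: exI[of _ "space ?Pn"])
  next
    fix r assume "r \<in> {measure ?Pn A |A. A \<in> sets ?Pn \<and> ?Good \<subseteq> A}"
    then obtain A where A: "r = measure ?Pn A" "A \<in> sets ?Pn" "?Good \<subseteq> A" by blast
    have "1 - exp (- x) \<le> 1 - measure ?Pn Bad" using dev(2) by simp
    also have "\<dots> = measure ?Pn (space ?Pn - Bad)" using Pn.prob_compl[OF dev(1)] by simp
    also have "\<dots> \<le> measure ?Pn A" using A sub by (intro Pn.finite_measure_mono) auto
    finally show "1 - exp (- x) \<le> r" by (simp add: A(1))
  qed
qed

text \<open>\<open>K\<close> is built from \<open>c\<close>, \<open>cL\<close> and \<open>p\<close>
  alone. The conditions on \<open>\<epsilon>\<close> are inverted and rescaled into
  \<open>k1\<close> to \<open>k4\<close>, which are the inputs of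
  \<open>localized_scales\<close>.\<close>

lemma oracle_inequality:
  "\<exists>K\<ge>1. \<forall>n::nat. \<forall>lam \<epsilon> x :: real.
      n \<ge> 1 \<and> 0 < lam \<and> lam \<le> 1 \<and> 0 < \<epsilon> \<and> 1 \<le> x \<and>
      ereal \<epsilon> \<ge> max (ereal (approx_err Phi P L lam + lam))
        (max (epow (K * a / (lam powr ((2 * \<alpha> * p + v * (2 - p)) / 4) * real n))
                   4 (8 - 2 * \<alpha> * p - (v + 2 * theta) * (2 - p)))
        (max (epow (K * a / (lam powr (\<alpha> * (2 + p) / 4) * real n)) 4 ((2 + p) * (2 - \<alpha>)))
        (max (epow (K * x / (lam powr (v / 2) * real n)) 2 (4 - v - 2 * theta))
             (epow (K * x / (lam powr (\<alpha> / 2) * real n)) 2 (2 - \<alpha>)))))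
      \<longrightarrow> outer_prob (PiM {..<n} (\<lambda>_. P))
            {T \<in> space (PiM {..<n} (\<lambda>_. P)).
               risk P L (rkhs_fun Phi (f_T_lam Phi n T L lam)) - bayes_risk P L
                 < approx_err Phi P L lam + \<epsilon>}
          \<ge> 1 - exp (- x)"
proof -
  define C0 where "C0 = 72 * c + 4 * cL"
  define K where "K = 16 * dev_const p * (4 * cL) powr p * C0 powr ((2 - p) / 2) + 8 * dev_const p * C0"
  have dc: "1 \<le> dev_const p" using chain_const_ge[OF p_pos p_lt] by (simp add: dev_const_def)
  have K1: "1 \<le> K"
  proof -
    have "1 * 1 \<le> dev_const p * C0" using dc c_ge cL_pos by (intro mult_mono) (auto simp: C0_def)
    moreover have "0 \<le> 16 * dev_const p * (4 * cL) powr p * C0 powr ((2 - p) / 2)" using dc by simp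
    ultimately show ?thesis unfolding K_def by linarith
  qed
  show ?thesis
  proof (intro exI[of _ K] conjI allI impI K1, elim conjE)
    fix n :: nat and lam \<epsilon> x :: real
    assume n: "1 \<le> n" and lam: "0 < lam" and \<epsilon>: "0 < \<epsilon>" and x: "1 \<le> x"
      and mx: "max (ereal (approx_err Phi P L lam + lam))
        (max (epow (K * a / (lam powr ((2 * \<alpha> * p + v * (2 - p)) / 4) * real n))
                   4 (8 - 2 * \<alpha> * p - (v + 2 * theta) * (2 - p)))
        (max (epow (K * a / (lam powr (\<alpha> * (2 + p) / 4) * real n)) 4 ((2 + p) * (2 - \<alpha>)))
        (max (epow (K * x / (lam powr (v / 2) * real n)) 2 (4 - v - 2 * theta))
             (epow (K * x / (lam powr (\<alpha> / 2) * real n)) 2 (2 - \<alpha>))))) \<le> ereal \<epsilon>"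
    have e0: "approx_err Phi P L lam + lam \<le> \<epsilon>"
      and e1: "epow (K * a / (lam powr ((2 * \<alpha> * p + v * (2 - p)) / 4) * real n))
                   4 (8 - 2 * \<alpha> * p - (v + 2 * theta) * (2 - p)) \<le> ereal \<epsilon>"
      and e2: "epow (K * a / (lam powr (\<alpha> * (2 + p) / 4) * real n)) 4 ((2 + p) * (2 - \<alpha>)) \<le> ereal \<epsilon>"
      and e3: "epow (K * x / (lam powr (v / 2) * real n)) 2 (4 - v - 2 * theta) \<le> ereal \<epsilon>"
      and e4: "epow (K * x / (lam powr (\<alpha> / 2) * real n)) 2 (2 - \<alpha>) \<le> ereal \<epsilon>"
      using mx by simp_all
    have "0 \<le> approx_err Phi P L lam"
    proof -
      have "0 \<le> lam * (norm (f_P_lam Phi P L lam))\<^sup>2" using lam by simp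
      then show ?thesis
        using excess_nonneg[of "f_P_lam Phi P L lam"] unfolding approx_err_def excess_def by linarith
    qed
    then have appr: "approx_err Phi P L lam \<le> \<epsilon>" and lam\<epsilon>: "lam \<le> \<epsilon>" using e0 lam by linarith+
    define G where "G = \<epsilon> / lam"
    have G: "1 \<le> G" using lam lam\<epsilon> by (simp add: G_def)
    have n0: "0 < real n" using n by simp
    have pos: "0 < K * a / (lam powr e * real n)" "0 < K * x / (lam powr e * real n)" for e
      using K1 a_ge x lam n by simp_all
    \<comment> \<open>This rewriting of the denominator of the first exponent shows its sign. It
      vanishes exactly for \<open>v = 2\<close>, \<open>theta = 1\<close>,
      \<open>\<alpha> = 2\<close>, the case settled by the convention in
      \<open>epow\<close>.\<close>
    have "0 \<le> (2 - p) * (4 - v - 2 * theta) + 2 * p * (2 - \<alpha>)"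
      using p_pos p_lt v_le theta_le \<alpha>_le by simp
    then have den1: "0 \<le> 8 - 2 * \<alpha> * p - (v + 2 * theta) * (2 - p)" by (simp add: algebra_simps)
    have den2: "0 \<le> (2 + p) * (2 - \<alpha>)" using p_pos \<alpha>_le by simp
    have k1: "K * a * G powr ((2 * \<alpha> * p + v * (2 - p)) / 4) \<le> real n * \<epsilon> powr (2 - theta * (2 - p) / 2)"
      unfolding G_def
      by (rule rescale_condition[OF le_powr_of_epow_le[OF e1 pos(1) _ den1 \<epsilon>] lam n0 \<epsilon>])
         (use p_pos in \<open>simp_all add: field_simps\<close>)
    have k2: "K * a * G powr (\<alpha> * (2 + p) / 4) \<le> real n * \<epsilon> powr ((2 + p) / 2)"
      unfolding G_def
      by (rule rescale_condition[OF le_powr_of_epow_le[OF e2 pos(1) _ den2 \<epsilon>] lam n0 \<epsilon>])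
         (use p_pos \<alpha>_le in \<open>simp_all add: field_simps\<close>)
    have k3: "K * x * G powr (v / 2) \<le> real n * \<epsilon> powr (2 - theta)"
      unfolding G_def
      by (rule rescale_condition[OF le_powr_of_epow_le[OF e3 pos(2) _ _ \<epsilon>] lam n0 \<epsilon>])
         (use v_le theta_le in \<open>simp_all add: field_simps\<close>)
    have k4: "K * x * G powr (\<alpha> / 2) \<le> real n * \<epsilon> powr 1"
      unfolding G_def
      by (rule rescale_condition[OF le_powr_of_epow_le[OF e4 pos(2) _ _ \<epsilon>] lam n0 \<epsilon>])
         (use \<alpha>_le in \<open>simp_all add: field_simps\<close>)
    note sc = localized_scales[OF G n0 \<epsilon> a_ge x p_pos p_lt \<alpha>_ge \<alpha>_le cL_pos c_ge theta_pos theta_le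
      v_nonneg v_le dc _ k1 k2 k3 k4]
    have K_le: "16 * dev_const p * (4 * cL) powr p * (72 * c + 4 * cL) powr ((2 - p) / 2)
        + 8 * dev_const p * (72 * c + 4 * cL) \<le> K"
      by (simp add: K_def C0_def)
    show "1 - exp (- x) \<le> outer_prob (PiM {..<n} (\<lambda>_. P))
            {T \<in> space (PiM {..<n} (\<lambda>_. P)).
               risk P L (rkhs_fun Phi (f_T_lam Phi n T L lam)) - bayes_risk P L
                 < approx_err Phi P L lam + \<epsilon>}"
      by (rule outer_prob_oracle_inequality[OF n lam \<epsilon> x appr refl refl
          sc(1)[OF K_le, unfolded G_def] sc(2)[OF K_le, unfolded G_def] sc(3)[OF K_le, unfolded G_def]
          sc(4)[OF K_le, unfolded G_def] sc(5)[OF K_le, unfolded G_def]])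
  qed
qed

end

theorem theorem2p1:
  fixes Phi :: "'x::metric_space \<Rightarrow> 'h::{real_inner,complete_space}"
    and Y :: "real set"
    and P :: "('x \<times> real) measure"
    and L :: "real \<Rightarrow> real \<Rightarrow> real"
    and fstar :: "'x \<Rightarrow> real"
    and a p \<alpha> cL c theta v :: real
  assumes X_compact: "compact (UNIV :: 'x set)"
    and Y_compact: "compact Y" and Y_sub: "Y \<subseteq> {-1..1}"
    and H_rkhs: "is_rkhs_cont_kernel Phi"
    and H_sup: "\<forall>h x. \<bar>rkhs_fun Phi h x\<bar> \<le> norm h"
    and a_ge: "a \<ge> 1" and p_pos: "0 < p" and p_lt: "p < 2"
    and entropy: "\<forall>n::nat. n \<ge> 1 \<longrightarrow> (\<forall>\<delta>>0. \<forall>T :: nat \<Rightarrow> 'x \<times> real.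
        (\<forall>i<n. snd (T i) \<in> Y) \<longrightarrow>
        ln (real (cov_num_BH Phi n (fst \<circ> T) \<delta>)) \<le> a * \<delta> powr (- p))"
    and L_nonneg: "\<forall>y\<in>Y. \<forall>t. 0 \<le> L y t"
    and L_cont: "continuous_on (Y \<times> UNIV) (\<lambda>(y, t). L y t)"
    and L_convex: "\<forall>y\<in>Y. convex_on UNIV (L y)"
    and \<alpha>_ge: "1 \<le> \<alpha>" and \<alpha>_le: "\<alpha> \<le> 2" and cL_pos: "0 < cL"
    and L_growth: "\<forall>y\<in>Y. \<forall>t. L y t \<le> 1 + \<bar>t\<bar> powr \<alpha>"
    and L_lip: "\<forall>t\<ge>0. \<forall>y\<in>Y. lipschitz_on (cL * t powr (\<alpha> - 1)) {-t..t} (L y)"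
    and P_prob: "prob_space P"
    and P_sets: "sets P = sets (restrict_space borel (UNIV \<times> Y))"
    and fstar_meas: "fstar \<in> borel_measurable borel"
    and fstar_int: "integrable P (\<lambda>z. L (snd z) (fstar (fst z)))"
    and fstar_min: "risk P L fstar = bayes_risk P L"
    and c_ge: "c \<ge> 1" and theta_pos: "0 < theta" and theta_le: "theta \<le> 1"
    and v_nonneg: "0 \<le> v" and v_le: "v \<le> 2"
    and variance: "\<forall>lam. 0 < lam \<and> lam \<le> 1 \<longrightarrow> (\<forall>h. norm h \<le> lam powr (- 1 / 2) \<longrightarrow>
        (\<integral>\<^sup>+ z. ennreal ((L (snd z) (rkhs_fun Phi h (fst z)) - L (snd z) (fstar (fst z)))\<^sup>2) \<partial>P)
        \<le> ennreal (c * (sup_norm (rkhs_fun Phi h) + 1) powr v *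
             (\<integral> z. L (snd z) (rkhs_fun Phi h (fst z)) - L (snd z) (fstar (fst z)) \<partial>P) powr theta))"
  shows "\<exists>K\<ge>1. \<forall>n::nat. \<forall>lam \<epsilon> x :: real.
      n \<ge> 1 \<and> 0 < lam \<and> lam \<le> 1 \<and> 0 < \<epsilon> \<and> 1 \<le> x \<and>
      ereal \<epsilon> \<ge> max (ereal (approx_err Phi P L lam + lam))
        (max (epow (K * a / (lam powr ((2 * \<alpha> * p + v * (2 - p)) / 4) * real n))
                   4 (8 - 2 * \<alpha> * p - (v + 2 * theta) * (2 - p)))
        (max (epow (K * a / (lam powr (\<alpha> * (2 + p) / 4) * real n)) 4 ((2 + p) * (2 - \<alpha>)))
        (max (epow (K * x / (lam powr (v / 2) * real n)) 2 (4 - v - 2 * theta))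
             (epow (K * x / (lam powr (\<alpha> / 2) * real n)) 2 (2 - \<alpha>)))))
      \<longrightarrow> outer_prob (PiM {..<n} (\<lambda>_. P))
            {T \<in> space (PiM {..<n} (\<lambda>_. P)).
               risk P L (rkhs_fun Phi (f_T_lam Phi n T L lam)) - bayes_risk P L
                 < approx_err Phi P L lam + \<epsilon>}
          \<ge> 1 - exp (- x)"
proof -
  interpret kernel_machine Phi Y P L fstar a p \<alpha> cL c theta v
    by (rule kernel_machine.intro) (fact assms)+
  show ?thesis by (rule oracle_inequality)
qed

end
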